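(* Let $\mathbb{G}$ be a stratified group, $\Omega\subset\mathbb{G}$ open and $f:\Omega\to\mathbb{G}$ continuously P-differentiable, and assume $Df(\overline x):\mathbb{G}\to\mathbb{G}$ is invertible for some $\overline x\in\Omega$. Then there is a neighbourhood $U$ of $\overline x$ such that $f|_U$ has an inverse mapping $g:f(U)\to U$ which is P-differentiable, and $Dg(y)=Df(g(y))^{-1}$ for every $y\in f(U)$.
   Context: Graded group: connected simply connected real Lie group with Lie algebra $V_1\oplus\cdots\oplus V_\iota$, $[V_i,V_j]\subset V_{i+j}$; stratified if $[V_i,V_j]=V_{i+j}$; dilations act by $r^i$ on $V_i$. Homogeneous distance $d$: continuous, left invariant, 1-homogeneous under dilations. h-homomorphism: group homomorphism commuting with dilations. $f$ is P-differentiable at $x$ if there is an h-homomorphism $Df(x)$ with $d(f(x)^{-1}f(xh),Df(x)(h))/d(h,e)\to0$ as $h\to e$; continuously P-differentiable: P-differentiable everywhere with $x\mapsto\exp^{-1}\circ Df(x)\circ\exp$ continuous. *)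

theory Defs
  imports "HOL-Analysis.Analysis"
begin

text \<open>We model a graded group in exponential coordinates: the underlying space is the
Lie algebra (a finite-dimensional real vector space 'v), exp is the identity, and the group
law is the Baker-Campbell-Hausdorff (Dynkin) product, which is a finite sum because the
algebra is nilpotent of step k. The identity is 0 and the inverse of v is -v.\<close>

fun rbr :: "('v::real_vector \<Rightarrow> 'v \<Rightarrow> 'v) \<Rightarrow> 'v list \<Rightarrow> 'v" where
  "rbr br [] = 0"
| "rbr br [a] = a"
| "rbr br (a # b # cs) = br a (rbr br (b # cs))"

definition dword :: "'v \<Rightarrow> 'v \<Rightarrow> (nat \<times> nat) list \<Rightarrow> 'v list" where
  "dword X Y ps = concat (map (\<lambda>(r, s). replicate r X @ replicate s Y) ps)"

definition dlen :: "(nat \<times> nat) list \<Rightarrow> nat" where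
  "dlen ps = sum_list (map (\<lambda>(r, s). r + s) ps)"

text \<open>Dynkin's formula, truncated at total degree k (terms of higher degree vanish in a
nilpotent Lie algebra of step k).\<close>
definition bch :: "('v::real_vector \<Rightarrow> 'v \<Rightarrow> 'v) \<Rightarrow> nat \<Rightarrow> 'v \<Rightarrow> 'v \<Rightarrow> 'v" where
  "bch br k X Y =
    (\<Sum>n\<in>{1..k}. ((-1) ^ (n - 1) / real n) *\<^sub>R
      (\<Sum>ps\<in>{ps. length ps = n \<and> set ps \<subseteq> {0..k} \<times> {0..k}
                 \<and> (\<forall>(r, s)\<in>set ps. 0 < r + s) \<and> dlen ps \<le> k}.
         (1 / (real (dlen ps) * prod_list (map (\<lambda>(r, s). real (fact r * fact s)) ps)))
           *\<^sub>R rbr br (dword X Y ps)))"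

definition graded_lie_algebra ::
  "('v::euclidean_space \<Rightarrow> 'v \<Rightarrow> 'v) \<Rightarrow> (nat \<Rightarrow> 'v set) \<Rightarrow> nat \<Rightarrow> bool" where
  "graded_lie_algebra br V k \<longleftrightarrow>
     bilinear br
   \<and> (\<forall>x y. br x y = - br y x)
   \<and> (\<forall>x y z. br x (br y z) + br y (br z x) + br z (br x y) = 0)
   \<and> 1 \<le> k
   \<and> (\<forall>i. subspace (V i))
   \<and> (\<forall>i. (i = 0 \<or> k < i) \<longrightarrow> V i = {0})
   \<and> (\<forall>v. \<exists>!w. (\<forall>i. w i \<in> V i) \<and> (\<forall>i. i \<notin> {1..k} \<longrightarrow> w i = 0) \<and> v = (\<Sum>i=1..k. w i))
   \<and> (\<forall>i j x y. x \<in> V i \<longrightarrow> y \<in> V j \<longrightarrow> br x y \<in> V (i + j))"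

definition stratified ::
  "('v::euclidean_space \<Rightarrow> 'v \<Rightarrow> 'v) \<Rightarrow> (nat \<Rightarrow> 'v set) \<Rightarrow> nat \<Rightarrow> bool" where
  "stratified br V k \<longleftrightarrow> graded_lie_algebra br V k
     \<and> (\<forall>i j. 1 \<le> i \<longrightarrow> 1 \<le> j \<longrightarrow> span {br x y | x y. x \<in> V i \<and> y \<in> V j} = V (i + j))"

definition gcomp :: "(nat \<Rightarrow> 'v::real_vector set) \<Rightarrow> nat \<Rightarrow> 'v \<Rightarrow> nat \<Rightarrow> 'v" where
  "gcomp V k v = (THE w. (\<forall>i. w i \<in> V i) \<and> (\<forall>i. i \<notin> {1..k} \<longrightarrow> w i = 0) \<and> v = (\<Sum>i=1..k. w i))"

definition dil :: "(nat \<Rightarrow> 'v::real_vector set) \<Rightarrow> nat \<Rightarrow> real \<Rightarrow> 'v \<Rightarrow> 'v" where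
  "dil V k r v = (\<Sum>i=1..k. (r ^ i) *\<^sub>R gcomp V k v i)"

definition h_hom ::
  "('v::real_vector \<Rightarrow> 'v \<Rightarrow> 'v) \<Rightarrow> (nat \<Rightarrow> 'v set) \<Rightarrow> nat \<Rightarrow> ('v \<Rightarrow> 'v) \<Rightarrow> bool" where
  "h_hom br V k L \<longleftrightarrow>
     (\<forall>a b. L (bch br k a b) = bch br k (L a) (L b))
   \<and> (\<forall>r>0. \<forall>a. L (dil V k r a) = dil V k r (L a))"

definition hom_dist ::
  "('v::euclidean_space \<Rightarrow> 'v \<Rightarrow> 'v) \<Rightarrow> (nat \<Rightarrow> 'v set) \<Rightarrow> nat \<Rightarrow> ('v \<Rightarrow> 'v \<Rightarrow> real) \<Rightarrow> bool" where
  "hom_dist br V k d \<longleftrightarrow>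
     (\<forall>x y. d x y = 0 \<longleftrightarrow> x = y)
   \<and> (\<forall>x y. d x y = d y x)
   \<and> (\<forall>x y z. d x z \<le> d x y + d y z)
   \<and> continuous_on UNIV (\<lambda>p. d (fst p) (snd p))
   \<and> (\<forall>z x y. d (bch br k z x) (bch br k z y) = d x y)
   \<and> (\<forall>r>0. \<forall>x y. d (dil V k r x) (dil V k r y) = r * d x y)"

text \<open>L is the P-differential of f at x (group inverse is -v, identity is 0).\<close>
definition P_diff ::
  "('v::euclidean_space \<Rightarrow> 'v \<Rightarrow> 'v) \<Rightarrow> (nat \<Rightarrow> 'v set) \<Rightarrow> nat \<Rightarrow> ('v \<Rightarrow> 'v \<Rightarrow> real)
     \<Rightarrow> ('v \<Rightarrow> 'v) \<Rightarrow> 'v \<Rightarrow> ('v \<Rightarrow> 'v) \<Rightarrow> bool" where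
  "P_diff br V k d f x L \<longleftrightarrow> h_hom br V k L
     \<and> ((\<lambda>h. d (bch br k (- f x) (f (bch br k x h))) (L h) / d h 0) \<longlongrightarrow> 0) (at 0)"

end

theory Submission
  imports Defs
begin

text \<open>The group axioms for Dynkin's formula come from a faithful nilpotent representation
\<open>\<rho>\<close> of the graded Lie algebra, the adjoint representation of its semidirect product with the
grading derivation. Along the ray \<open>t \<mapsto> (t x, t y)\<close>, the logarithm of
\<open>exp (t \<rho> x) exp (t \<rho> y)\<close> and the image under \<open>\<rho>\<close> of Dynkin's formula have the same
derivative, so \<open>exp \<circ> \<rho>\<close> turns the formula into multiplication.

Since the algebra is stratified, every point \<open>h\<close> is a product of boundedly many horizontal factors
\<open>t X\<close> with \<open>X\<close> in a finite subset of the first layer and \<open>t\<close> at most a multiple of the distance of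
\<open>h\<close> to the identity. Along each horizontal segment the map \<open>f\<close> traces a horizontal curve whose
velocity is close to the constant \<open>Df xbar X\<close>; integrating and composing the segments yields strict
differentiability of \<open>f\<close> at \<open>xbar\<close>. If the differential is invertible, \<open>f\<close> is bi-Lipschitz near
\<open>xbar\<close>, so its image is open by invariance of domain, every differential near \<open>xbar\<close> is bijective,
and the inverse is P-differentiable.\<close>

subsection \<open>Power series of nilpotent operators\<close>

unbundle no vec_syntax and fps_syntax

text \<open>The group law is given only as Dynkin's truncated sum, so even associativity has to be
  proved. The adjoint representation alone loses the centre; the grading derivation restores it
  because all weights are nonzero. The two derivatives along the ray agree because the words with n
  + 1 blocks add up to the n-th power of e^(ad x) e^(ad y) - 1 applied to x + e^(ad x) y, while the
  factor one over the word length cancels on differentiation.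

  On the analytic side the distance is only left invariant: an error followed by further factors is
  conjugated by them. After a dilation this distortion is uniformly controlled, and the bound on the
  number of factors keeps the accumulated error small. Paths that leave the horizontal directions
  need not have finite length, so estimates are integrated along horizontal segments only. Since
  finitely many directions X occur, continuity of \<open>Df x X\<close> in x for each of them yields
  one common radius. Strict differentiability compares all pairs of points near \<open>xbar\<close>,
  which is what injectivity on a neighbourhood requires.\<close>

lemma sum_square_triangle:
  fixes \<phi> :: "nat \<Rightarrow> nat \<Rightarrow> 'a::comm_monoid_add"
  assumes "\<And>i j. k < i + j \<Longrightarrow> \<phi> i j = 0"
  shows "(\<Sum>i\<le>k. \<Sum>j\<le>k. \<phi> i j) = (\<Sum>n\<le>k. \<Sum>i\<le>n. \<phi> i (n - i))"
proof -
  have "(\<Sum>i\<le>k. \<Sum>j\<le>k. \<phi> i j) = (\<Sum>(i,j)\<in>{..k}\<times>{..k}. \<phi> i j)"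
    by (simp add: sum.cartesian_product)
  also have "\<dots> = (\<Sum>(i,j)\<in>{(i,j). i + j \<le> k}. \<phi> i j)"
    by (rule sum.mono_neutral_right) (auto intro: assms)
  also have "\<dots> = (\<Sum>n\<le>k. \<Sum>i\<le>n. \<phi> i (n - i))"
    by (rule sum.triangle_reindex_eq)
  finally show ?thesis .
qed

text \<open>Pascal's rule with vector coefficients, the induction step of the two noncommutative
  binomial formulas for \<open>commutator\<close>.\<close>

lemma sum_choose_Suc:
  fixes x :: "nat \<Rightarrow> 'a::real_vector"
  shows "(\<Sum>i\<le>Suc n. real (Suc n choose i) *\<^sub>R x i) = (\<Sum>i\<le>n. real (n choose i) *\<^sub>R (x i + x (Suc i)))"
proof -
  have "(\<Sum>i\<le>Suc n. real (Suc n choose i) *\<^sub>R x i)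
      = x 0 + (\<Sum>i\<le>n. real (n choose Suc i) *\<^sub>R x (Suc i)) + (\<Sum>i\<le>n. real (n choose i) *\<^sub>R x (Suc i))"
    by (simp add: sum.atMost_Suc_shift scaleR_left_distrib sum.distrib del: sum.atMost_Suc)
  also have "x 0 + (\<Sum>i\<le>n. real (n choose Suc i) *\<^sub>R x (Suc i)) = (\<Sum>i\<le>Suc n. real (n choose i) *\<^sub>R x i)"
    by (simp add: sum.atMost_Suc_shift del: sum.atMost_Suc)
  also have "\<dots> = (\<Sum>i\<le>n. real (n choose i) *\<^sub>R x i)"
    by simp
  finally show ?thesis
    by (simp add: sum.distrib scaleR_right_distrib)
qed

text \<open>A formal power series evaluated at an operator and truncated at degree \<open>k\<close>.
  Identities between series carry over once the powers above \<open>k\<close> kill \<open>v\<close>.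
  Nilpotency is asked at that vector only, since for \<open>commutator\<close> it is available on
  the filtration.\<close>

definition fps_ev :: "nat \<Rightarrow> real fps \<Rightarrow> ('a::real_vector \<Rightarrow> 'a) \<Rightarrow> 'a \<Rightarrow> 'a" where
  "fps_ev k F a v = (\<Sum>i\<le>k. (F $ i) *\<^sub>R (a ^^ i) v)"

lemma linear_funpow:
  fixes a :: "'a::real_vector \<Rightarrow> 'a"
  assumes "linear a" shows "linear (a ^^ n)"
proof (induction n)
  case 0 then show ?case by (simp add: linear_iff)
next
  case (Suc n) then show ?case using linear_compose[OF Suc assms] by (simp add: o_def)
qed

lemma fps_ev_mult:
  assumes a: "linear a" and nil: "\<And>i. k < i \<Longrightarrow> (a ^^ i) v = 0"
  shows "fps_ev k (F * G) a v = fps_ev k F a (fps_ev k G a v)"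
proof -
  have "fps_ev k F a (fps_ev k G a v) = (\<Sum>i\<le>k. \<Sum>j\<le>k. (F $ i * G $ j) *\<^sub>R (a ^^ (i + j)) v)"
    unfolding fps_ev_def
    by (simp add: linear_sum[OF linear_funpow[OF a]] linear_cmul[OF linear_funpow[OF a]] funpow_add
        scaleR_sum_right)
  also have "\<dots> = (\<Sum>n\<le>k. \<Sum>i\<le>n. (F $ i * G $ (n - i)) *\<^sub>R (a ^^ (i + (n - i))) v)"
    by (rule sum_square_triangle) (simp add: nil)
  also have "\<dots> = fps_ev k (F * G) a v"
    unfolding fps_ev_def
    by (intro sum.cong refl) (simp add: fps_mult_nth scaleR_sum_left atMost_atLeast0)
  finally show ?thesis by simp
qed

lemma fps_ev_1 [simp]: "fps_ev k 1 a v = v"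
proof -
  have "fps_ev k 1 a v = (\<Sum>i\<le>k. if i = 0 then v else 0)"
    unfolding fps_ev_def by (intro sum.cong) auto
  then show ?thesis by simp
qed

lemma fps_ev_X:
  assumes "(a ^^ Suc k) v = 0"
  shows "fps_ev k fps_X a v = a v"
proof -
  have "fps_ev k fps_X a v = (\<Sum>i\<le>k. if i = 1 then a v else 0)"
    unfolding fps_ev_def by (intro sum.cong) (auto simp: fps_X_nth)
  then show ?thesis using assms by (cases k) (auto simp: numeral_eq_Suc)
qed

lemma fps_ev_diff: "fps_ev k (F - G) a v = fps_ev k F a v - fps_ev k G a v"
  by (simp add: fps_ev_def scaleR_left_diff_distrib sum_subtractf)

lemma fps_ev_funpow:
  assumes "linear a" and "\<And>i. k < i \<Longrightarrow> (a ^^ i) v = 0"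
  shows "(fps_ev k G a ^^ n) v = fps_ev k (G ^ n) a v"
  by (induction n) (simp_all add: fps_ev_mult[OF assms])

text \<open>Without constant term, \<open>G ^ n\<close> starts in degree at least n. The coefficient
  of degree i in the composition thus involves only n up to i, and the truncation at
  \<open>k\<close> loses nothing.\<close>

lemma fps_ev_compose:
  assumes a: "linear a" and nil: "\<And>i. k < i \<Longrightarrow> (a ^^ i) v = 0" and G: "G $ 0 = 0"
  shows "fps_ev k (F oo G) a v = fps_ev k F (fps_ev k G a) v"
proof -
  have "fps_ev k F (fps_ev k G a) v = (\<Sum>n\<le>k. \<Sum>i\<le>k. (F $ n * (G ^ n) $ i) *\<^sub>R (a ^^ i) v)"
    by (subst fps_ev_def) (simp add: fps_ev_funpow[OF a nil], simp add: fps_ev_def scaleR_sum_right)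
  also have "\<dots> = (\<Sum>i\<le>k. \<Sum>n\<le>k. (F $ n * (G ^ n) $ i) *\<^sub>R (a ^^ i) v)"
    by (rule sum.swap)
  also have "\<dots> = (\<Sum>i\<le>k. \<Sum>n\<in>{0..i}. (F $ n * (G ^ n) $ i) *\<^sub>R (a ^^ i) v)"
  proof (rule sum.cong[OF refl], rule sum.mono_neutral_right)
    fix i assume "i \<in> {..k}"
    then show "finite {..k}" "{0..i} \<subseteq> {..k}" by auto
  next
    fix i assume "i \<in> {..k}"
    show "\<forall>n\<in>{..k} - {0..i}. (F $ n * (G ^ n) $ i) *\<^sub>R (a ^^ i) v = 0"
      using startsby_zero_power_prefix[OF G] by force
  qed
  also have "\<dots> = fps_ev k (F oo G) a v"
    unfolding fps_ev_def by (simp add: fps_compose_nth scaleR_sum_left)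
  finally show ?thesis by simp
qed

text \<open>\<open>fps_ln 1\<close> is the series of log (1 + X), the compositional inverse of e^X -
  1.\<close>

lemma fps_ln_compose_exp: "fps_ln 1 oo (fps_exp 1 - 1 :: real fps) = fps_X"
  and fps_exp_compose_ln: "(fps_exp 1 - 1 :: real fps) oo fps_ln 1 = fps_X"
  using fps_inv_fps_exp_compose[of "1::real"] by (simp_all add: fps_ln_fps_exp_inv)

text \<open>With E = e^X - 1 this is (log (1 + E) / E) (E / X) = 1, as \<open>fps_shift 1\<close>
  divides a series without constant term by X. The second factor is the operator in the derivative
  of \<open>exp\<close>; the first inverts it.\<close>

lemma fps_ln_quotient_exp_quotient:
  "(fps_shift 1 (fps_ln 1) oo (fps_exp 1 - 1)) * fps_shift 1 (fps_exp 1 - 1) = (1 :: real fps)"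
proof -
  let ?E = "fps_exp 1 - 1 :: real fps"
  have E: "?E = fps_shift 1 ?E * fps_X" and L: "fps_ln 1 = fps_shift 1 (fps_ln 1) * (fps_X :: real fps)"
    by (auto simp: fps_eq_iff)
  have "(fps_shift 1 (fps_ln 1) oo ?E) * fps_shift 1 ?E * fps_X = (fps_shift 1 (fps_ln 1) oo ?E) * ?E"
    by (metis E mult.assoc)
  also have "\<dots> = (fps_shift 1 (fps_ln 1) * fps_X) oo ?E"
    by (simp add: fps_compose_mult_distrib fps_X_fps_compose_startby0)
  also have "\<dots> = fps_X"
    using fps_ln_compose_exp L by simp
  finally show ?thesis by simp
qed

subsection \<open>Exponential and logarithm of nilpotent elements\<close>

definition commutator :: "'a::ring \<Rightarrow> 'a \<Rightarrow> 'a" where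
  "commutator x y = x * y - y * x"

lemma linear_commutator: "linear (commutator (x::'a::real_algebra))"
  by (auto simp: linear_iff commutator_def algebra_simps)

text \<open>Left multiplication by C is the sum of \<open>commutator C\<close> and right
  multiplication by C. These two operators commute, so the binomial theorem applies to them.\<close>

lemma power_mult_eq_sum_commutator:
  fixes C T :: "'a::real_algebra_1"
  shows "C ^ n * T = (\<Sum>i\<le>n. real (n choose i) *\<^sub>R ((commutator C ^^ i) T * C ^ (n - i)))"
proof (induction n)
  case 0 then show ?case by simp
next
  case (Suc n)
  let ?t = "\<lambda>n i. (commutator C ^^ i) T * C ^ (n - i)"
  have step: "C * ?t n i = ?t (Suc n) i + ?t (Suc n) (Suc i)" if "i \<le> n" for i
    using that by (simp add: commutator_def Suc_diff_le algebra_simps power_commutes)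
  have "C ^ Suc n * T = C * (C ^ n * T)"
    by (simp add: mult.assoc)
  also have "\<dots> = (\<Sum>i\<le>n. real (n choose i) *\<^sub>R (C * ?t n i))"
    unfolding Suc by (simp add: sum_distrib_left)
  also have "\<dots> = (\<Sum>i\<le>n. real (n choose i) *\<^sub>R (?t (Suc n) i + ?t (Suc n) (Suc i)))"
    by (intro sum.cong refl) (simp add: step)
  also have "\<dots> = (\<Sum>i\<le>Suc n. real (Suc n choose i) *\<^sub>R ?t (Suc n) i)"
    by (rule sum_choose_Suc[symmetric])
  finally show ?case .
qed

text \<open>The product rule gives a sum of terms C^a C' C^b; moving every C to the right of C'
  produces iterated commutators with binomial weights. The summand for i = 0 is kept as 0 so that
  Pascal's rule applies on the full range.\<close>

lemma has_vector_derivative_power_commutator: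
  fixes C :: "real \<Rightarrow> 'a::real_normed_algebra_1"
  assumes "(C has_vector_derivative C') (at t)"
  shows "((\<lambda>t. C t ^ n) has_vector_derivative
    (\<Sum>i\<le>n. real (n choose i) *\<^sub>R
      (if i = 0 then 0 else (commutator (C t) ^^ (i - 1)) C' * C t ^ (n - i)))) (at t)"
proof (induction n)
  case 0 then show ?case by simp
next
  case (Suc n)
  let ?t = "\<lambda>n i. if i = 0 then 0 else (commutator (C t) ^^ (i - 1)) C' * C t ^ (n - i)"
  have "?t (Suc n) i + ?t (Suc n) (Suc i) = C t * ?t n i + (if i = 0 then C' * C t ^ n else 0)"
    if "i \<le> n" for i
    using that
    by (cases i) (auto simp: commutator_def Suc_diff_le algebra_simps power_commutes Suc_diff_Suc
        simp flip: power_Suc)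
  then have "(\<Sum>i\<le>n. real (n choose i) *\<^sub>R (?t (Suc n) i + ?t (Suc n) (Suc i)))
     = (\<Sum>i\<le>n. real (n choose i) *\<^sub>R (C t * ?t n i) + (if i = 0 then C' * C t ^ n else 0))"
    by (intro sum.cong refl) (simp add: algebra_simps)
  also have "\<dots> = C t * (\<Sum>i\<le>n. real (n choose i) *\<^sub>R ?t n i) + C' * C t ^ n"
    by (simp add: sum.distrib sum_distrib_left)
  finally have "C t * (\<Sum>i\<le>n. real (n choose i) *\<^sub>R ?t n i) + C' * C t ^ n
     = (\<Sum>i\<le>Suc n. real (Suc n choose i) *\<^sub>R ?t (Suc n) i)"
    by (simp only: sum_choose_Suc)
  with has_vector_derivative_mult[OF assms Suc] show ?case
    by (simp del: sum.atMost_Suc)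
qed

text \<open>\<open>J i\<close> behaves like the i-th power of a nilpotent ideal. Membership replaces
  counting factors: a product whose degrees exceed \<open>k\<close> in total vanishes, so
  exponential and logarithm are polynomials on \<open>J 1\<close>.\<close>

locale nilpotent_filtration =
  fixes J :: "nat \<Rightarrow> 'a::{real_normed_algebra_1,banach} set" and k :: nat
  assumes subspace_J: "subspace (J i)"
    and mult_J: "x \<in> J i \<Longrightarrow> y \<in> J j \<Longrightarrow> x * y \<in> J (i + j)"
    and one_J: "1 \<in> J 0"
    and antimono_J: "i \<le> j \<Longrightarrow> J j \<subseteq> J i"
    and J_zero: "x \<in> J i \<Longrightarrow> k < i \<Longrightarrow> x = 0"
begin

lemmas J_intros = subspace_0[OF subspace_J] subspace_add[OF subspace_J] subspace_diff[OF subspace_J]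
  subspace_scale[OF subspace_J] subspace_sum[OF subspace_J]

lemma power_J: "x \<in> J 1 \<Longrightarrow> x ^ n \<in> J n"
  using mult_J[of x 1 "x ^ n" n for n] by (induction n) (auto simp: one_J intro: mult_J[where i = 1, simplified])

lemma power_Suc_J: "x \<in> J 1 \<Longrightarrow> x ^ Suc n \<in> J 1"
  using power_J[of x "Suc n"] antimono_J[of 1 "Suc n"] by auto

lemma mult_J1: "x \<in> J 1 \<Longrightarrow> y \<in> J 1 \<Longrightarrow> x * y \<in> J 1"
  using mult_J[of x 1 y 1] antimono_J[of 1 2] by (auto simp: numeral_2_eq_2)

lemma commutator_J:
  assumes "x \<in> J 1" "y \<in> J i" shows "commutator x y \<in> J (Suc i)"
  using mult_J[OF assms] mult_J[OF assms(2,1)] by (auto simp: commutator_def intro: J_intros)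

lemma commutator_funpow_J:
  assumes "x \<in> J 1" "y \<in> J i" shows "(commutator x ^^ n) y \<in> J (n + i)"
  by (induction n) (simp_all add: assms commutator_J del: One_nat_def)

lemma commutator_funpow_zero:
  assumes "x \<in> J 1" "y \<in> J 1" "k \<le> n" shows "(commutator x ^^ n) y = 0"
  using J_zero[OF commutator_funpow_J[OF assms(1,2)], of n] assms(3) by simp

lemma power_zero: "x \<in> J 1 \<Longrightarrow> k < n \<Longrightarrow> x ^ n = 0"
  using J_zero power_J by blast

lemma exp_eq_sum:
  assumes "x \<in> J 1" shows "exp x = (\<Sum>n\<le>k. (1 / fact n) *\<^sub>R x ^ n)"
proof -
  have "(\<Sum>n. x ^ n /\<^sub>R fact n) = (\<Sum>n\<in>{..k}. x ^ n /\<^sub>R fact n)"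
    by (rule suminf_finite) (auto simp: power_zero[OF assms])
  then show ?thesis by (simp add: exp_def divide_inverse)
qed

text \<open>The argument is the increment from 1: \<open>nlog x\<close> is log (1 + x).\<close>

definition nlog :: "'a \<Rightarrow> 'a" where
  "nlog x = (\<Sum>n\<le>k. (fps_nth (fps_ln 1) n) *\<^sub>R x ^ n)"

lemma times_funpow: "((\<lambda>y. x * y) ^^ n) y = x ^ n * y" for x y :: 'a
  by (induction n) (simp_all add: mult.assoc)

lemma fps_ev_times: "fps_ev k F (\<lambda>y. x * y) y = (\<Sum>n\<le>k. fps_nth F n *\<^sub>R x ^ n) * y"
  for x y :: 'a
  by (simp add: fps_ev_def times_funpow sum_distrib_right)

lemma linear_times: "linear (\<lambda>y. x * y)" for x :: 'a
  by (auto simp: linear_iff algebra_simps)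

lemma nlog_J: "x \<in> J 1 \<Longrightarrow> nlog x \<in> J 1"
  unfolding nlog_def
proof (rule subspace_sum[OF subspace_J])
  fix i assume "x \<in> J 1"
  then show "fps_nth (fps_ln 1) i *\<^sub>R x ^ i \<in> J 1"
    by (cases i) (auto simp del: power_Suc One_nat_def intro!: J_intros power_Suc_J)
qed

lemma exp_minus_1_J: "x \<in> J 1 \<Longrightarrow> exp x - 1 \<in> J 1"
proof -
  assume x: "x \<in> J 1"
  have "exp x - 1 = (\<Sum>n\<le>k. (1 / fact n) *\<^sub>R x ^ n) - (\<Sum>n\<le>k. if n = 0 then 1 else 0)"
    by (simp add: exp_eq_sum[OF x])
  also have "\<dots> = (\<Sum>n\<le>k. (1 / fact n) *\<^sub>R x ^ n - (if n = 0 then 1 else 0))"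
    by (simp only: sum_subtractf)
  also have "\<dots> \<in> J 1"
  proof (rule subspace_sum[OF subspace_J])
    fix i show "(1 / fact i) *\<^sub>R x ^ i - (if i = 0 then 1 else 0) \<in> J 1"
      using x by (cases i) (auto simp del: power_Suc One_nat_def intro!: J_intros power_Suc_J)
  qed
  finally show ?thesis .
qed

lemma exp_nlog:
  assumes "x \<in> J 1" shows "exp (nlog x) = 1 + x"
proof -
  have nil: "((\<lambda>y. x * y) ^^ i) 1 = 0" if "k < i" for i
    using power_zero[OF assms that] by (simp add: times_funpow)
  have "fps_ev k (fps_exp 1 - 1) (fps_ev k (fps_ln 1) (\<lambda>y. x * y)) 1 = fps_ev k fps_X (\<lambda>y. x * y) 1"
    using fps_ev_compose[OF linear_times nil, where G = "fps_ln 1" and F = "fps_exp 1 - 1"]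
    by (simp add: fps_exp_compose_ln)
  also have "\<dots> = x" using fps_ev_X[OF nil] by simp
  also have "fps_ev k (fps_ln 1) (\<lambda>y. x * y) = (\<lambda>y. nlog x * y)"
    by (simp add: fun_eq_iff fps_ev_times nlog_def)
  finally show ?thesis
    by (simp add: fps_ev_diff fps_ev_times exp_eq_sum[OF nlog_J[OF assms]] algebra_simps)
qed

lemma nlog_exp:
  assumes "x \<in> J 1" shows "nlog (exp x - 1) = x"
proof -
  have nil: "((\<lambda>y. x * y) ^^ i) 1 = 0" if "k < i" for i
    using power_zero[OF assms that] by (simp add: times_funpow)
  have "fps_ev k (fps_ln 1) (fps_ev k (fps_exp 1 - 1) (\<lambda>y. x * y)) 1 = fps_ev k fps_X (\<lambda>y. x * y) 1"
    using fps_ev_compose[OF linear_times nil, where F = "fps_ln 1" and G = "fps_exp 1 - 1"]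
    by (simp add: fps_ln_compose_exp)
  also have "\<dots> = x" using fps_ev_X[OF nil] by simp
  also have "fps_ev k (fps_exp 1 - 1) (\<lambda>y. x * y) = (\<lambda>y. (exp x - 1) * y)"
    by (simp add: fun_eq_iff fps_ev_diff fps_ev_times exp_eq_sum[OF assms] algebra_simps)
  finally show ?thesis by (simp add: fps_ev_times nlog_def)
qed

text \<open>Conjugation by exp C is the exponential of \<open>commutator C\<close>, written without
  an inverse. The binomial formula for C^n T, divided by n!, is the degree n part of a product of
  two exponential series.\<close>

lemma exp_times_eq_commutator:
  assumes C: "C \<in> J 1" and T: "T \<in> J 1"
  shows "exp C * T = fps_ev k (fps_exp 1) (commutator C) T * exp C"
proof -
  let ?a = "\<lambda>i. (1 / fact i) *\<^sub>R (commutator C ^^ i) T" and ?b = "\<lambda>j. (1 / fact j) *\<^sub>R C ^ j"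
  have "exp C * T = (\<Sum>n\<le>k. (1 / fact n) *\<^sub>R (C ^ n * T))"
    by (simp add: exp_eq_sum[OF C] sum_distrib_right)
  also have "\<dots> = (\<Sum>n\<le>k. \<Sum>i\<le>n. ?a i * ?b (n - i))"
    unfolding power_mult_eq_sum_commutator scaleR_sum_right
    by (intro sum.cong refl) (simp add: binomial_fact)
  also have "\<dots> = (\<Sum>i\<le>k. \<Sum>j\<le>k. ?a i * ?b j)"
  proof (rule sum_square_triangle[symmetric])
    fix i j assume "k < i + j"
    then have "(commutator C ^^ i) T * C ^ j = 0"
      using J_zero[OF mult_J[OF commutator_funpow_J[OF C T] power_J[OF C]], of i j] by simp
    then show "?a i * ?b j = 0" by simp
  qed
  also have "\<dots> = fps_ev k (fps_exp 1) (commutator C) T * exp C"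
    by (simp add: exp_eq_sum[OF C] fps_ev_def sum_product)
  finally show ?thesis .
qed

text \<open>The classical derivative of the exponential: \<open>fps_shift 1 (fps_exp 1)\<close> is
  the series (e^X - 1) / X, evaluated at \<open>commutator (C t)\<close>.\<close>

lemma has_vector_derivative_exp:
  assumes C: "\<And>t. C t \<in> J 1" and C': "C' \<in> J 1" and d: "(C has_vector_derivative C') (at t)"
  shows "((\<lambda>t. exp (C t)) has_vector_derivative
    fps_ev k (fps_shift 1 (fps_exp 1)) (commutator (C t)) C' * exp (C t)) (at t)"
proof -
  let ?t = "\<lambda>n i. if i = 0 then 0 else (commutator (C t) ^^ (i - 1)) C' * C t ^ (n - i)"
  let ?a = "\<lambda>i. if i = 0 then 0 else (1 / fact i) *\<^sub>R (commutator (C t) ^^ (i - 1)) C'"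
    and ?b = "\<lambda>j. (1 / fact j) *\<^sub>R C t ^ j"
  have "((\<lambda>t. exp (C t)) has_vector_derivative
      (\<Sum>n\<le>k. (1 / fact n) *\<^sub>R (\<Sum>i\<le>n. real (n choose i) *\<^sub>R ?t n i))) (at t)"
    unfolding exp_eq_sum[OF C]
    by (intro has_vector_derivative_sum bounded_linear.has_vector_derivative[OF bounded_linear_scaleR_right]
        has_vector_derivative_power_commutator[OF d])
  moreover have "(\<Sum>n\<le>k. (1 / fact n) *\<^sub>R (\<Sum>i\<le>n. real (n choose i) *\<^sub>R ?t n i))
      = (\<Sum>n\<le>k. \<Sum>i\<le>n. ?a i * ?b (n - i))"
    unfolding scaleR_sum_right
    by (intro sum.cong refl) (simp add: binomial_fact)
  moreover have "\<dots> = (\<Sum>i\<le>k. \<Sum>j\<le>k. ?a i * ?b j)"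
  proof (rule sum_square_triangle[symmetric])
    fix i j assume ij: "k < i + j"
    have "(commutator (C t) ^^ (i - 1)) C' * C t ^ j = 0" if "i \<noteq> 0"
      using that ij J_zero[OF mult_J[OF commutator_funpow_J[OF C[of t] C'] power_J[OF C[of t]]], of "i - 1" j]
      by simp
    then show "?a i * ?b j = 0" by auto
  qed
  moreover have "\<dots> = (\<Sum>i\<le>k. ?a i) * exp (C t)"
    by (simp add: exp_eq_sum[OF C] sum_product)
  \<comment> \<open>The extra summand is zero, since \<open>k\<close> commutators already kill an
    element of \<open>J 1\<close>; the longer range makes the index shift of
    \<open>fps_shift\<close> exact.\<close>
  moreover have "(\<Sum>i\<le>k. ?a i) = (\<Sum>i\<le>Suc k. ?a i)"
    using commutator_funpow_zero[OF C[of t] C', of k] by simp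
  moreover have "\<dots> = fps_ev k (fps_shift 1 (fps_exp 1)) (commutator (C t)) C'"
    unfolding fps_ev_def by (simp add: sum.atMost_Suc_shift algebra_simps del: sum.atMost_Suc)
  ultimately show ?thesis by metis
qed

lemma has_vector_derivative_power_J:
  assumes P: "\<And>t. P t \<in> J 1" and P': "P' \<in> J 1" and d: "(P has_vector_derivative P') (at t)"
  shows "\<exists>D\<in>J 1. ((\<lambda>t. P t ^ Suc n) has_vector_derivative D) (at t)"
proof (induction n)
  case 0 then show ?case using P' d by auto
next
  case (Suc n)
  then obtain D where D: "D \<in> J 1" "((\<lambda>t. P t ^ Suc n) has_vector_derivative D) (at t)" by blast
  show ?case
  proof
    show "((\<lambda>t. P t ^ Suc (Suc n)) has_vector_derivative (P t * D + P' * P t ^ Suc n)) (at t)"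
      using has_vector_derivative_mult[OF d D(2)] by simp
    show "P t * D + P' * P t ^ Suc n \<in> J 1"
      by (intro J_intros mult_J1 P P' D power_Suc_J)
  qed
qed

text \<open>Only differentiability and membership in \<open>J 1\<close> are recorded; the value is
  found afterwards by differentiating \<open>exp (nlog (P t))\<close>.\<close>

lemma has_vector_derivative_nlog_J:
  assumes P: "\<And>t. P t \<in> J 1" and P': "P' \<in> J 1" and d: "(P has_vector_derivative P') (at t)"
  shows "\<exists>D\<in>J 1. ((\<lambda>t. nlog (P t)) has_vector_derivative D) (at t)"
proof -
  have "\<exists>D\<in>J 1. ((\<lambda>t. fps_nth (fps_ln 1) n *\<^sub>R P t ^ n) has_vector_derivative D) (at t)" for n
  proof (cases n)
    case 0 then show ?thesis by (intro bexI[of _ 0]) (auto intro: J_intros)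
  next
    case (Suc m)
    then obtain D where "D \<in> J 1" "((\<lambda>t. P t ^ n) has_vector_derivative D) (at t)"
      using has_vector_derivative_power_J[OF assms] by blast
    then show ?thesis
      by (intro bexI[of _ "fps_nth (fps_ln 1) n *\<^sub>R D"] J_intros
          bounded_linear.has_vector_derivative[OF bounded_linear_scaleR_right])
  qed
  then obtain D where D: "\<And>n. D n \<in> J 1"
    "\<And>n. ((\<lambda>t. fps_nth (fps_ln 1) n *\<^sub>R P t ^ n) has_vector_derivative D n) (at t)" by metis
  show ?thesis unfolding nlog_def
    by (rule bexI[of _ "\<Sum>n\<le>k. D n"]) (auto intro!: has_vector_derivative_sum D subspace_sum[OF subspace_J]
        simp del: One_nat_def)
qed

text \<open>Differentiating exp (nlog P) = 1 + P and cancelling the invertible factor gives U =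
  ((e^a - 1) / a) D with a = \<open>commutator (nlog (P t))\<close>. Inverting the series yields D
  as log (1 + E) / E at E = e^a - 1, the shape in which Dynkin's sum appears.\<close>

lemma has_vector_derivative_nlog:
  assumes P: "\<And>t. P t \<in> J 1" and U: "U \<in> J 1"
    and d: "(P has_vector_derivative U * (1 + P t)) (at t)" and inv: "(1 + P t) * Q = 1"
  shows "((\<lambda>t. nlog (P t)) has_vector_derivative
    fps_ev k (fps_shift 1 (fps_ln 1)) (fps_ev k (fps_exp 1 - 1) (commutator (nlog (P t)))) U) (at t)"
proof -
  let ?a = "commutator (nlog (P t))"
  have "U * (1 + P t) \<in> J 1"
    using U P[of t] by (auto simp: distrib_left intro!: J_intros mult_J1 simp del: One_nat_def)
  from has_vector_derivative_nlog_J[OF P this d] obtain D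
    where D: "D \<in> J 1" "((\<lambda>t. nlog (P t)) has_vector_derivative D) (at t)" by blast
  have "((\<lambda>t. 1 + P t) has_vector_derivative U * (1 + P t)) (at t)"
    using has_vector_derivative_add[OF has_vector_derivative_const d, of 1] by simp
  moreover have "((\<lambda>t. 1 + P t) has_vector_derivative
      fps_ev k (fps_shift 1 (fps_exp 1)) ?a D * (1 + P t)) (at t)"
    using has_vector_derivative_exp[OF nlog_J[OF P] D] by (simp add: exp_nlog[OF P])
  ultimately have "U * (1 + P t) = fps_ev k (fps_shift 1 (fps_exp 1)) ?a D * (1 + P t)"
    by (rule vector_derivative_unique_at)
  then have "U * ((1 + P t) * Q) = fps_ev k (fps_shift 1 (fps_exp 1)) ?a D * ((1 + P t) * Q)"
    by (metis mult.assoc)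
  moreover have "fps_shift 1 (1 :: real fps) = 0"
    by (simp add: fps_eq_iff)
  ultimately have U_eq: "fps_ev k (fps_shift 1 (fps_exp 1 - 1)) ?a D = U"
    by (simp add: inv fps_shift_diff)
  have nil: "(?a ^^ i) v = 0" if "v \<in> J 1" "k < i" for i v
    using that commutator_funpow_zero[OF nlog_J[OF P]] by simp
  have "D = fps_ev k ((fps_shift 1 (fps_ln 1) oo (fps_exp 1 - 1)) * fps_shift 1 (fps_exp 1 - 1)) ?a D"
    by (simp only: fps_ln_quotient_exp_quotient fps_ev_1)
  also have "\<dots> = fps_ev k (fps_shift 1 (fps_ln 1) oo (fps_exp 1 - 1)) ?a U"
    by (subst fps_ev_mult) (simp_all only: linear_commutator nil[OF D(1)] U_eq)
  also have "\<dots> = fps_ev k (fps_shift 1 (fps_ln 1)) (fps_ev k (fps_exp 1 - 1) ?a) U"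
    by (rule fps_ev_compose) (simp_all only: linear_commutator nil[OF U], simp)
  finally show ?thesis using D by simp
qed

end

subsection \<open>The Baker-Campbell-Hausdorff theorem for Dynkin's formula\<close>

lemma dword_Nil [simp]: "dword x y [] = []"
  by (simp add: dword_def)

lemma dword_Cons [simp]: "dword x y ((r, s) # ps) = replicate r x @ replicate s y @ dword x y ps"
  by (simp add: dword_def)

lemma dlen_Nil [simp]: "dlen [] = 0" by (simp add: dlen_def)

lemma dlen_Cons [simp]: "dlen ((r, s) # ps) = r + s + dlen ps" by (simp add: dlen_def)

lemma length_dword: "length (dword x y ps) = dlen ps"
  by (induction ps) auto

lemma length_le_dlen: "\<forall>(r, s)\<in>set ps. 0 < r + s \<Longrightarrow> length ps \<le> dlen ps"
  by (induction ps) fastforce+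

lemma rbr_Cons: "w \<noteq> [] \<Longrightarrow> rbr br (a # w) = br a (rbr br w)"
  by (cases w) auto

lemma rbr_replicate_append: "w \<noteq> [] \<Longrightarrow> rbr br (replicate n a @ w) = (br a ^^ n) (rbr br w)"
  by (induction n) (auto simp: rbr_Cons)

text \<open>Dynkin's weight without the factor one over the word length, hence multiplicative in the
  blocks.\<close>

definition dcoeff :: "(nat \<times> nat) list \<Rightarrow> real" where
  "dcoeff ps = 1 / prod_list (map (\<lambda>(r, s). real (fact r * fact s)) ps)"

lemma dcoeff_Nil [simp]: "dcoeff [] = 1" by (simp add: dcoeff_def)

lemma dcoeff_Cons [simp]: "dcoeff ((r, s) # ps) = 1 / (fact r * fact s) * dcoeff ps"
  by (simp add: dcoeff_def)

text \<open>The index set of \<open>bch\<close> without the bound on the total length. The blocks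
  are then chosen independently and sums split off the first block; the additional words are longer
  than \<open>k\<close> and vanish.\<close>

definition dlists :: "nat \<Rightarrow> nat \<Rightarrow> (nat \<times> nat) list set" where
  "dlists k n = {ps. length ps = n \<and> set ps \<subseteq> {0..k} \<times> {0..k} - {(0, 0)}}"

lemma finite_dlists: "finite (dlists k n)"
  using finite_lists_length_eq[of "{0..k} \<times> {0..k} - {(0, 0)}" n]
  by (simp add: dlists_def conj_commute)

lemma dlists_pos: "ps \<in> dlists k n \<Longrightarrow> \<forall>(r, s)\<in>set ps. 0 < r + s"
  unfolding dlists_def by force

lemma dlen_dlists: "ps \<in> dlists k n \<Longrightarrow> n \<le> dlen ps"
  using length_le_dlen[OF dlists_pos] by (auto simp: dlists_def)

lemma dlists_0: "dlists k 0 = {[]}"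
  by (auto simp: dlists_def)

lemma dlists_Suc: "dlists k (Suc n) = (\<lambda>(p, ps). p # ps) ` (({0..k} \<times> {0..k} - {(0, 0)}) \<times> dlists k n)"
  by (auto simp: dlists_def length_Suc_conv image_iff)

lemma sum_dlists_Suc:
  "(\<Sum>ps\<in>dlists k (Suc n). g ps)
    = (\<Sum>(r, s)\<in>{0..k} \<times> {0..k} - {(0, 0)}. \<Sum>ps\<in>dlists k n. g ((r, s) # ps))"
proof -
  have inj: "inj_on (\<lambda>(p, ps). p # ps) (({0..k} \<times> {0..k} - {(0, 0)}) \<times> dlists k n)"
    by (auto simp: inj_on_def)
  have "(\<Sum>ps\<in>dlists k (Suc n). g ps)
      = (\<Sum>(p, ps)\<in>({0..k} \<times> {0..k} - {(0, 0)}) \<times> dlists k n. g (p # ps))"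
    unfolding dlists_Suc by (subst sum.reindex[OF inj]) (auto intro: sum.cong)
  also have "\<dots> = (\<Sum>p\<in>{0..k} \<times> {0..k} - {(0, 0)}. \<Sum>ps\<in>dlists k n. g (p # ps))"
    by (subst sum.cartesian_product) simp
  finally show ?thesis by (simp add: case_prod_beta)
qed

locale nilpotent_representation = nilpotent_filtration J k
  for J :: "nat \<Rightarrow> 'a::{real_normed_algebra_1,banach} set" and k :: nat +
  fixes br :: "'v::euclidean_space \<Rightarrow> 'v \<Rightarrow> 'v" and \<rho> :: "'v \<Rightarrow> 'a"
  assumes bilinear_br: "bilinear br"
    and linear_\<rho>: "linear \<rho>" and inj_\<rho>: "inj \<rho>"
    and \<rho>_br: "\<rho> (br x y) = commutator (\<rho> x) (\<rho> y)"
    and \<rho>_J: "\<rho> x \<in> J 1"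
    and k_pos: "1 \<le> k"
begin

lemma \<rho>_eq_iff: "\<rho> x = \<rho> y \<longleftrightarrow> x = y"
  using inj_\<rho> by (auto simp: inj_def)

lemma linear_br: "linear (br x)"
  using bilinear_br by (simp add: bilinear_def)

lemma linear_br_left: "linear (\<lambda>x. br x y)"
  using bilinear_br by (simp add: bilinear_def)

lemma br_self: "br x x = 0"
proof -
  have "\<rho> (br x x) = \<rho> 0"
    by (simp add: \<rho>_br commutator_def linear_0[OF linear_\<rho>])
  then show ?thesis by (simp add: \<rho>_eq_iff)
qed

lemma \<rho>_br_funpow: "\<rho> ((br x ^^ n) y) = (commutator (\<rho> x) ^^ n) (\<rho> y)"
  by (induction n) (simp_all add: \<rho>_br)

lemma \<rho>_rbr_J: "w \<noteq> [] \<Longrightarrow> \<rho> (rbr br w) \<in> J (length w)"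
proof (induction w rule: induct_list012)
  case (2 x) then show ?case using \<rho>_J by simp
next
  case (3 a b cs)
  then show ?case by (simp add: \<rho>_br commutator_J \<rho>_J del: One_nat_def)
qed simp

lemma rbr_zero:
  assumes "k < length w" shows "rbr br w = 0"
proof -
  have "w \<noteq> []" using assms by auto
  from J_zero[OF \<rho>_rbr_J[OF this] assms] have "\<rho> (rbr br w) = \<rho> 0"
    by (simp add: linear_0[OF linear_\<rho>])
  then show ?thesis by (simp add: \<rho>_eq_iff)
qed

abbreviation exp_ad :: "'v \<Rightarrow> 'v \<Rightarrow> 'v" where
  "exp_ad x \<equiv> fps_ev k (fps_exp 1) (br x)"

lemma linear_exp_ad: "linear (exp_ad x)"
  unfolding fps_ev_def
  by (intro linear_compose_sum ballI linear_compose_scale_right linear_funpow linear_br)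

lemma \<rho>_exp_ad: "\<rho> (exp_ad x u) = fps_ev k (fps_exp 1) (commutator (\<rho> x)) (\<rho> u)"
  by (simp add: fps_ev_def linear_sum[OF linear_\<rho>] linear_cmul[OF linear_\<rho>] \<rho>_br_funpow)

lemma exp_\<rho>_times_\<rho>: "exp (\<rho> x) * \<rho> u = \<rho> (exp_ad x u) * exp (\<rho> x)"
  using exp_times_eq_commutator[OF \<rho>_J \<rho>_J] by (simp add: \<rho>_exp_ad)

text \<open>This is Ad (exp x exp y) - 1.\<close>

definition dynkin_step :: "'v \<Rightarrow> 'v \<Rightarrow> 'v \<Rightarrow> 'v" where
  "dynkin_step x y u = exp_ad x (exp_ad y u) - u"

lemma linear_dynkin_step: "linear (dynkin_step x y)"
  unfolding dynkin_step_def
  by (intro linear_compose_sub linear_compose[OF linear_exp_ad linear_exp_ad, unfolded o_def] linear_ident)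

definition dynkin_sum :: "nat \<Rightarrow> 'v \<Rightarrow> 'v \<Rightarrow> 'v" where
  "dynkin_sum n x y = (\<Sum>ps\<in>dlists k n. dcoeff ps *\<^sub>R rbr br (dword x y ps))"

lemma sum_pairs_minus_zero:
  fixes g :: "nat \<Rightarrow> nat \<Rightarrow> 'v"
  shows "(\<Sum>(r, s)\<in>{0..k} \<times> {0..k} - {(0, 0)}. g r s) = (\<Sum>r\<le>k. \<Sum>s\<le>k. g r s) - g 0 0"
proof -
  have "(\<Sum>(r, s)\<in>{0..k} \<times> {0..k} - {(0, 0)}. g r s) = (\<Sum>(r, s)\<in>{0..k} \<times> {0..k}. g r s) - g 0 0"
    by (subst sum_diff1) auto
  then show ?thesis
    by (simp add: sum.cartesian_product atLeast0AtMost)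
qed

lemma rbr_replicate: "rbr br (replicate n x) = (if n = 1 then x else 0)"
proof (cases n rule: nat.exhaust)
  case (Suc m)
  have "rbr br (replicate m x @ [x]) = (br x ^^ m) x"
    by (simp add: rbr_replicate_append)
  moreover have "(br x ^^ m) x = 0" if "m \<noteq> 0"
  proof -
    obtain l where "m = Suc l" using \<open>m \<noteq> 0\<close> by (cases m) auto
    then show ?thesis
      by (simp add: funpow_Suc_right br_self linear_0[OF linear_funpow[OF linear_br]] del: funpow.simps)
  qed
  ultimately show ?thesis
    using Suc by (auto simp flip: replicate_append_same)
qed simp

text \<open>Since \<open>br a a = 0\<close>, the only words of one block that survive are
  \<open>x\<close> itself and those with exactly one \<open>y\<close>.\<close>

lemma dynkin_sum_1: "dynkin_sum 1 x y = x + exp_ad x y"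
proof -
  let ?g = "\<lambda>r s. (1 / (fact r * fact s)) *\<^sub>R rbr br (replicate r x @ replicate s y)"
  have g: "?g r s = (if s = 0 then if r = 1 then x else 0 else
      if s = 1 then (1 / fact r) *\<^sub>R (br x ^^ r) y else 0)" for r s
    by (cases "s = 0"; cases "s = 1")
      (auto simp: rbr_replicate rbr_replicate_append linear_0[OF linear_funpow[OF linear_br]] simp del: One_nat_def)
  have "dynkin_sum 1 x y = (\<Sum>r\<le>k. \<Sum>s\<le>k. ?g r s)"
    unfolding dynkin_sum_def One_nat_def sum_dlists_Suc dlists_0
    by (simp add: sum_pairs_minus_zero)
  also have "\<dots> = (\<Sum>r\<le>k. (\<Sum>s\<le>k. if s = 0 then if r = 1 then x else 0 else 0)
      + (\<Sum>s\<le>k. if s = 1 then (1 / fact r) *\<^sub>R (br x ^^ r) y else 0))"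
    unfolding sum.distrib[symmetric] g by (intro sum.cong refl) auto
  also have "\<dots> = x + exp_ad x y"
    using k_pos by (simp add: sum.distrib fps_ev_def)
  finally show ?thesis .
qed

text \<open>A leading block (r, s) applies (ad x)^r (ad y)^s / (r! s!) to the nonempty rest of the
  word. Over all pairs this sums to e^(ad x) e^(ad y), and the excluded pair (0, 0) subtracts the
  identity.\<close>

lemma dynkin_sum_Suc:
  assumes "1 \<le> n" shows "dynkin_sum (Suc n) x y = dynkin_step x y (dynkin_sum n x y)"
proof -
  let ?S = "dynkin_sum n x y"
  have eq: "dcoeff ((r, s) # ps) *\<^sub>R rbr br (dword x y ((r, s) # ps))
      = (1 / (fact r * fact s) * dcoeff ps) *\<^sub>R (br x ^^ r) ((br y ^^ s) (rbr br (dword x y ps)))"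
    if "ps \<in> dlists k n" for r s ps
  proof -
    have "length (dword x y ps) \<noteq> 0"
      using dlen_dlists[OF that] assms by (simp add: length_dword)
    then have "dword x y ps \<noteq> []" by auto
    then show ?thesis by (simp add: rbr_replicate_append)
  qed
  have "dynkin_sum (Suc n) x y = (\<Sum>(r, s)\<in>{0..k} \<times> {0..k} - {(0, 0)}. \<Sum>ps\<in>dlists k n.
      (1 / (fact r * fact s) * dcoeff ps) *\<^sub>R (br x ^^ r) ((br y ^^ s) (rbr br (dword x y ps))))"
    unfolding dynkin_sum_def sum_dlists_Suc
  proof (rule sum.cong[OF refl])
    fix p :: "nat \<times> nat"
    show "(case p of (r, s) \<Rightarrow> \<Sum>ps\<in>dlists k n. dcoeff ((r, s) # ps) *\<^sub>R rbr br (dword x y ((r, s) # ps)))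
      = (case p of (r, s) \<Rightarrow> \<Sum>ps\<in>dlists k n. (1 / (fact r * fact s) * dcoeff ps) *\<^sub>R
          (br x ^^ r) ((br y ^^ s) (rbr br (dword x y ps))))"
      unfolding case_prod_beta by (rule sum.cong[OF refl]) (rule eq)
  qed
  also have "\<dots> = (\<Sum>(r, s)\<in>{0..k} \<times> {0..k} - {(0, 0)}.
      (1 / (fact r * fact s)) *\<^sub>R (br x ^^ r) ((br y ^^ s) ?S))"
    by (simp add: dynkin_sum_def linear_sum[OF linear_funpow[OF linear_br]]
        linear_cmul[OF linear_funpow[OF linear_br]] scaleR_sum_right)
  also have "\<dots> = dynkin_step x y ?S"
    by (simp add: sum_pairs_minus_zero dynkin_step_def fps_ev_def linear_sum[OF linear_funpow[OF linear_br]]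
        linear_cmul[OF linear_funpow[OF linear_br]] scaleR_sum_right)
  finally show ?thesis .
qed

lemma dynkin_sum_eq: "dynkin_sum (Suc n) x y = (dynkin_step x y ^^ n) (x + exp_ad x y)"
  by (induction n) (simp_all add: dynkin_sum_1[simplified] dynkin_sum_Suc)

lemma dynkin_sum_top: "dynkin_sum (Suc k) x y = 0"
  unfolding dynkin_sum_def
proof (intro sum.neutral ballI)
  fix ps assume "ps \<in> dlists k (Suc k)"
  then have "k < length (dword x y ps)"
    using dlen_dlists by (fastforce simp: length_dword)
  then show "dcoeff ps *\<^sub>R rbr br (dword x y ps) = 0" by (simp add: rbr_zero)
qed

lemma bch_eq:
  "bch br k x y = (\<Sum>n=1..k. ((-1) ^ (n - 1) / real n) *\<^sub>R
    (\<Sum>ps\<in>dlists k n. (dcoeff ps / real (dlen ps)) *\<^sub>R rbr br (dword x y ps)))"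
  unfolding bch_def
proof (rule sum.cong[OF refl], rule arg_cong2[where f = scaleR, OF refl])
  fix n
  show "(\<Sum>ps\<in>{ps. length ps = n \<and> set ps \<subseteq> {0..k} \<times> {0..k} \<and> (\<forall>(r, s)\<in>set ps. 0 < r + s) \<and> dlen ps \<le> k}.
      (1 / (real (dlen ps) * prod_list (map (\<lambda>(r, s). real (fact r * fact s)) ps))) *\<^sub>R rbr br (dword x y ps))
    = (\<Sum>ps\<in>dlists k n. (dcoeff ps / real (dlen ps)) *\<^sub>R rbr br (dword x y ps))"
  proof (rule sum.mono_neutral_cong_left)
    show "finite (dlists k n)" by (rule finite_dlists)
    show "{ps. length ps = n \<and> set ps \<subseteq> {0..k} \<times> {0..k} \<and> (\<forall>(r, s)\<in>set ps. 0 < r + s) \<and> dlen ps \<le> k}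
        \<subseteq> dlists k n"
      unfolding dlists_def by force
    show "\<forall>ps\<in>dlists k n - {ps. length ps = n \<and> set ps \<subseteq> {0..k} \<times> {0..k}
        \<and> (\<forall>(r, s)\<in>set ps. 0 < r + s) \<and> dlen ps \<le> k}.
        (dcoeff ps / real (dlen ps)) *\<^sub>R rbr br (dword x y ps) = 0"
    proof
      fix ps assume ps: "ps \<in> dlists k n - {ps. length ps = n \<and> set ps \<subseteq> {0..k} \<times> {0..k}
        \<and> (\<forall>(r, s)\<in>set ps. 0 < r + s) \<and> dlen ps \<le> k}"
      then have "k < dlen ps"
        using dlists_pos[of ps k n] by (auto simp: dlists_def)
      then show "(dcoeff ps / real (dlen ps)) *\<^sub>R rbr br (dword x y ps) = 0"
        by (simp add: rbr_zero length_dword)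
    qed
  qed (auto simp: dcoeff_def)
qed

lemma dword_scale: "dword (c *\<^sub>R x) (c *\<^sub>R y) ps = map (scaleR c) (dword x y ps)"
  by (induction ps) auto

lemma rbr_scale: "rbr br (map (scaleR c) w) = c ^ length w *\<^sub>R rbr br w"
  by (induction w rule: induct_list012)
    (simp_all add: linear_cmul[OF linear_br] linear_cmul[OF linear_br_left])

lemma dynkin_sum_scale:
  "dynkin_sum n (c *\<^sub>R x) (c *\<^sub>R y) = (\<Sum>ps\<in>dlists k n. (dcoeff ps * c ^ dlen ps) *\<^sub>R rbr br (dword x y ps))"
  by (simp add: dynkin_sum_def dword_scale rbr_scale length_dword)

text \<open>A word of length m scales as t^m, and differentiation cancels the weight 1 / m. The
  remaining block sums are powers of \<open>dynkin_step\<close> and add up to log (1 + E) / E at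
  that operator. The final division by t restricts the formula to nonzero t.\<close>

lemma has_vector_derivative_bch_ray:
  assumes "t \<noteq> 0"
  shows "((\<lambda>t. bch br k (t *\<^sub>R x) (t *\<^sub>R y)) has_vector_derivative
    fps_ev k (fps_shift 1 (fps_ln 1)) (dynkin_step (t *\<^sub>R x) (t *\<^sub>R y)) (x + exp_ad (t *\<^sub>R x) y)) (at t)"
proof -
  let ?x = "t *\<^sub>R x" and ?y = "t *\<^sub>R y"
  let ?D = "\<Sum>n=1..k. ((-1) ^ (n - 1) / real n) *\<^sub>R
    (\<Sum>ps\<in>dlists k n. (dcoeff ps * t ^ (dlen ps - 1)) *\<^sub>R rbr br (dword x y ps))"
  have term_deriv: "((\<lambda>t. (dcoeff ps / real (dlen ps) * t ^ dlen ps) *\<^sub>R rbr br (dword x y ps)) has_vector_derivative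
      (dcoeff ps * t ^ (dlen ps - 1)) *\<^sub>R rbr br (dword x y ps)) (at t)" if "0 < dlen ps" for ps
    using that by (auto intro!: derivative_eq_intros)
  have "((\<lambda>t. bch br k (t *\<^sub>R x) (t *\<^sub>R y)) has_vector_derivative ?D) (at t)"
    unfolding bch_eq dword_scale rbr_scale scaleR_scaleR length_dword
    by (intro has_vector_derivative_sum bounded_linear.has_vector_derivative[OF bounded_linear_scaleR_right] term_deriv)
      (use dlen_dlists in fastforce)
  moreover have "t *\<^sub>R ?D = (\<Sum>n=1..k. ((-1) ^ (n - 1) / real n) *\<^sub>R dynkin_sum n ?x ?y)"
    unfolding dynkin_sum_scale scaleR_sum_right scaleR_scaleR
  proof (rule sum.cong[OF refl], rule sum.cong[OF refl])
    fix n ps assume "n \<in> {1..k}" "ps \<in> dlists k n"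
    then have "0 < dlen ps" using dlen_dlists by fastforce
    then have "t * t ^ (dlen ps - 1) = t ^ dlen ps" by (cases "dlen ps") auto
    then show "(t * ((-1) ^ (n - 1) / real n * (dcoeff ps * t ^ (dlen ps - 1)))) *\<^sub>R rbr br (dword x y ps)
      = ((-1) ^ (n - 1) / real n * (dcoeff ps * t ^ dlen ps)) *\<^sub>R rbr br (dword x y ps)"
      by (metis mult.assoc mult.left_commute)
  qed
  moreover have "\<dots> = (\<Sum>n\<le>k. (fps_nth (fps_shift 1 (fps_ln 1)) n) *\<^sub>R dynkin_sum (Suc n) ?x ?y)"
  proof -
    \<comment> \<open>A word of \<open>k + 1\<close> nonempty blocks is longer than
      \<open>k\<close>, so the new summand is zero; it completes the range of the shifted logarithm
      series.\<close>
    have "(\<Sum>n=1..k. ((-1) ^ (n - 1) / real n) *\<^sub>R dynkin_sum n ?x ?y)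
        = (\<Sum>n=1..Suc k. ((-1) ^ (n - 1) / real n) *\<^sub>R dynkin_sum n ?x ?y)"
      by (simp add: dynkin_sum_top)
    also have "\<dots> = (\<Sum>n\<le>k. ((-1) ^ n / real (Suc n)) *\<^sub>R dynkin_sum (Suc n) ?x ?y)"
      unfolding One_nat_def sum.shift_bounds_cl_Suc_ivl atLeast0AtMost by simp
    finally show ?thesis by (simp add: fps_ln_nth)
  qed
  moreover have "\<dots> = fps_ev k (fps_shift 1 (fps_ln 1)) (dynkin_step ?x ?y) (?x + exp_ad ?x ?y)"
    by (simp add: fps_ev_def dynkin_sum_eq)
  moreover have "\<dots> = t *\<^sub>R fps_ev k (fps_shift 1 (fps_ln 1)) (dynkin_step ?x ?y) (x + exp_ad ?x y)"
    unfolding fps_ev_def linear_cmul[OF linear_exp_ad[unfolded fps_ev_def]] scaleR_add_right[symmetric]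
      linear_cmul[OF linear_funpow[OF linear_dynkin_step]]
    by (simp add: scaleR_sum_right mult.commute)
  ultimately have "t *\<^sub>R ?D = t *\<^sub>R fps_ev k (fps_shift 1 (fps_ln 1)) (dynkin_step ?x ?y) (x + exp_ad ?x y)"
    by metis
  with assms have "?D = fps_ev k (fps_shift 1 (fps_ln 1)) (dynkin_step ?x ?y) (x + exp_ad ?x y)" by simp
  then show ?thesis
    using \<open>((\<lambda>t. bch br k (t *\<^sub>R x) (t *\<^sub>R y)) has_vector_derivative ?D) (at t)\<close> by simp
qed

lemma continuous_on_bch_ray: "continuous_on S (\<lambda>t. bch br k (t *\<^sub>R x) (t *\<^sub>R y))"
  unfolding bch_eq dword_scale rbr_scale by (intro continuous_intros)

lemma bch_0: "bch br k 0 0 = 0"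
proof -
  have "rbr br (dword 0 0 ps) = 0" for ps
  proof -
    have "dword 0 0 ps = map (scaleR 0) (dword 0 0 ps :: 'v list)"
      using dword_scale[of 0 "0::'v" "0::'v" ps] by simp
    then have "rbr br (dword 0 0 ps) = 0 ^ length (dword 0 0 ps :: 'v list) *\<^sub>R rbr br (dword 0 0 ps)"
      using rbr_scale[of 0 "dword 0 0 ps :: 'v list"] by (simp only: \<open>dword 0 0 ps = map (scaleR 0) (dword 0 0 ps)\<close>[symmetric])
    then show ?thesis
      by (cases "dword 0 0 ps :: 'v list") auto
  qed
  then show ?thesis by (simp add: bch_eq)
qed

theorem exp_\<rho>_bch: "exp (\<rho> (bch br k x y)) = exp (\<rho> x) * exp (\<rho> y)"
proof -
  define M where "M t = exp (t *\<^sub>R \<rho> x) * exp (t *\<^sub>R \<rho> y)" for t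
  define P where "P t = M t - 1" for t
  define \<Delta> where "\<Delta> t = nlog (P t) - \<rho> (bch br k (t *\<^sub>R x) (t *\<^sub>R y))" for t
  have scale_J: "t *\<^sub>R \<rho> u \<in> J 1" for t u
    by (intro J_intros \<rho>_J)
  have P_J: "P t \<in> J 1" for t
  proof -
    have "P t = (exp (t *\<^sub>R \<rho> x) - 1) * (exp (t *\<^sub>R \<rho> y) - 1) + (exp (t *\<^sub>R \<rho> x) - 1) + (exp (t *\<^sub>R \<rho> y) - 1)"
      by (simp add: P_def M_def algebra_simps)
    also have "\<dots> \<in> J 1"
      by (intro J_intros mult_J1 exp_minus_1_J scale_J)
    finally show ?thesis .
  qed
  have exp_P: "exp (nlog (P t)) = M t" for t
    using exp_nlog[OF P_J, of t] by (simp add: P_def)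
  have inv: "M t * (exp (- (t *\<^sub>R \<rho> y)) * exp (- (t *\<^sub>R \<rho> x))) = 1" for t
  proof -
    have "M t * (exp (- (t *\<^sub>R \<rho> y)) * exp (- (t *\<^sub>R \<rho> x)))
      = exp (t *\<^sub>R \<rho> x) * (exp (t *\<^sub>R \<rho> y) * exp (- (t *\<^sub>R \<rho> y))) * exp (- (t *\<^sub>R \<rho> x))"
      by (simp only: M_def mult.assoc)
    then show ?thesis by (simp add: exp_minus_inverse)
  qed
  have exp_conj: "exp (t *\<^sub>R \<rho> z) * \<rho> u = \<rho> (exp_ad (t *\<^sub>R z) u) * exp (t *\<^sub>R \<rho> z)" for t z u
    using exp_\<rho>_times_\<rho>[of "t *\<^sub>R z" u] by (simp add: linear_cmul[OF linear_\<rho>])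
  have M_conj: "M t * \<rho> u = \<rho> (exp_ad (t *\<^sub>R x) (exp_ad (t *\<^sub>R y) u)) * M t" for t u
  proof -
    have "M t * \<rho> u = exp (t *\<^sub>R \<rho> x) * (exp (t *\<^sub>R \<rho> y) * \<rho> u)"
      by (simp only: M_def mult.assoc)
    also have "\<dots> = exp (t *\<^sub>R \<rho> x) * \<rho> (exp_ad (t *\<^sub>R y) u) * exp (t *\<^sub>R \<rho> y)"
      unfolding exp_conj[of t y u] by (simp only: mult.assoc)
    also have "\<dots> = \<rho> (exp_ad (t *\<^sub>R x) (exp_ad (t *\<^sub>R y) u)) * M t"
      unfolding exp_conj[of t x] M_def by (simp only: mult.assoc)
    finally show ?thesis .
  qed
  have M_deriv: "(M has_vector_derivative \<rho> (x + exp_ad (t *\<^sub>R x) y) * M t) (at t)" for t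
  proof -
    have "(M has_vector_derivative
        exp (t *\<^sub>R \<rho> x) * (\<rho> y * exp (t *\<^sub>R \<rho> y)) + \<rho> x * exp (t *\<^sub>R \<rho> x) * exp (t *\<^sub>R \<rho> y)) (at t)"
      unfolding M_def
      by (rule has_vector_derivative_mult[OF exp_scaleR_has_vector_derivative_left exp_scaleR_has_vector_derivative_left])
    moreover have "exp (t *\<^sub>R \<rho> x) * (\<rho> y * exp (t *\<^sub>R \<rho> y)) + \<rho> x * exp (t *\<^sub>R \<rho> x) * exp (t *\<^sub>R \<rho> y)
      = \<rho> (x + exp_ad (t *\<^sub>R x) y) * M t"
      by (simp add: linear_add[OF linear_\<rho>] distrib_right M_def mult.assoc[symmetric] exp_conj)
    ultimately show ?thesis by simp
  qed
  \<comment> \<open>Here the two derivatives meet: the exponential of ad (log M) is conjugation by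
    M, and for a product of exponentials this is the composition of the two \<open>exp_ad\<close>.
    So e^a - 1 for a = \<open>commutator (nlog (P t))\<close> corresponds to
    \<open>dynkin_step\<close> under \<rho>.\<close>
  have step: "fps_ev k (fps_exp 1 - 1) (commutator (nlog (P t))) (\<rho> u) = \<rho> (dynkin_step (t *\<^sub>R x) (t *\<^sub>R y) u)" for t u
  proof -
    have "fps_ev k (fps_exp 1) (commutator (nlog (P t))) (\<rho> u) * M t = \<rho> (exp_ad (t *\<^sub>R x) (exp_ad (t *\<^sub>R y) u)) * M t"
      using exp_times_eq_commutator[OF nlog_J[OF P_J] \<rho>_J, of t u] by (simp add: exp_P M_conj)
    then have "fps_ev k (fps_exp 1) (commutator (nlog (P t))) (\<rho> u) = \<rho> (exp_ad (t *\<^sub>R x) (exp_ad (t *\<^sub>R y) u))"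
      using inv[of t] by (metis (no_types) mult.assoc mult.right_neutral)
    then show ?thesis
      by (simp add: fps_ev_diff dynkin_step_def linear_diff[OF linear_\<rho>])
  qed
  have steps: "(fps_ev k (fps_exp 1 - 1) (commutator (nlog (P t))) ^^ n) (\<rho> u)
      = \<rho> ((dynkin_step (t *\<^sub>R x) (t *\<^sub>R y) ^^ n) u)" for t u n
    by (induction n) (simp_all add: step)
  have log_deriv: "((\<lambda>t. nlog (P t)) has_vector_derivative
      \<rho> (fps_ev k (fps_shift 1 (fps_ln 1)) (dynkin_step (t *\<^sub>R x) (t *\<^sub>R y)) (x + exp_ad (t *\<^sub>R x) y))) (at t)" for t
  proof -
    have "(P has_vector_derivative \<rho> (x + exp_ad (t *\<^sub>R x) y) * (1 + P t)) (at t)"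
      using has_vector_derivative_diff[OF M_deriv has_vector_derivative_const[of 1]] by (simp add: P_def[abs_def])
    moreover have "(1 + P t) * (exp (- (t *\<^sub>R \<rho> y)) * exp (- (t *\<^sub>R \<rho> x))) = 1"
      using inv[of t] by (simp add: P_def)
    ultimately have "((\<lambda>t. nlog (P t)) has_vector_derivative fps_ev k (fps_shift 1 (fps_ln 1))
        (fps_ev k (fps_exp 1 - 1) (commutator (nlog (P t)))) (\<rho> (x + exp_ad (t *\<^sub>R x) y))) (at t)"
      by (rule has_vector_derivative_nlog[OF P_J \<rho>_J])
    then show ?thesis
      unfolding fps_ev_def[of k "fps_shift 1 (fps_ln 1)"]
      by (simp only: steps linear_sum[OF linear_\<rho>] linear_cmul[OF linear_\<rho>])
  qed
  have bl: "bounded_linear \<rho>"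
    using linear_\<rho> by (simp add: linear_conv_bounded_linear)
  have nlog_cont: "continuous_on {0..1} (\<lambda>t. nlog (P t))"
    by (rule continuous_at_imp_continuous_on) (blast intro: has_vector_derivative_continuous log_deriv)
  have "\<Delta> 1 = 0"
  \<comment> \<open>The derivative along the ray is known for nonzero t; at the exceptional point 0
    continuity takes over.\<close>
  proof (rule has_derivative_zero_unique_strong_interval[where k = "{0}" and a = 0 and b = 1])
    show "continuous_on {0..1} \<Delta>"
      unfolding \<Delta>_def
      by (intro continuous_on_diff nlog_cont bounded_linear.continuous_on[OF bl] continuous_on_bch_ray)
    show "\<Delta> 0 = 0"
      using nlog_exp[OF subspace_0[OF subspace_J]]
      by (simp add: \<Delta>_def P_def M_def bch_0 linear_0[OF linear_\<rho>])
    fix t :: real assume "t \<in> {0..1} - {0}"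
    then have "t \<noteq> 0" by simp
    then have "(\<Delta> has_vector_derivative 0) (at t)"
      unfolding \<Delta>_def[abs_def]
      using has_vector_derivative_diff[OF log_deriv[of t] bounded_linear.has_vector_derivative[OF bl
            has_vector_derivative_bch_ray[where x = x and y = y, OF \<open>t \<noteq> 0\<close>]]]
      by (simp only: diff_self)
    then show "(\<Delta> has_derivative (\<lambda>h. 0)) (at t within {0..1})"
      by (simp add: has_vector_derivative_def has_derivative_at_withinI)
  qed auto
  then have "nlog (P 1) = \<rho> (bch br k x y)"
    unfolding \<Delta>_def scaleR_one by (simp only: right_minus_eq)
  with exp_P[of 1] show ?thesis
    unfolding M_def scaleR_one by (simp only:)
qed

lemma exp_\<rho>_inject: "exp (\<rho> x) = exp (\<rho> y) \<Longrightarrow> x = y"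
proof -
  assume "exp (\<rho> x) = exp (\<rho> y)"
  then have "nlog (exp (\<rho> x) - 1) = nlog (exp (\<rho> y) - 1)" by (simp only:)
  then show "x = y" by (simp only: nlog_exp[OF \<rho>_J] \<rho>_eq_iff)
qed

lemma exp_\<rho>_0: "exp (\<rho> 0) = 1"
  by (simp add: linear_0[OF linear_\<rho>])

lemma exp_\<rho>_uminus: "exp (\<rho> (- x)) * exp (\<rho> x) = 1" "exp (\<rho> x) * exp (\<rho> (- x)) = 1"
  using exp_minus_inverse[of "\<rho> x"] exp_minus_inverse[of "- \<rho> x"] by (simp_all add: linear_neg[OF linear_\<rho>])

lemma bch_assoc: "bch br k (bch br k x y) z = bch br k x (bch br k y z)"
  by (rule exp_\<rho>_inject) (simp add: exp_\<rho>_bch mult.assoc)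

lemma bch_0_left [simp]: "bch br k 0 x = x" and bch_0_right [simp]: "bch br k x 0 = x"
  by (rule exp_\<rho>_inject; simp add: exp_\<rho>_bch exp_\<rho>_0)+

lemma bch_minus_left [simp]: "bch br k (- x) x = 0" and bch_minus_right [simp]: "bch br k x (- x) = 0"
  by (rule exp_\<rho>_inject; simp add: exp_\<rho>_bch exp_\<rho>_0 exp_\<rho>_uminus)+

lemma bch_cancel_left [simp]: "bch br k (- x) (bch br k x y) = y" "bch br k x (bch br k (- x) y) = y"
  by (simp_all flip: bch_assoc)

lemma bch_left_inject [simp]: "bch br k x y = bch br k x z \<longleftrightarrow> y = z"
  by (metis bch_cancel_left(1))

lemma bch_eq_0_iff: "bch br k (- x) y = 0 \<longleftrightarrow> x = y"
  by (metis bch_0_right bch_cancel_left(2) bch_minus_left)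

lemma minus_bch: "- bch br k x y = bch br k (- y) (- x)"
proof -
  have "bch br k (bch br k x y) (- bch br k x y) = bch br k (bch br k x y) (bch br k (- y) (- x))"
    by (simp add: bch_assoc)
  then show ?thesis by (simp only: bch_left_inject)
qed

lemma bch_parallel: "bch br k (s *\<^sub>R x) (t *\<^sub>R x) = (s + t) *\<^sub>R x"
proof (rule exp_\<rho>_inject)
  have "(s *\<^sub>R \<rho> x) * (t *\<^sub>R \<rho> x) = (t *\<^sub>R \<rho> x) * (s *\<^sub>R \<rho> x)" by simp
  from exp_add_commuting[OF this]
  show "exp (\<rho> (bch br k (s *\<^sub>R x) (t *\<^sub>R x))) = exp (\<rho> ((s + t) *\<^sub>R x))"
    by (simp add: exp_\<rho>_bch linear_cmul[OF linear_\<rho>] linear_add[OF linear_\<rho>] scaleR_left_distrib)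
qed

text \<open>Conjugation is multiplicative, hence passes through the powers in the exponential
  series; on the image of \<rho> it acts as \<open>exp_ad\<close>.\<close>

lemma bch_conj: "bch br k (bch br k x y) (- x) = exp_ad x y"
proof (rule exp_\<rho>_inject)
  let ?E = "exp (\<rho> x)" and ?E' = "exp (\<rho> (- x))"
  have conj: "?E * \<rho> y * ?E' = \<rho> (exp_ad x y)"
    by (simp add: exp_\<rho>_times_\<rho> mult.assoc exp_\<rho>_uminus)
  have "?E * \<rho> y ^ n * ?E' = \<rho> (exp_ad x y) ^ n" for n
  proof (induction n)
    case 0 then show ?case by (simp add: exp_\<rho>_uminus)
  next
    case (Suc n)
    have "?E * \<rho> y ^ Suc n * ?E' = ?E * \<rho> y * (?E' * ?E) * \<rho> y ^ n * ?E'"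
      by (simp add: exp_\<rho>_uminus mult.assoc)
    also have "\<dots> = (?E * \<rho> y * ?E') * (?E * \<rho> y ^ n * ?E')"
      by (simp only: mult.assoc)
    finally show ?case by (simp add: conj Suc)
  qed
  then show "exp (\<rho> (bch br k (bch br k x y) (- x))) = exp (\<rho> (exp_ad x y))"
    by (simp add: exp_\<rho>_bch exp_eq_sum[OF \<rho>_J, of y] exp_eq_sum[OF \<rho>_J, of "exp_ad x y"]
        sum_distrib_left sum_distrib_right)
qed

end

subsection \<open>Faithful representation of a graded Lie algebra\<close>

text \<open>A copy of the bounded linear maps with composition as multiplication, which makes it a
  Banach algebra with its own \<open>exp\<close>.\<close>

typedef (overloaded) 'a endo = "UNIV :: ('a::euclidean_space \<Rightarrow>\<^sub>L 'a) set"
  morphisms blinfun_of_endo Endo ..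

setup_lifting type_definition_endo

instantiation endo :: (euclidean_space) real_normed_algebra_1
begin

lift_definition zero_endo :: "'a endo" is 0 .
lift_definition one_endo :: "'a endo" is id_blinfun .
lift_definition plus_endo :: "'a endo \<Rightarrow> 'a endo \<Rightarrow> 'a endo" is "(+)" .
lift_definition minus_endo :: "'a endo \<Rightarrow> 'a endo \<Rightarrow> 'a endo" is "(-)" .
lift_definition uminus_endo :: "'a endo \<Rightarrow> 'a endo" is "uminus" .
lift_definition times_endo :: "'a endo \<Rightarrow> 'a endo \<Rightarrow> 'a endo" is "(o\<^sub>L)" .
lift_definition scaleR_endo :: "real \<Rightarrow> 'a endo \<Rightarrow> 'a endo" is "scaleR" .
lift_definition norm_endo :: "'a endo \<Rightarrow> real" is norm .
definition dist_endo :: "'a endo \<Rightarrow> 'a endo \<Rightarrow> real" where "dist_endo x y = norm (x - y)"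
definition sgn_endo :: "'a endo \<Rightarrow> 'a endo" where "sgn_endo x = inverse (norm x) *\<^sub>R x"
definition uniformity_endo :: "('a endo \<times> 'a endo) filter"
  where "uniformity_endo = (INF e\<in>{0<..}. principal {(x, y). dist x y < e})"
definition open_endo :: "'a endo set \<Rightarrow> bool"
  where "open_endo S = (\<forall>x\<in>S. \<forall>\<^sub>F (x', y) in uniformity. x' = x \<longrightarrow> y \<in> S)"

instance
proof
  fix a b c :: "'a endo" and r s :: real
  show "a + b + c = a + (b + c)" "a + b = b + a" "0 + a = a" "- a + a = 0" "a - b = a + - b"
    by (transfer; simp)+
  show "r *\<^sub>R (a + b) = r *\<^sub>R a + r *\<^sub>R b" "(r + s) *\<^sub>R a = r *\<^sub>R a + s *\<^sub>R a"
    "r *\<^sub>R s *\<^sub>R a = (r * s) *\<^sub>R a" "1 *\<^sub>R a = a"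
    by (transfer; simp add: algebra_simps)+
  show "a * b * c = a * (b * c)" "(a + b) * c = a * c + b * c" "a * (b + c) = a * b + a * c"
    "r *\<^sub>R a * b = r *\<^sub>R (a * b)" "a * r *\<^sub>R b = r *\<^sub>R (a * b)" "1 * a = a" "a * 1 = a"
    by (transfer; rule blinfun_eqI; simp add: blinfun.bilinear_simps)+
  show "(0::'a endo) \<noteq> 1"
  proof transfer
    obtain b :: 'a where "b \<in> Basis" using nonempty_Basis by blast
    then have "blinfun_apply 0 b \<noteq> blinfun_apply id_blinfun b" by (simp add: nonzero_Basis)
    then show "0 \<noteq> (id_blinfun :: 'a \<Rightarrow>\<^sub>L 'a)" by metis
  qed
  show "dist a b = norm (a - b)" by (rule dist_endo_def)
  show "sgn a = inverse (norm a) *\<^sub>R a" by (simp add: sgn_endo_def)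
  show "uniformity = (INF e\<in>{0<..}. principal {(x, y::'a endo). dist x y < e})"
    by (rule uniformity_endo_def)
  show "open U = (\<forall>x\<in>U. \<forall>\<^sub>F (x', y) in uniformity. x' = x \<longrightarrow> y \<in> U)" for U :: "'a endo set"
    by (rule open_endo_def)
  show "norm a = 0 \<longleftrightarrow> a = 0" "norm (a + b) \<le> norm a + norm b" "norm (r *\<^sub>R a) = \<bar>r\<bar> * norm a"
    by (transfer; simp add: norm_triangle_ineq)+
  show "norm (a * b) \<le> norm a * norm b"
    by transfer (rule norm_blinfun_compose)
  show "norm (1::'a endo) = 1"
    by transfer (rule norm_blinfun_id)
qed

end

instance endo :: (euclidean_space) banach
proof
  fix X :: "nat \<Rightarrow> 'a endo" assume "Cauchy X"
  have d: "dist (blinfun_of_endo x) (blinfun_of_endo y) = dist x y" for x y :: "'a endo"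
    by (simp add: dist_norm norm_endo.rep_eq minus_endo.rep_eq)
  then have "Cauchy (\<lambda>n. blinfun_of_endo (X n))"
    using \<open>Cauchy X\<close> by (simp add: Cauchy_def)
  then obtain L where "(\<lambda>n. blinfun_of_endo (X n)) \<longlonglongrightarrow> L"
    using Cauchy_convergent convergent_def by blast
  then have "X \<longlonglongrightarrow> Endo L"
    using d[of _ "Endo L"] by (simp add: lim_sequentially Endo_inverse)
  then show "convergent X" by (auto simp: convergent_def)
qed

lift_definition endo_apply :: "'a::euclidean_space endo \<Rightarrow> 'a \<Rightarrow> 'a" is blinfun_apply .

lift_definition endo_of :: "('a::euclidean_space \<Rightarrow> 'a) \<Rightarrow> 'a endo" is Blinfun .

lemma endo_apply_endo_of: "linear f \<Longrightarrow> endo_apply (endo_of f) = f"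
  by transfer (simp add: bounded_linear_Blinfun_apply linear_conv_bounded_linear)

lemma endo_eqI: "(\<And>x. endo_apply S x = endo_apply T x) \<Longrightarrow> S = T"
  by transfer (rule blinfun_eqI)

lemma endo_apply_simps [simp]:
  "endo_apply 0 x = 0" "endo_apply 1 x = x"
  "endo_apply (S + T) x = endo_apply S x + endo_apply T x"
  "endo_apply (S - T) x = endo_apply S x - endo_apply T x"
  "endo_apply (r *\<^sub>R T) x = r *\<^sub>R endo_apply T x"
  "endo_apply (S * T) x = endo_apply S (endo_apply T x)"
  by (transfer; simp add: blinfun.bilinear_simps)+

section \<open>Components, dilations and the grading derivation of a graded Lie algebra\<close>

locale graded_algebra =
  fixes br :: "'v::euclidean_space \<Rightarrow> 'v \<Rightarrow> 'v" and V :: "nat \<Rightarrow> 'v set" and k :: nat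
  assumes graded: "graded_lie_algebra br V k"
begin

abbreviation proj :: "nat \<Rightarrow> 'v \<Rightarrow> 'v" where "proj i v \<equiv> gcomp V k v i"

lemma bilinear_br: "bilinear br"
  and br_antisym: "br x y = - br y x"
  and jacobi: "br x (br y z) + br y (br z x) + br z (br x y) = 0"
  and k_pos: "1 \<le> k"
  and subspace_V: "subspace (V i)"
  and V_trivial: "i = 0 \<or> k < i \<Longrightarrow> V i = {0}"
  and br_V: "x \<in> V i \<Longrightarrow> y \<in> V j \<Longrightarrow> br x y \<in> V (i + j)"
proof -
  note g = graded[unfolded graded_lie_algebra_def]
  note g2 = g[THEN conjunct2] note g3 = g2[THEN conjunct2] note g4 = g3[THEN conjunct2]
  note g5 = g4[THEN conjunct2] note g6 = g5[THEN conjunct2] note g7 = g6[THEN conjunct2]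
  show "bilinear br" "1 \<le> k" by (rule g[THEN conjunct1] g4[THEN conjunct1])+
  show "br x y = - br y x" "br x (br y z) + br y (br z x) + br z (br x y) = 0"
    "subspace (V i)" "i = 0 \<or> k < i \<Longrightarrow> V i = {0}"
    by (rule g2[THEN conjunct1, rule_format] g3[THEN conjunct1, rule_format]
        g5[THEN conjunct1, rule_format] g6[THEN conjunct1, rule_format], assumption?)+
  show "x \<in> V i \<Longrightarrow> y \<in> V j \<Longrightarrow> br x y \<in> V (i + j)"
    by (rule g7[THEN conjunct2, rule_format])
qed

lemma ex1_components:
  "\<exists>!w. (\<forall>i. w i \<in> V i) \<and> (\<forall>i. i \<notin> {1..k} \<longrightarrow> w i = 0) \<and> v = (\<Sum>i=1..k. w i)"
  using graded[unfolded graded_lie_algebra_def, THEN conjunct2, THEN conjunct2, THEN conjunct2,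
      THEN conjunct2, THEN conjunct2, THEN conjunct2, THEN conjunct1] by (rule spec)

lemma linear_br: "linear (br x)" and linear_br_left: "linear (\<lambda>x. br x y)"
  using bilinear_br by (simp_all add: bilinear_def)

lemma proj_V: "proj i v \<in> V i"
  and proj_trivial: "i \<notin> {1..k} \<Longrightarrow> proj i v = 0"
  and sum_proj: "(\<Sum>i=1..k. proj i v) = v"
  using theI'[OF ex1_components[of v]] unfolding gcomp_def[symmetric] by auto

lemma proj_unique:
  assumes "\<And>i. w i \<in> V i" "\<And>i. i \<notin> {1..k} \<Longrightarrow> w i = 0" "v = (\<Sum>i=1..k. w i)"
  shows "proj i v = w i"
proof -
  have "gcomp V k v = w"
    unfolding gcomp_def using assms by (intro the1_equality ex1_components) blast
  then show ?thesis by simp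
qed

lemma linear_proj: "linear (proj i)"
proof (rule linearI)
  fix x y :: 'v and c :: real
  show "proj i (x + y) = proj i x + proj i y"
    by (rule proj_unique)
      (simp_all add: subspace_add[OF subspace_V] proj_V proj_trivial sum.distrib sum_proj del: One_nat_def)
  show "proj i (c *\<^sub>R x) = c *\<^sub>R proj i x"
    by (rule proj_unique)
      (simp_all add: subspace_scale[OF subspace_V] proj_V proj_trivial scaleR_sum_right[symmetric] sum_proj del: One_nat_def)
qed

lemma proj_of_V:
  assumes "v \<in> V j" shows "proj i v = (if i = j then v else 0)"
proof (cases "j \<in> {1..k}")
  case True
  show ?thesis
  proof (rule proj_unique)
    show "v = (\<Sum>i=1..k. if i = j then v else 0)" using True by simp
  qed (use True assms subspace_0[OF subspace_V] in auto)
next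
  case False
  then have "v = 0" using assms V_trivial[of j] by auto
  then show ?thesis by (simp add: linear_0[OF linear_proj])
qed

lemma V_scale_proj: "(\<Sum>i=1..k. g i *\<^sub>R proj i v) = g j *\<^sub>R v" if "v \<in> V j"
proof (cases "j \<in> {1..k}")
  case True
  have "(\<Sum>i=1..k. g i *\<^sub>R proj i v) = (\<Sum>i=1..k. if i = j then g j *\<^sub>R v else 0)"
    by (intro sum.cong) (auto simp: proj_of_V[OF that])
  with True show ?thesis by simp
next
  case False
  then have "v = 0" using that V_trivial[of j] by auto
  then show ?thesis by (simp add: linear_0[OF linear_proj])
qed

lemma linear_scale_proj: "linear (\<lambda>v. \<Sum>i=1..k. g i *\<^sub>R proj i v)"
  by (intro linear_compose_sum ballI linear_compose_scale_right linear_proj)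

text \<open>Homogeneous arguments suffice because every vector is the sum of its components; on a
  single layer dilations and the grading derivation are scalars.\<close>

lemma bilinear_eq_on_V:
  assumes f: "bilinear f" and g: "bilinear g"
    and eq: "\<And>i j x y. x \<in> V i \<Longrightarrow> y \<in> V j \<Longrightarrow> f x y = g x y"
  shows "f x y = (g x y :: 'w::real_vector)"
proof -
  have "f (\<Sum>i=1..k. proj i x) (\<Sum>j=1..k. proj j y) = g (\<Sum>i=1..k. proj i x) (\<Sum>j=1..k. proj j y)"
    unfolding bilinear_sum[OF f] bilinear_sum[OF g] by (intro sum.cong refl) (auto intro: eq proj_V)
  then show ?thesis by (simp add: sum_proj del: One_nat_def)
qed

lemma bilinear_br_compose: "linear f \<Longrightarrow> linear g \<Longrightarrow> bilinear (\<lambda>x y. br (f x) (g y))"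
  using bilinear_br linear_compose[of f "\<lambda>x. br x y" for y] linear_compose[of g "br x" for x]
  by (simp add: bilinear_def o_def)

lemma bilinear_compose_br: "linear f \<Longrightarrow> bilinear (\<lambda>x y. f (br x y))"
  using bilinear_br linear_compose[of "\<lambda>x. br x y" f for y] linear_compose[of "br x" f for x]
  by (simp add: bilinear_def o_def)

lemma linear_dil: "linear (dil V k r)"
  unfolding dil_def by (rule linear_scale_proj)

lemma dil_V: "v \<in> V i \<Longrightarrow> dil V k r v = r ^ i *\<^sub>R v"
  unfolding dil_def by (rule V_scale_proj)

lemma dil_br: "dil V k r (br x y) = br (dil V k r x) (dil V k r y)"
  by (rule bilinear_eq_on_V[OF bilinear_compose_br[OF linear_dil] bilinear_br_compose[OF linear_dil linear_dil]])
    (simp add: dil_V[OF br_V] dil_V linear_cmul[OF linear_br] linear_cmul[OF linear_br_left] power_add)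

text \<open>The infinitesimal generator of the dilations.\<close>

definition weight_der :: "'v \<Rightarrow> 'v" where
  "weight_der v = (\<Sum>i=1..k. real i *\<^sub>R proj i v)"

lemma linear_weight_der: "linear weight_der"
  unfolding weight_der_def by (rule linear_scale_proj)

lemma weight_der_V: "v \<in> V i \<Longrightarrow> weight_der v = real i *\<^sub>R v"
  unfolding weight_der_def by (rule V_scale_proj)

lemma bilinear_add: "bilinear f \<Longrightarrow> bilinear g \<Longrightarrow> bilinear (\<lambda>x y. f x y + g x y)"
  by (simp add: bilinear_def linear_compose_add)

lemma weight_der_br: "weight_der (br x y) = br (weight_der x) y + br x (weight_der y)"
  by (rule bilinear_eq_on_V[OF bilinear_compose_br[OF linear_weight_der]
        bilinear_add[OF bilinear_br_compose[OF linear_weight_der linear_ident]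
          bilinear_br_compose[OF linear_ident linear_weight_der]]])
    (simp add: weight_der_V[OF br_V] weight_der_V linear_cmul[OF linear_br] linear_cmul[OF linear_br_left]
      scaleR_left_distrib)

lemma proj_weight_der: "proj i (weight_der v) = real i *\<^sub>R proj i v"
proof (rule proj_unique)
  show "weight_der v = (\<Sum>i=1..k. real i *\<^sub>R proj i v)" by (rule weight_der_def)
qed (auto simp: subspace_scale[OF subspace_V] proj_V proj_trivial)

lemma proj_eqI: "(\<And>i. i \<in> {1..k} \<Longrightarrow> proj i v = proj i w) \<Longrightarrow> v = w"
  using sum_proj[of v] sum_proj[of w] sum.cong[of "{1..k}" "{1..k}" "\<lambda>i. proj i v" "\<lambda>i. proj i w"] by metis

lemma weight_der_inj: "weight_der v = weight_der w \<Longrightarrow> v = w"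
proof (rule proj_eqI)
  fix i assume "weight_der v = weight_der w" "i \<in> {1..k}"
  then show "proj i v = proj i w"
    using proj_weight_der[where i = i and v = v] proj_weight_der[where i = i and v = w] by simp
qed

text \<open>The sum of the layers from \<open>i\<close> on, expressed by the vanishing of the lower
  components. Unlike a single layer it is stable under brackets with arbitrary vectors and under
  group products.\<close>

definition F :: "nat \<Rightarrow> 'v set" where "F i = {v. \<forall>j<i. proj j v = 0}"

lemma subspace_F: "subspace (F i)"
  by (auto simp: F_def subspace_def linear_0[OF linear_proj] linear_add[OF linear_proj] linear_cmul[OF linear_proj])

lemma F_antimono: "i \<le> j \<Longrightarrow> F j \<subseteq> F i"
  by (auto simp: F_def)

lemma F_1: "F 1 = UNIV"
  by (auto simp: F_def proj_trivial)

lemma F_zero: "k < i \<Longrightarrow> v \<in> F i \<Longrightarrow> v = 0"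
  by (rule proj_eqI) (auto simp: F_def linear_0[OF linear_proj])

lemma F_Suc: "v \<in> F i \<Longrightarrow> v - proj i v \<in> F (Suc i)"
  by (auto simp: F_def linear_diff[OF linear_proj] proj_of_V[OF proj_V] less_Suc_eq)

lemma V_subset_F: "V i \<subseteq> F i"
  by (auto simp: F_def proj_of_V)

lemma br_F:
  assumes "x \<in> F i" "y \<in> F j" shows "br x y \<in> F (i + j)"
proof -
  have "br x y = (\<Sum>(a, b)\<in>{1..k} \<times> {1..k}. br (proj a x) (proj b y))"
    using bilinear_sum[OF bilinear_br, of "\<lambda>a. proj a x" "{1..k}" "\<lambda>b. proj b y" "{1..k}"]
    by (simp add: sum_proj del: One_nat_def)
  also have "\<dots> \<in> F (i + j)"
  proof (rule subspace_sum[OF subspace_F], clarify)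
    fix a b
    show "br (proj a x) (proj b y) \<in> F (i + j)"
    proof (cases "i \<le> a \<and> j \<le> b")
      case True
      have "br (proj a x) (proj b y) \<in> F (a + b)"
        using br_V[OF proj_V proj_V] V_subset_F by blast
      then show ?thesis using F_antimono[of "i + j" "a + b"] True by auto
    next
      case False
      then have "proj a x = 0 \<or> proj b y = 0"
        using assms by (auto simp: F_def)
      then show ?thesis
        by (auto simp: linear_0[OF linear_br] linear_0[OF linear_br_left] subspace_0[OF subspace_F])
    qed
  qed
  finally show ?thesis .
qed

text \<open>The adjoint representation of the semidirect product with the grading derivation, restricted
  to the Lie algebra. The derivation makes it faithful in spite of the centre.\<close>
definition ad_ext :: "'v \<Rightarrow> ('v \<times> real) endo" where
  "ad_ext x = endo_of (\<lambda>p. (br x (fst p) - snd p *\<^sub>R weight_der x, 0))"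

lemma ad_ext_apply: "endo_apply (ad_ext x) p = (br x (fst p) - snd p *\<^sub>R weight_der x, 0)"
proof -
  have "linear (\<lambda>p. (br x (fst p) - snd p *\<^sub>R weight_der x, 0 :: real))"
    by (auto intro!: linearI simp: linear_add[OF linear_br] linear_cmul[OF linear_br] algebra_simps)
  then show ?thesis by (simp add: ad_ext_def endo_apply_endo_of)
qed

text \<open>The derivation direction \<open>(0, 1)\<close> is given degree 0.
  \<open>ad_ext x\<close> sends it to a vector with first entry in \<open>F 1\<close> and second
  entry 0, so every \<open>ad_ext x\<close> raises the degree by one.\<close>

definition ext_filt :: "nat \<Rightarrow> ('v \<times> real) set" where
  "ext_filt i = (if i = 0 then UNIV else F i \<times> {0})"

definition endo_filt :: "nat \<Rightarrow> ('v \<times> real) endo set" where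
  "endo_filt i = {T. \<forall>j. \<forall>p\<in>ext_filt j. endo_apply T p \<in> ext_filt (i + j)}"

lemma subspace_ext_filt: "subspace (ext_filt i)"
  using subspace_F[of i] by (auto simp: ext_filt_def intro: subspace_Times)

lemma ext_filt_antimono: "i \<le> j \<Longrightarrow> ext_filt j \<subseteq> ext_filt i"
  using F_antimono by (auto simp: ext_filt_def)

sublocale nilpotent_representation endo_filt k br ad_ext
proof
  show "subspace (endo_filt i)" for i
    unfolding endo_filt_def subspace_def
    by (auto simp: subspace_0[OF subspace_ext_filt] subspace_add[OF subspace_ext_filt]
        subspace_scale[OF subspace_ext_filt])
  show "x * y \<in> endo_filt (i + j)" if "x \<in> endo_filt i" "y \<in> endo_filt j" for x y i j
    using that by (auto simp: endo_filt_def add.assoc)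
  show "1 \<in> endo_filt 0" by (auto simp: endo_filt_def)
  show "endo_filt j \<subseteq> endo_filt i" if "i \<le> j" for i j
    using ext_filt_antimono[of "i + l" "j + l" for l] that by (auto simp: endo_filt_def)
  show "x = 0" if "x \<in> endo_filt i" "k < i" for x i
  proof (rule endo_eqI)
    fix p
    have "p \<in> ext_filt 0" by (simp add: ext_filt_def)
    then have "endo_apply x p \<in> ext_filt (i + 0)" using that unfolding endo_filt_def by blast
    then show "endo_apply x p = endo_apply 0 p" using \<open>k < i\<close> F_zero[of i]
      by (auto simp: ext_filt_def zero_prod_def)
  qed
  show "bilinear br" by (rule bilinear_br)
  show "ad_ext (x + y) = ad_ext x + ad_ext y" "ad_ext (r *\<^sub>R x) = r *\<^sub>R ad_ext x" for x y r
    by (auto intro!: endo_eqI simp: ad_ext_apply linear_add[OF linear_br_left] linear_cmul[OF linear_br_left]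
        linear_add[OF linear_weight_der] linear_cmul[OF linear_weight_der] algebra_simps)
  show "inj ad_ext"
  proof (rule injI)
    fix x y assume "ad_ext x = ad_ext y"
    \<comment> \<open>Applied to the derivation itself, \<open>ad_ext x\<close> returns
      \<open>- weight_der x\<close>, which determines x.\<close>
    then have "endo_apply (ad_ext x) (0, 1) = endo_apply (ad_ext y) (0, 1)" by simp
    then have "weight_der x = weight_der y"
      by (simp add: ad_ext_apply linear_0[OF linear_br])
    then show "x = y" by (rule weight_der_inj)
  qed
  show "ad_ext (br x y) = commutator (ad_ext x) (ad_ext y)" for x y
  proof (rule endo_eqI)
    fix p
    have "br (br x y) z = br x (br y z) - br y (br x z)" for z
      using jacobi[of x y z] br_antisym[of z "br x y"] br_antisym[of z x] linear_neg[OF linear_br, of y "br x z"]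
      by (simp add: algebra_simps eq_neg_iff_add_eq_0)
    then show "endo_apply (ad_ext (br x y)) p = endo_apply (commutator (ad_ext x) (ad_ext y)) p"
      using br_antisym[of "weight_der x" y]
      by (simp add: commutator_def ad_ext_apply weight_der_br linear_diff[OF linear_br] linear_cmul[OF linear_br]
          algebra_simps)
  qed
  show "ad_ext x \<in> endo_filt 1" for x
  proof -
    have "br x y \<in> F (Suc j)" if "y \<in> F j" for y j
      using br_F[of x 1 y j] that F_1 by simp
    then show ?thesis
      using F_1 by (auto simp: endo_filt_def ext_filt_def ad_ext_apply)
  qed
  show "1 \<le> k" by (rule k_pos)
qed

end

subsection \<open>The group law and the descending filtration\<close>

text \<open>Lipschitz on every bounded set. Polynomial maps such as the group law have this
  property, and unlike a global Lipschitz condition it survives products.\<close>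

definition lip_bounded :: "('a::real_normed_vector \<Rightarrow> 'b::real_normed_vector) \<Rightarrow> bool" where
  "lip_bounded f \<longleftrightarrow> (\<forall>R. \<exists>C. \<forall>p q. norm p \<le> R \<longrightarrow> norm q \<le> R \<longrightarrow> norm (f p - f q) \<le> C * norm (p - q))"

lemma lip_boundedE:
  assumes "lip_bounded f"
  obtains C where "0 \<le> C" "\<And>p q. norm p \<le> R \<Longrightarrow> norm q \<le> R \<Longrightarrow> norm (f p - f q) \<le> C * norm (p - q)"
proof -
  obtain C where C: "\<And>p q. norm p \<le> R \<Longrightarrow> norm q \<le> R \<Longrightarrow> norm (f p - f q) \<le> C * norm (p - q)"
    using assms unfolding lip_bounded_def by meson
  show ?thesis
  proof (rule that[of "max 0 C"])
    fix p q :: 'a assume "norm p \<le> R" "norm q \<le> R"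
    then have "norm (f p - f q) \<le> C * norm (p - q)" by (rule C)
    also have "\<dots> \<le> max 0 C * norm (p - q)" by (intro mult_right_mono) auto
    finally show "norm (f p - f q) \<le> max 0 C * norm (p - q)" .
  qed simp
qed

lemma lip_bounded_bound:
  assumes "lip_bounded f"
  obtains B where "0 \<le> B" "\<And>p. norm p \<le> R \<Longrightarrow> norm (f p) \<le> B"
proof -
  obtain C where C: "0 \<le> C" "\<And>p q. norm p \<le> \<bar>R\<bar> \<Longrightarrow> norm q \<le> \<bar>R\<bar> \<Longrightarrow> norm (f p - f q) \<le> C * norm (p - q)"
    using lip_boundedE[OF assms] by blast
  show ?thesis
  proof (rule that[of "norm (f 0) + C * \<bar>R\<bar>"])
    fix p :: 'a assume p: "norm p \<le> R"
    have "norm (f p - f 0) \<le> C * norm (p - 0)" using p by (intro C) auto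
    also have "\<dots> \<le> C * \<bar>R\<bar>" using p C(1) by (intro mult_left_mono) auto
    finally show "norm (f p) \<le> norm (f 0) + C * \<bar>R\<bar>"
      using norm_triangle_ineq2[of "f p" "f 0"] by linarith
  qed (use C in auto)
qed

lemma lip_bounded_continuous_on:
  fixes f :: "'a::real_normed_vector \<Rightarrow> 'b::real_normed_vector"
  assumes "lip_bounded f" shows "continuous_on S f"
proof (rule continuous_at_imp_continuous_on, rule ballI)
  fix x :: 'a
  obtain C where C: "0 \<le> C" "\<And>p q. norm p \<le> norm x + 1 \<Longrightarrow> norm q \<le> norm x + 1 \<Longrightarrow>
      norm (f p - f q) \<le> C * norm (p - q)"
    using lip_boundedE[OF assms] by blast
  have "norm p \<le> norm x + 1" if "p \<in> ball x 1" for p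
    using that norm_triangle_ineq2[of p x] by (simp add: dist_norm norm_minus_commute)
  then have "C-lipschitz_on (ball x 1) f"
    by (intro lipschitz_onI) (auto simp: dist_norm C)
  from lipschitz_on_continuous_on[OF this] show "isCont f x"
    by (simp add: continuous_on_eq_continuous_at)
qed

lemma lip_bounded_const: "lip_bounded (\<lambda>p. c)"
  by (auto simp: lip_bounded_def intro: exI[of _ 0])

lemma lip_bounded_linear: "bounded_linear f \<Longrightarrow> lip_bounded f"
  using bounded_linear.bounded[of f]
  by (auto simp: lip_bounded_def linear_diff[OF bounded_linear.linear, symmetric] mult.commute)

lemma lip_bounded_add:
  assumes "lip_bounded f" "lip_bounded g" shows "lip_bounded (\<lambda>p. f p + g p)"
  unfolding lip_bounded_def
proof
  fix R
  obtain C where C: "\<And>p q. norm p \<le> R \<Longrightarrow> norm q \<le> R \<Longrightarrow> norm (f p - f q) \<le> C * norm (p - q)"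
    using lip_boundedE[OF assms(1)] by blast
  obtain D where D: "\<And>p q. norm p \<le> R \<Longrightarrow> norm q \<le> R \<Longrightarrow> norm (g p - g q) \<le> D * norm (p - q)"
    using lip_boundedE[OF assms(2)] by blast
  have "norm (f p + g p - (f q + g q)) \<le> (C + D) * norm (p - q)" if "norm p \<le> R" "norm q \<le> R" for p q
    using C[OF that] D[OF that] norm_triangle_ineq[of "f p - f q" "g p - g q"]
    by (simp add: algebra_simps)
  then show "\<exists>C. \<forall>p q. norm p \<le> R \<longrightarrow> norm q \<le> R \<longrightarrow> norm (f p + g p - (f q + g q)) \<le> C * norm (p - q)"
    by blast
qed

lemma lip_bounded_sum:
  "(\<And>i. i \<in> I \<Longrightarrow> lip_bounded (f i)) \<Longrightarrow> lip_bounded (\<lambda>p. \<Sum>i\<in>I. f i p)"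
  by (induction I rule: infinite_finite_induct) (auto simp: lip_bounded_const lip_bounded_add)

lemma lip_bounded_bilinear:
  assumes B: "bounded_bilinear B" and f: "lip_bounded f" and g: "lip_bounded g"
  shows "lip_bounded (\<lambda>p. B (f p) (g p))"
  unfolding lip_bounded_def
proof
  fix R
  obtain K where K: "0 \<le> K" "\<And>a b. norm (B a b) \<le> norm a * norm b * K"
    using bounded_bilinear.nonneg_bounded[OF B] by blast
  obtain C where C: "0 \<le> C" "\<And>p q. norm p \<le> R \<Longrightarrow> norm q \<le> R \<Longrightarrow> norm (f p - f q) \<le> C * norm (p - q)"
    using lip_boundedE[OF f] by blast
  obtain D where D: "0 \<le> D" "\<And>p q. norm p \<le> R \<Longrightarrow> norm q \<le> R \<Longrightarrow> norm (g p - g q) \<le> D * norm (p - q)"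
    using lip_boundedE[OF g] by blast
  obtain M where M: "0 \<le> M" "\<And>p. norm p \<le> R \<Longrightarrow> norm (f p) \<le> M"
    using lip_bounded_bound[OF f] by blast
  obtain N where N: "0 \<le> N" "\<And>p. norm p \<le> R \<Longrightarrow> norm (g p) \<le> N"
    using lip_bounded_bound[OF g] by blast
  have "norm (B (f p) (g p) - B (f q) (g q)) \<le> (C * N * K + M * D * K) * norm (p - q)"
    if p: "norm p \<le> R" and q: "norm q \<le> R" for p q
  proof -
    have "B (f p) (g p) - B (f q) (g q) = B (f p - f q) (g p) + B (f q) (g p - g q)"
      by (simp add: bounded_bilinear.diff_left[OF B] bounded_bilinear.diff_right[OF B])
    also have "norm \<dots> \<le> norm (f p - f q) * norm (g p) * K + norm (f q) * norm (g p - g q) * K"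
      by (intro order.trans[OF norm_triangle_ineq] add_mono K)
    also have "\<dots> \<le> (C * norm (p - q)) * N * K + M * (D * norm (p - q)) * K"
      by (intro add_mono mult_mono C D M N p q K mult_nonneg_nonneg norm_ge_zero order.refl)
    finally show ?thesis by (simp add: algebra_simps)
  qed
  then show "\<exists>C. \<forall>p q. norm p \<le> R \<longrightarrow> norm q \<le> R \<longrightarrow> norm (B (f p) (g p) - B (f q) (g q)) \<le> C * norm (p - q)"
    by blast
qed

text \<open>Separates the pattern of a word from its letters, so that an induction can run over a
  fixed pattern while the letters depend on a parameter.\<close>

lemma dword_eq_map: "dword x y ps = map (\<lambda>b. if b then x else y) (dword True False ps)"
  by (induction ps) auto

lemma dword_map: "map f (dword x y ps) = dword (f x) (f y) ps"
  by (induction ps) auto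

lemma set_dword: "set (dword x y ps) \<subseteq> {x, y}"
  by (induction ps) auto

section \<open>Regularity of the group law, dilations, and products modulo the filtration\<close>

context graded_algebra
begin

abbreviation gmult :: "'v \<Rightarrow> 'v \<Rightarrow> 'v" (infixl "\<odot>" 70) where
  "x \<odot> y \<equiv> bch br k x y"

lemma bounded_bilinear_br: "bounded_bilinear br"
  by (rule bilinear_conv_bounded_bilinear[THEN iffD1, OF bilinear_br])

lemma lip_bounded_bch:
  assumes f: "lip_bounded f" and g: "lip_bounded g"
  shows "lip_bounded (\<lambda>p. f p \<odot> g p)"
proof -
  have "lip_bounded (\<lambda>p. rbr br (map (\<lambda>b. if b then f p else g p) w))" for w
  proof (induction w rule: induct_list012)
    case (2 b) then show ?case using f g by (cases b) auto
  next
    case (3 b c w)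
    have "lip_bounded (\<lambda>p. br (if b then f p else g p) (rbr br (map (\<lambda>b. if b then f p else g p) (c # w))))"
      using f g by (intro lip_bounded_bilinear[OF bounded_bilinear_br] 3) (cases b; simp)
    then show ?case by simp
  qed (simp add: lip_bounded_const)
  then have word: "lip_bounded (\<lambda>p. rbr br (dword (f p) (g p) ps))" for ps
    by (simp add: dword_eq_map[where x = "f p" and y = "g p" for p])
  show ?thesis
    unfolding bch_eq
    by (intro lip_bounded_sum lip_bounded_bilinear[OF bounded_bilinear_scaleR] lip_bounded_const word)
qed

lemma lip_bounded_fst: "lip_bounded fst" and lip_bounded_snd: "lip_bounded snd"
  by (rule lip_bounded_linear, rule bounded_linear_fst bounded_linear_snd)+

lemma continuous_on_bch [continuous_intros]:
  assumes "continuous_on S f" "continuous_on S g"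
  shows "continuous_on S (\<lambda>x. f x \<odot> g x)"
proof -
  have "continuous_on UNIV (\<lambda>p. fst p \<odot> snd p)"
    by (intro lip_bounded_continuous_on lip_bounded_bch lip_bounded_fst lip_bounded_snd)
  from continuous_on_compose2[OF this continuous_on_Pair[OF assms]] show ?thesis by simp
qed

lemma rbr_hom:
  assumes "linear f" and "\<And>x y. f (br x y) = br (f x) (f y)"
  shows "f (rbr br w) = rbr br (map f w)"
  by (induction w rule: induct_list012) (simp_all add: assms(2) linear_0[OF assms(1)])

lemma bch_hom:
  assumes "linear f" and "\<And>x y. f (br x y) = br (f x) (f y)"
  shows "f (x \<odot> y) = f x \<odot> f y"
  unfolding bch_eq linear_sum[OF assms(1)] linear_cmul[OF assms(1)] rbr_hom[OF assms] dword_map ..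

abbreviation dilate :: "real \<Rightarrow> 'v \<Rightarrow> 'v" where "dilate \<equiv> dil V k"

lemma dil_bch: "dilate r (x \<odot> y) = dilate r x \<odot> dilate r y"
  by (rule bch_hom[OF linear_dil dil_br])

lemma proj_dil: "proj i (dilate r v) = r ^ i *\<^sub>R proj i v"
proof (rule proj_unique)
  show "dilate r v = (\<Sum>i=1..k. r ^ i *\<^sub>R proj i v)" by (rule dil_def)
qed (auto simp: subspace_scale[OF subspace_V] proj_V proj_trivial)

lemma dil_dil: "dilate r (dilate s v) = dilate (r * s) v"
  by (rule proj_eqI) (simp add: proj_dil power_mult_distrib)

lemma dil_1: "dilate 1 v = v"
  by (rule proj_eqI) (simp add: proj_dil)

lemma dil_0: "dilate 0 v = 0"
  by (rule proj_eqI) (simp add: proj_dil linear_0[OF linear_proj])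

lemma dil_zero [simp]: "dilate r 0 = 0"
  by (rule linear_0[OF linear_dil])

lemma dil_uminus: "dilate r (- v) = - dilate r v"
  by (rule linear_neg[OF linear_dil])

lemma dil_V1: "v \<in> V 1 \<Longrightarrow> dilate r v = r *\<^sub>R v"
  using dil_V[of v 1] by simp

lemma continuous_on_proj [continuous_intros]:
  "continuous_on S f \<Longrightarrow> continuous_on S (\<lambda>x. proj i (f x))"
  by (rule bounded_linear.continuous_on[OF linear_proj[unfolded linear_conv_bounded_linear]])

lemma continuous_on_dil [continuous_intros]:
  "continuous_on S f \<Longrightarrow> continuous_on S r \<Longrightarrow> continuous_on S (\<lambda>x. dilate (r x) (f x))"
  unfolding dil_def by (intro continuous_intros)

text \<open>For \<open>r\<close> at most 1, each factor \<open>r ^ i\<close> with i at least 1 is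
  bounded by \<open>r\<close>.\<close>

lemma norm_dil_le: "\<exists>C\<ge>0. \<forall>r x. 0 \<le> r \<longrightarrow> r \<le> 1 \<longrightarrow> norm (dilate r x) \<le> C * r * norm x"
proof -
  have "\<exists>C\<ge>0. \<forall>x. norm (proj i x) \<le> C * norm x" for i
    using bounded_linear.nonneg_bounded[of "proj i"] linear_proj[of i]
    by (auto simp: linear_conv_bounded_linear mult.commute)
  then obtain C where C: "\<And>i. 0 \<le> C i" "\<And>i x. norm (proj i x) \<le> C i * norm x" by metis
  show ?thesis
  proof (intro exI[of _ "\<Sum>i=1..k. C i"] conjI allI impI)
    show "0 \<le> (\<Sum>i=1..k. C i)" by (intro sum_nonneg C)
    fix r :: real and x :: 'v assume r: "0 \<le> r" "r \<le> 1"
    have "norm (dilate r x) \<le> (\<Sum>i=1..k. norm (r ^ i *\<^sub>R proj i x))"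
      unfolding dil_def by (rule norm_sum)
    also have "\<dots> \<le> (\<Sum>i=1..k. r * (C i * norm x))"
    proof (rule sum_mono)
      fix i assume "i \<in> {1..k}"
      then have "r ^ i \<le> r" using power_decreasing[of 1 i r] r by simp
      then have "r ^ i * norm (proj i x) \<le> r * (C i * norm x)"
        using r C by (intro mult_mono) auto
      then show "norm (r ^ i *\<^sub>R proj i x) \<le> r * (C i * norm x)" using r by simp
    qed
    finally show "norm (dilate r x) \<le> (\<Sum>i=1..k. C i) * r * norm x"
      by (simp add: sum_distrib_left sum_distrib_right mult.assoc mult.left_commute)
  qed
qed

text \<open>The innermost bracket of a word in two letters is \<open>br x y\<close> up to sign, or
  zero; the outer letters map S into itself.\<close>

lemma rbr_word_in:
  assumes S: "subspace S" and brS: "\<And>z. z \<in> S \<Longrightarrow> br x z \<in> S" "\<And>z. z \<in> S \<Longrightarrow> br y z \<in> S" and xy: "br x y \<in> S"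
    and w: "set w \<subseteq> {x, y}" "2 \<le> length w"
  shows "rbr br w \<in> S"
  using w
proof (induction w)
  case (Cons a w)
  show ?case
  proof (cases "2 \<le> length w")
    case True
    then have "rbr br w \<in> S" "w \<noteq> []" using Cons by auto
    then show ?thesis using brS Cons.prems(1) by (auto simp: rbr_Cons)
  next
    case False
    then obtain b where "w = [b]" using Cons.prems(2) by (cases w) (auto simp: Suc_le_eq)
    moreover have "br y x \<in> S" using br_antisym[of y x] xy S by (simp add: subspace_neg)
    ultimately show ?thesis using Cons.prems(1) xy S by (auto simp: br_self subspace_0)
  qed
qed simp

lemma dlists_dlen_1:
  assumes "ps \<in> dlists k n" "1 \<le> n" "dlen ps < 2"
  shows "ps = [(1, 0)] \<or> ps = [(0, 1)]"
proof -
  have "length ps = 1" using dlen_dlists[OF assms(1)] assms by (auto simp: dlists_def)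
  then obtain r s where "ps = [(r, s)]" by (cases ps) auto
  then show ?thesis using assms dlists_pos[OF assms(1)] by auto
qed

text \<open>The two words of length one, singled out by \<open>l\<close>, contribute exactly x + y;
  every longer word lies in S.\<close>

lemma bch_minus_add_in:
  assumes S: "subspace S" and brS: "\<And>z. z \<in> S \<Longrightarrow> br x z \<in> S" "\<And>z. z \<in> S \<Longrightarrow> br y z \<in> S" and xy: "br x y \<in> S"
  shows "x \<odot> y - (x + y) \<in> S"
proof -
  define l where "l ps = (if ps = [(1, 0)] then x else if ps = [(0::nat, 1::nat)] then y else 0)" for ps
  have in_S: "rbr br (dword x y ps) - l ps \<in> S" if "ps \<in> dlists k n" "1 \<le> n" for ps n
  proof (cases "2 \<le> dlen ps")
    case True
    then have "rbr br (dword x y ps) \<in> S"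
      using rbr_word_in[OF S brS xy set_dword] by (simp add: length_dword)
    moreover have "l ps = 0" using True by (auto simp: l_def)
    ultimately show ?thesis by simp
  next
    case False
    then show ?thesis
      using dlists_dlen_1[OF that] S by (auto simp: l_def subspace_0)
  qed
  let ?c = "\<lambda>n. (-1) ^ (n - 1) / real n"
  have "(\<Sum>n=1..k. ?c n *\<^sub>R (\<Sum>ps\<in>dlists k n. (dcoeff ps / real (dlen ps)) *\<^sub>R l ps)) = x + y"
  proof -
    have "(\<Sum>ps\<in>dlists k n. (dcoeff ps / real (dlen ps)) *\<^sub>R l ps) = (if n = 1 then x + y else 0)" for n
    proof (cases "n = 1")
      case True
      have sub: "{[(1, 0)], [(0, 1)]} \<subseteq> dlists k 1" using k_pos by (auto simp: dlists_def)
      have "(\<Sum>ps\<in>dlists k 1. (dcoeff ps / real (dlen ps)) *\<^sub>R l ps)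
          = (\<Sum>ps\<in>{[(1, 0)], [(0, 1)]}. (dcoeff ps / real (dlen ps)) *\<^sub>R l ps)"
        by (rule sum.mono_neutral_right[OF finite_dlists sub]) (auto simp: l_def)
      with True show ?thesis by (simp add: l_def dcoeff_def)
    next
      case False
      then have "l ps = 0" if "ps \<in> dlists k n" for ps using that by (auto simp: l_def dlists_def)
      with False show ?thesis by simp
    qed
    then have "(\<Sum>n=1..k. ?c n *\<^sub>R (\<Sum>ps\<in>dlists k n. (dcoeff ps / real (dlen ps)) *\<^sub>R l ps))
        = (\<Sum>n=1..k. if n = 1 then x + y else 0)"
      by (intro sum.cong refl) simp
    then show ?thesis using k_pos by simp
  qed
  then have "x \<odot> y - (x + y) = (\<Sum>n=1..k. ?c n *\<^sub>R
      (\<Sum>ps\<in>dlists k n. (dcoeff ps / real (dlen ps)) *\<^sub>R (rbr br (dword x y ps) - l ps)))"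
    unfolding bch_eq by (simp add: scaleR_right_diff_distrib sum_subtractf)
  also have "\<dots> \<in> S"
    by (intro subspace_sum[OF S] subspace_scale[OF S] in_S) auto
  finally show ?thesis .
qed

lemma bch_F:
  assumes x: "x \<in> F i" and y: "y \<in> F j" shows "x \<odot> y - (x + y) \<in> F (i + j)"
proof (rule bch_minus_add_in[OF subspace_F])
  show "br x y \<in> F (i + j)" by (rule br_F[OF x y])
  show "br x z \<in> F (i + j)" if "z \<in> F (i + j)" for z
    using br_F[OF x that] F_antimono[of "i + j" "i + (i + j)"] by auto
  show "br y z \<in> F (i + j)" if "z \<in> F (i + j)" for z
    using br_F[OF y that] F_antimono[of "i + j" "j + (i + j)"] by auto
qed

lemmas F_intros = subspace_0[OF subspace_F] subspace_add[OF subspace_F] subspace_diff[OF subspace_F]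
  subspace_neg[OF subspace_F] subspace_scale[OF subspace_F] subspace_sum[OF subspace_F]

lemma bch_closed_F:
  assumes x: "x \<in> F i" and y: "y \<in> F i" shows "x \<odot> y \<in> F i"
proof -
  have "x \<odot> y - (x + y) \<in> F i" using bch_F[OF x y] F_antimono[of i "i + i"] by auto
  then have "(x \<odot> y - (x + y)) + (x + y) \<in> F i"
    using x y by (intro subspace_add[OF subspace_F])
  then show ?thesis by simp
qed

text \<open>With w = e^(ad x) y - y, conjugation gives \<open>c \<odot> y = y + w\<close>, while the
  group law differs from addition only in deeper layers. So c agrees with w, and w with
  \<open>br x y\<close>, modulo \<open>F (Suc (Suc j))\<close>.\<close>

lemma group_commutator_F:
  fixes x y :: 'v
  assumes y: "y \<in> F j" and j: "1 \<le> j"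
  defines "c \<equiv> x \<odot> y \<odot> (- x) \<odot> (- y)"
  shows "c \<in> F (Suc j)" "c - br x y \<in> F (Suc (Suc j))"
proof -
  have br_x: "br x z \<in> F (Suc i)" if "z \<in> F i" for z i
    using br_F[of x 1 z i] F_1 that by simp
  have funpow_F: "(br x ^^ i) y \<in> F (i + j)" for i
    by (induction i) (auto simp: y br_x)
  define w where "w = exp_ad x y - y"
  have w: "w - br x y \<in> F (Suc (Suc j))"
  proof -
    obtain k' where k': "k = Suc k'" using k_pos by (cases k) auto
    have "w - br x y = (\<Sum>i<k'. (1 / fact (Suc (Suc i))) *\<^sub>R (br x ^^ Suc (Suc i)) y)"
      unfolding w_def fps_ev_def k' by (simp add: sum.atMost_Suc_shift lessThan_Suc_atMost[symmetric] sum.lessThan_Suc_shift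
          del: sum.lessThan_Suc sum.atMost_Suc fact_Suc funpow.simps(2), simp)
    also have "\<dots> \<in> F (Suc (Suc j))"
    proof (intro F_intros)
      fix i show "(br x ^^ Suc (Suc i)) y \<in> F (Suc (Suc j))"
        using funpow_F[of "Suc (Suc i)"] F_antimono[of "Suc (Suc j)" "Suc (Suc i) + j"] by auto
    qed
    finally show ?thesis .
  qed
  then have "(w - br x y) + br x y \<in> F (Suc j)"
    using F_antimono[of "Suc j" "Suc (Suc j)"] br_x[OF y] by (intro subspace_add[OF subspace_F]) auto
  then have w': "w \<in> F (Suc j)" by simp
  have cy: "c \<odot> y = y + w"
    unfolding c_def bch_conj by (simp add: bch_assoc w_def)
  have "y + w \<in> F j"
    using y w' F_antimono[of j "Suc j"] by (intro F_intros) auto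
  \<comment> \<open>A bootstrap: this crude degree of c yields \<open>F (Suc j)\<close>, and
    inserting that into the same identity gains the last degree, as j is at least 1.\<close>
  then have "c \<in> F j"
    unfolding c_def bch_conj using y by (auto simp: w_def intro!: bch_closed_F F_intros)
  from bch_F[OF this y] have "w - c \<in> F (j + j)" by (simp add: cy algebra_simps)
  then have "w - (w - c) \<in> F (Suc j)"
    using w' F_antimono[of "Suc j" "j + j"] j
    by - (rule subspace_diff[OF subspace_F], auto)
  then show c: "c \<in> F (Suc j)" by simp
  from bch_F[OF this y] have "w - c \<in> F (Suc j + j)" by (simp add: cy algebra_simps)
  then have "w - br x y - (w - c) \<in> F (Suc (Suc j))"
    using w F_antimono[of "Suc (Suc j)" "Suc j + j"] j
    by - (rule subspace_diff[OF subspace_F], auto)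
  then show "c - br x y \<in> F (Suc (Suc j))" by (simp add: algebra_simps)
qed

end

subsection \<open>Homogeneous distances\<close>

text \<open>A speed bound at every single point is chained by bisection into a bound on the whole
  interval. The function D is general because the lemma is applied both to \<open>d\<close> and to
  the Euclidean distance.\<close>

lemma pointwise_lipschitz_imp_lipschitz:
  fixes \<gamma> :: "real \<Rightarrow> 'a" and D :: "'a \<Rightarrow> 'a \<Rightarrow> real"
  assumes sym: "\<And>x y. D x y = D y x" and tri: "\<And>x y z. D x z \<le> D x y + D y z"
    and loc: "\<And>s e. s \<in> {0..T} \<Longrightarrow> 0 < e \<Longrightarrow>
      \<exists>\<delta>>0. \<forall>s'\<in>{0..T}. \<bar>s' - s\<bar> < \<delta> \<longrightarrow> D (\<gamma> s) (\<gamma> s') \<le> (M + e) * \<bar>s' - s\<bar>"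
    and ab: "0 \<le> a" "a \<le> b" "b \<le> T"
  shows "D (\<gamma> a) (\<gamma> b) \<le> M * (b - a)"
proof (cases "a = b")
  case True
  obtain \<delta> where "0 < \<delta>" "\<forall>s'\<in>{0..T}. \<bar>s' - a\<bar> < \<delta> \<longrightarrow> D (\<gamma> a) (\<gamma> s') \<le> (M + 1) * \<bar>s' - a\<bar>"
    using loc[of a 1] ab by auto
  from this(2)[rule_format, of a] \<open>0 < \<delta>\<close> ab True show ?thesis by simp
next
  case False
  have le: "D (\<gamma> a) (\<gamma> b) \<le> (M + e) * (b - a)" if "0 < e" for e
  proof -
    \<comment> \<open>Bisection also tests small intervals that stick out of [0, T]; the guards make
      the claim vacuous for them.\<close>
    define P where "P u v \<longleftrightarrow> (0 \<le> u \<longrightarrow> v \<le> T \<longrightarrow> D (\<gamma> u) (\<gamma> v) \<le> (M + e) * (v - u))" for u v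
    have "P a b" using \<open>a \<le> b\<close>
    proof (induction rule: Bolzano)
      case (trans u v w)
      show ?case unfolding P_def
      proof (intro impI)
        assume "0 \<le> u" "w \<le> T"
        then have "D (\<gamma> u) (\<gamma> v) \<le> (M + e) * (v - u)" "D (\<gamma> v) (\<gamma> w) \<le> (M + e) * (w - v)"
          using trans by (auto simp: P_def)
        then show "D (\<gamma> u) (\<gamma> w) \<le> (M + e) * (w - u)"
          using tri[of "\<gamma> u" "\<gamma> w" "\<gamma> v"] by (simp add: algebra_simps)
      qed
    next
      case (local x)
      then obtain \<delta> where \<delta>: "0 < \<delta>" "\<forall>s'\<in>{0..T}. \<bar>s' - x\<bar> < \<delta> \<longrightarrow> D (\<gamma> x) (\<gamma> s') \<le> (M + e) * \<bar>s' - x\<bar>"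
        using loc[of x e] ab \<open>0 < e\<close> by auto
      have "P u v" if "u \<le> x" "x \<le> v" "v - u < \<delta>" for u v
        unfolding P_def
      proof (intro impI)
        assume "0 \<le> u" "v \<le> T"
        then have "D (\<gamma> x) (\<gamma> u) \<le> (M + e) * (x - u)" "D (\<gamma> x) (\<gamma> v) \<le> (M + e) * (v - x)"
          using \<delta>(2)[rule_format, of u] \<delta>(2)[rule_format, of v] that by auto
        then show "D (\<gamma> u) (\<gamma> v) \<le> (M + e) * (v - u)"
          using tri[of "\<gamma> u" "\<gamma> v" "\<gamma> x"] sym[of "\<gamma> u" "\<gamma> x"] by (simp add: algebra_simps)
      qed
      with \<delta>(1) show ?case by blast
    qed
    then show ?thesis using ab by (simp add: P_def)
  qed
  show ?thesis
  proof (rule field_le_epsilon)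
    fix e :: real assume "0 < e"
    then have "D (\<gamma> a) (\<gamma> b) \<le> (M + e / (b - a)) * (b - a)"
      using False ab by (intro le) auto
    then show "D (\<gamma> a) (\<gamma> b) \<le> M * (b - a) + e"
      using False by (simp add: distrib_right)
  qed
qed

locale homogeneous_group = graded_algebra br V k
  for br :: "'v::euclidean_space \<Rightarrow> 'v \<Rightarrow> 'v" and V :: "nat \<Rightarrow> 'v set" and k :: nat +
  fixes d :: "'v \<Rightarrow> 'v \<Rightarrow> real"
  assumes hom_dist: "hom_dist br V k d"
begin

lemma d_eq_0_iff [simp]: "d x y = 0 \<longleftrightarrow> x = y"
  and d_sym: "d x y = d y x"
  and d_tri: "d x z \<le> d x y + d y z"
  and d_left [simp]: "d (z \<odot> x) (z \<odot> y) = d x y"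
  and d_dil: "0 < r \<Longrightarrow> d (dilate r x) (dilate r y) = r * d x y"
  and d_cont: "continuous_on UNIV (\<lambda>p. d (fst p) (snd p))"
  using hom_dist unfolding hom_dist_def by metis+

definition hnorm :: "'v \<Rightarrow> real" where "hnorm x = d x 0"

lemma d_self [simp]: "d x x = 0"
  by simp

lemma d_eq_hnorm: "d x y = hnorm (- x \<odot> y)"
  using d_left[of "- x" x y] by (simp add: hnorm_def d_sym)

lemma d_nonneg [simp]: "0 \<le> d x y"
proof -
  have "d x x = 0" by simp
  then show ?thesis using d_tri[of x x y] d_sym[of x y] by linarith
qed

lemma hnorm_nonneg [simp]: "0 \<le> hnorm x"
  by (simp add: hnorm_def)

lemma hnorm_eq_0_iff [simp]: "hnorm x = 0 \<longleftrightarrow> x = 0"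
  by (simp add: hnorm_def)

lemma hnorm_0 [simp]: "hnorm 0 = 0"
  by simp

lemma hnorm_uminus [simp]: "hnorm (- x) = hnorm x"
  using d_eq_hnorm[of x 0] by (simp add: hnorm_def)

lemma d_mult_right [simp]: "d (x \<odot> h) x = hnorm h" "d x (x \<odot> h) = hnorm h"
  using d_left[of x h 0] d_left[of x 0 h] by (simp_all add: hnorm_def d_sym)

lemma hnorm_mult: "hnorm (x \<odot> y) \<le> hnorm x + hnorm y"
  using d_tri[of "x \<odot> y" 0 x] by (simp add: hnorm_def[of x] hnorm_def[of "x \<odot> y"])

lemma hnorm_dil: "0 \<le> r \<Longrightarrow> hnorm (dilate r x) = r * hnorm x"
  using d_dil[of r x 0] by (cases "r = 0") (auto simp: hnorm_def dil_0)

lemma hnorm_scale_V1: "x \<in> V 1 \<Longrightarrow> hnorm (r *\<^sub>R x) = \<bar>r\<bar> * hnorm x"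
  using hnorm_dil[of "\<bar>r\<bar>" x] hnorm_uminus[of "r *\<^sub>R x"] dil_V1[of x "\<bar>r\<bar>"]
  by (cases "0 \<le> r") auto

section \<open>Balls of the homogeneous distance and the Euclidean topology\<close>

lemma continuous_on_d [continuous_intros]:
  assumes "continuous_on S f" "continuous_on S g"
  shows "continuous_on S (\<lambda>x. d (f x) (g x))"
  using continuous_on_compose2[OF d_cont continuous_on_Pair[OF assms]] by simp

lemma continuous_on_hnorm [continuous_intros]:
  "continuous_on S f \<Longrightarrow> continuous_on S (\<lambda>x. hnorm (f x))"
  unfolding hnorm_def by (intro continuous_intros)

text \<open>A point of Euclidean norm at least 1 can be moved onto the unit sphere by a dilation
  with factor at most 1, which does not raise \<open>hnorm\<close>. So the minimum of
  \<open>hnorm\<close> on the sphere serves as m.\<close>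

lemma hnorm_small: "\<exists>m>0. \<forall>x. hnorm x < m \<longrightarrow> norm x < 1"
proof -
  have "continuous_on (sphere 0 1) hnorm"
    by (intro continuous_intros)
  moreover have "sphere 0 1 \<noteq> ({} :: 'v set)" by simp
  ultimately obtain z where z: "z \<in> sphere 0 1" "\<And>x. x \<in> sphere 0 1 \<Longrightarrow> hnorm z \<le> hnorm x"
    using continuous_attains_inf[OF compact_sphere] by blast
  have "norm x < 1" if x: "hnorm x < hnorm z" for x
  proof (rule ccontr)
    assume "\<not> norm x < 1"
    then have "1 \<le> norm (dilate 1 x)" by (simp add: dil_1)
    moreover have "norm (dilate 0 x) \<le> 1" by (simp add: dil_0)
    moreover have "continuous_on {0..1} (\<lambda>r. norm (dilate r x))"
      by (intro continuous_intros)
    ultimately obtain r where r: "0 \<le> r" "r \<le> 1" "norm (dilate r x) = 1"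
      using IVT'[of "\<lambda>r. norm (dilate r x)" 0 1 1] by auto
    then have "hnorm z \<le> r * hnorm x" using z(2)[of "dilate r x"] by (simp add: hnorm_dil)
    also have "\<dots> \<le> 1 * hnorm x" using r by (intro mult_right_mono) auto
    finally show False using x by simp
  qed
  moreover have "0 < hnorm z"
    using z(1) hnorm_nonneg[of z] hnorm_eq_0_iff[of z] by (auto simp: less_le)
  ultimately show ?thesis by blast
qed

text \<open>A dilation shrinks the ball of radius c into the small ball of
  \<open>hnorm_small\<close>, so the original ball lies in a dilated Euclidean ball, which is
  compact.\<close>

lemma norm_bounded_of_hnorm: "\<exists>R. \<forall>x. hnorm x \<le> c \<longrightarrow> norm x \<le> R"
proof -
  obtain m where m: "0 < m" "\<And>x. hnorm x < m \<Longrightarrow> norm x < 1" using hnorm_small by blast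
  define r where "r = (\<bar>c\<bar> + 1) / m"
  have r: "0 < r" using m(1) by (simp add: r_def)
  have "compact (dilate r ` cball 0 1)"
    by (intro compact_continuous_image continuous_intros compact_cball)
  then obtain R where R: "\<And>x. x \<in> dilate r ` cball 0 1 \<Longrightarrow> norm x \<le> R"
    using compact_imp_bounded bounded_iff by metis
  have "norm x \<le> R" if "hnorm x \<le> c" for x
  proof (rule R, rule image_eqI)
    show "x = dilate r (dilate (1 / r) x)" using r by (simp add: dil_dil dil_1)
    have "hnorm (dilate (1 / r) x) = m * hnorm x / (\<bar>c\<bar> + 1)"
      using m(1) by (subst hnorm_dil) (auto simp: r_def)
    also have "\<dots> < m"
    proof -
      have "hnorm x < \<bar>c\<bar> + 1" using that by linarith
      then show ?thesis using m(1) by (subst pos_divide_less_eq) auto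
    qed
    finally show "dilate (1 / r) x \<in> cball 0 1" using m(2) by force
  qed
  then show ?thesis by blast
qed

lemma compact_hnorm_ball: "compact {x. hnorm x \<le> c}"
proof -
  have "closed {x. hnorm x \<le> c}"
    by (intro closed_Collect_le continuous_intros)
  moreover have "bounded {x. hnorm x \<le> c}"
    using norm_bounded_of_hnorm[of c] by (auto simp: bounded_iff)
  ultimately show ?thesis by (simp add: compact_eq_bounded_closed)
qed

text \<open>Dilating x to \<open>hnorm\<close> equal to 1 gives a bounded vector; dilating back by a
  factor \<open>hnorm x\<close> of at most 1 shrinks its Euclidean norm at least in proportion, up
  to a constant.\<close>

lemma norm_le_hnorm: "\<exists>C>0. \<forall>x. hnorm x \<le> 1 \<longrightarrow> norm x \<le> C * hnorm x"
proof -
  obtain R where R: "\<And>x. hnorm x \<le> 1 \<Longrightarrow> norm x \<le> R" using norm_bounded_of_hnorm by blast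
  obtain C where C: "0 \<le> C" "\<And>r x. 0 \<le> r \<Longrightarrow> r \<le> 1 \<Longrightarrow> norm (dilate r x) \<le> C * r * norm x"
    using norm_dil_le by blast
  have "norm x \<le> (C * \<bar>R\<bar> + 1) * hnorm x" if x: "hnorm x \<le> 1" for x
  proof (cases "x = 0")
    case False
    let ?r = "hnorm x"
    have r: "0 < ?r" using False by (simp add: less_le)
    let ?y = "dilate (1 / ?r) x"
    have "hnorm ?y = 1" using False by (simp add: hnorm_dil)
    then have "norm ?y \<le> \<bar>R\<bar>" using R[of ?y] by auto
    have "norm x = norm (dilate ?r ?y)" using r by (simp add: dil_dil dil_1)
    also have "\<dots> \<le> C * ?r * norm ?y" using x by (intro C) auto
    also have "\<dots> \<le> C * ?r * \<bar>R\<bar>" using C(1) \<open>norm ?y \<le> \<bar>R\<bar>\<close> by (intro mult_left_mono) auto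
    also have "\<dots> \<le> (C * \<bar>R\<bar> + 1) * ?r" by (simp add: algebra_simps)
    finally show ?thesis .
  qed simp
  moreover have "0 < C * \<bar>R\<bar> + 1" using C(1) by (simp add: add_nonneg_pos)
  ultimately show ?thesis by blast
qed

lemma open_contains_d_ball:
  assumes "open S" "x \<in> S" shows "\<exists>\<delta>>0. \<forall>y. d x y < \<delta> \<longrightarrow> y \<in> S"
proof -
  obtain C where C: "0 < C" "\<And>x. hnorm x \<le> 1 \<Longrightarrow> norm x \<le> C * hnorm x"
    using norm_le_hnorm by blast
  have "continuous_on UNIV (\<lambda>u. x \<odot> u)" by (intro continuous_intros)
  then have "open ((\<lambda>u. x \<odot> u) -` S)" using assms(1) by (auto intro: open_vimage)
  moreover have "0 \<in> (\<lambda>u. x \<odot> u) -` S" using assms(2) by simp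
  ultimately obtain e where e: "0 < e" "\<And>u. norm u < e \<Longrightarrow> x \<odot> u \<in> S"
    by (metis open_contains_ball_eq[of "(\<lambda>u. x \<odot> u) -` S"] mem_ball_0 subsetD vimageD)
  show ?thesis
  proof (intro exI[of _ "min 1 (e / C)"] conjI allI impI)
    show "0 < min 1 (e / C)" using e C by simp
    fix y assume y: "d x y < min 1 (e / C)"
    let ?u = "- x \<odot> y"
    have "norm ?u \<le> C * hnorm ?u" using y by (intro C) (auto simp: d_eq_hnorm)
    also have "\<dots> < e" using y C(1) by (simp add: d_eq_hnorm pos_less_divide_eq mult.commute)
    finally have "x \<odot> ?u \<in> S" by (rule e(2))
    then show "y \<in> S" by simp
  qed
qed

lemma open_d_ball: "open {y. d x y < \<delta>}"
  by (intro open_Collect_less continuous_intros)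

lemma continuous_at_d:
  "isCont f x \<Longrightarrow> 0 < e \<Longrightarrow> \<exists>\<delta>>0. \<forall>y. d x y < \<delta> \<longrightarrow> norm (f y - f x) < (e::real)"
  for f :: "'v \<Rightarrow> 'w::real_normed_vector"
proof -
  assume "isCont f x" "0 < e"
  then obtain \<delta> where \<delta>: "0 < \<delta>" "\<And>y. dist y x < \<delta> \<Longrightarrow> dist (f y) (f x) < e"
    unfolding continuous_at_eps_delta by blast
  have "\<exists>\<delta>'>0. \<forall>y. d x y < \<delta>' \<longrightarrow> y \<in> ball x \<delta>"
    using \<delta>(1) by (intro open_contains_d_ball) auto
  then show ?thesis using \<delta>(2) by (auto simp: dist_commute dist_norm)
qed

text \<open>Conjugation fixes the identity and is uniformly continuous on compact sets; balls of
  \<open>hnorm\<close> are compact.\<close>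

lemma conj_small_unit:
  assumes "0 < \<eta>"
  shows "\<exists>\<epsilon>>0. \<forall>q u. hnorm q \<le> c \<longrightarrow> hnorm u \<le> \<epsilon> \<longrightarrow> hnorm (- q \<odot> u \<odot> q) \<le> \<eta>"
proof -
  obtain C where C: "0 < C" "\<And>x. hnorm x \<le> 1 \<Longrightarrow> norm x \<le> C * hnorm x"
    using norm_le_hnorm by blast
  let ?K = "{q. hnorm q \<le> c} \<times> {u. hnorm u \<le> 1}"
  let ?g = "\<lambda>p. hnorm (- fst p \<odot> snd p \<odot> fst p)"
  have "compact ?K" by (intro compact_Times compact_hnorm_ball)
  moreover have "continuous_on ?K ?g" by (intro continuous_intros)
  ultimately have "uniformly_continuous_on ?K ?g" by (intro compact_uniformly_continuous)
  then obtain \<delta> where \<delta>: "0 < \<delta>" "\<And>p p'. p \<in> ?K \<Longrightarrow> p' \<in> ?K \<Longrightarrow> dist p' p < \<delta> \<Longrightarrow> dist (?g p') (?g p) < \<eta>"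
    using assms unfolding uniformly_continuous_on_def by meson
  show ?thesis
  proof (intro exI[of _ "min 1 (\<delta> / (2 * C))"] conjI allI impI)
    show "0 < min 1 (\<delta> / (2 * C))" using \<delta> C by simp
    fix q u assume q: "hnorm q \<le> c" and u: "hnorm u \<le> min 1 (\<delta> / (2 * C))"
    have "norm u \<le> C * hnorm u" using u by (intro C) simp
    also have "\<dots> \<le> \<delta> / 2" using u C(1) by (simp add: pos_le_divide_eq mult.commute mult.left_commute)
    also have "\<dots> < \<delta>" using \<delta>(1) by simp
    finally have "dist (?g (q, u)) (?g (q, 0)) < \<eta>"
      using q u by (intro \<delta>(2)) (auto simp: dist_norm)
    then show "hnorm (- q \<odot> u \<odot> q) \<le> \<eta>" by (simp add: dist_real_def)
  qed
qed

text \<open>Right multiplication does not preserve \<open>d\<close>: it conjugates the quotient of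
  the two points by q. Dilation by 1 / r reduces to bounded q, so one \<epsilon> works at every
  scale.\<close>

lemma d_mult_right_small:
  assumes "0 < \<eta>"
  shows "\<exists>\<epsilon>>0. \<forall>r>0. \<forall>q a a'. hnorm q \<le> c * r \<longrightarrow> d a a' \<le> \<epsilon> * r \<longrightarrow> d (a \<odot> q) (a' \<odot> q) \<le> \<eta> * r"
proof -
  obtain \<epsilon> where \<epsilon>: "0 < \<epsilon>" "\<And>q u. hnorm q \<le> c \<Longrightarrow> hnorm u \<le> \<epsilon> \<Longrightarrow> hnorm (- q \<odot> u \<odot> q) \<le> \<eta>"
    using conj_small_unit[OF assms] by blast
  have "d (a \<odot> q) (a' \<odot> q) \<le> \<eta> * r" if r: "0 < r" and q: "hnorm q \<le> c * r" and a: "d a a' \<le> \<epsilon> * r" for r q a a'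
  proof -
    let ?D = "dilate (1 / r)"
    have "hnorm (- ?D q \<odot> ?D (- a \<odot> a') \<odot> ?D q) \<le> \<eta>"
      using r q a by (intro \<epsilon>(2)) (auto simp: hnorm_dil d_eq_hnorm pos_divide_le_eq)
    moreover have "- ?D q \<odot> ?D (- a \<odot> a') \<odot> ?D q = ?D (- (a \<odot> q) \<odot> (a' \<odot> q))"
      by (simp add: dil_bch dil_uminus minus_bch bch_assoc)
    ultimately show ?thesis
      using r by (simp add: hnorm_dil d_eq_hnorm pos_divide_le_eq)
  qed
  with \<epsilon>(1) show ?thesis by blast
qed

end

subsection \<open>Horizontal curves\<close>

context homogeneous_group
begin

text \<open>The product vanishes at A = A0 and is locally Lipschitz in A, which gives the factor
  \<open>norm (A - A0)\<close>. Both vectors are horizontal, so the time acts as a dilation, which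
  gives the factor of \<tau>.\<close>

lemma bch_V1_parallel_small:
  assumes A0: "A0 \<in> V 1"
  shows "\<exists>C\<ge>0. \<forall>\<tau> A. A \<in> V 1 \<longrightarrow> norm (A - A0) \<le> 1 \<longrightarrow> \<bar>\<tau>\<bar> \<le> 1 \<longrightarrow>
    norm (\<tau> *\<^sub>R A \<odot> (- \<tau>) *\<^sub>R A0) \<le> C * norm (A - A0) * \<bar>\<tau>\<bar>"
proof -
  obtain C where C: "0 \<le> C" "\<And>r x. 0 \<le> r \<Longrightarrow> r \<le> 1 \<Longrightarrow> norm (dilate r x) \<le> C * r * norm x"
    using norm_dil_le by blast
  have "lip_bounded (\<lambda>A. s *\<^sub>R A \<odot> (- s) *\<^sub>R A0)" for s
    by (intro lip_bounded_bch lip_bounded_const lip_bounded_linear bounded_linear_scaleR_right)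
  then have "\<exists>D\<ge>0. \<forall>A. norm (A - A0) \<le> 1 \<longrightarrow> norm (s *\<^sub>R A \<odot> (- s) *\<^sub>R A0) \<le> D * norm (A - A0)" for s
  proof -
    obtain D where D: "0 \<le> D" "\<And>p q. norm p \<le> norm A0 + 1 \<Longrightarrow> norm q \<le> norm A0 + 1 \<Longrightarrow>
        norm ((s *\<^sub>R p \<odot> (- s) *\<^sub>R A0) - (s *\<^sub>R q \<odot> (- s) *\<^sub>R A0)) \<le> D * norm (p - q)"
      using lip_boundedE[OF \<open>lip_bounded (\<lambda>A. s *\<^sub>R A \<odot> (- s) *\<^sub>R A0)\<close>] by blast
    have "norm (s *\<^sub>R A \<odot> (- s) *\<^sub>R A0) \<le> D * norm (A - A0)" if "norm (A - A0) \<le> 1" for A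
      using D(2)[of A A0] that norm_triangle_ineq2[of A A0] bch_minus_right[of "s *\<^sub>R A0"] by simp
    with D(1) show ?thesis by blast
  qed
  then obtain D where D: "\<And>s. 0 \<le> D s"
    "\<And>s A. norm (A - A0) \<le> 1 \<Longrightarrow> norm (s *\<^sub>R A \<odot> (- s) *\<^sub>R A0) \<le> D s * norm (A - A0)"
    by metis
  define K where "K = C * (D 1 + D (- 1))"
  have "norm (\<tau> *\<^sub>R A \<odot> (- \<tau>) *\<^sub>R A0) \<le> K * norm (A - A0) * \<bar>\<tau>\<bar>"
    if A: "A \<in> V 1" "norm (A - A0) \<le> 1" and \<tau>: "\<bar>\<tau>\<bar> \<le> 1" for \<tau> A
  proof -
    \<comment> \<open>The dilation estimate takes a nonnegative factor, so the sign of \<tau> is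
      moved to the vectors.\<close>
    define s :: real where "s = (if 0 \<le> \<tau> then 1 else - 1)"
    have \<tau>_eq: "\<tau> = \<bar>\<tau>\<bar> * s" by (simp add: s_def)
    have "s *\<^sub>R A \<in> V 1" "(- s) *\<^sub>R A0 \<in> V 1"
      by (rule subspace_scale[OF subspace_V A(1)] subspace_scale[OF subspace_V A0])+
    then have "\<bar>\<tau>\<bar> *\<^sub>R (s *\<^sub>R A) \<odot> \<bar>\<tau>\<bar> *\<^sub>R ((- s) *\<^sub>R A0) = dilate \<bar>\<tau>\<bar> (s *\<^sub>R A \<odot> (- s) *\<^sub>R A0)"
      by (simp only: dil_bch dil_V1)
    then have "\<tau> *\<^sub>R A \<odot> (- \<tau>) *\<^sub>R A0 = dilate \<bar>\<tau>\<bar> (s *\<^sub>R A \<odot> (- s) *\<^sub>R A0)"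
      using \<tau>_eq by simp
    then have "norm (\<tau> *\<^sub>R A \<odot> (- \<tau>) *\<^sub>R A0) \<le> C * \<bar>\<tau>\<bar> * norm (s *\<^sub>R A \<odot> (- s) *\<^sub>R A0)"
      using C(2)[of "\<bar>\<tau>\<bar>"] \<tau> by simp
    also have "\<dots> \<le> C * \<bar>\<tau>\<bar> * ((D 1 + D (- 1)) * norm (A - A0))"
    proof (intro mult_left_mono)
      have "norm (s *\<^sub>R A \<odot> (- s) *\<^sub>R A0) \<le> D s * norm (A - A0)" by (rule D(2)[OF A(2)])
      also have "\<dots> \<le> (D 1 + D (- 1)) * norm (A - A0)"
        using D(1)[of 1] D(1)[of "-1"] by (intro mult_right_mono) (auto simp: s_def)
      finally show "norm (s *\<^sub>R A \<odot> (- s) *\<^sub>R A0) \<le> (D 1 + D (- 1)) * norm (A - A0)" .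
    qed (use C in auto)
    finally show ?thesis by (simp add: K_def mult.assoc mult.left_commute mult.commute)
  qed
  moreover have "0 \<le> K" using C(1) D(1) by (simp add: K_def)
  ultimately show ?thesis by blast
qed

text \<open>The curve \<open>\<sigma> s = \<gamma> s \<odot> - s A0\<close> moves slowly in the Euclidean norm, as its increments are
  Euclidean-bounded conjugates of \<open>\<tau> A \<odot> - \<tau> A0\<close> up to a higher order error.\<close>
lemma horizontal_curve_unit:
  assumes A0: "A0 \<in> V 1" and \<eta>: "0 < \<eta>"
  shows "\<exists>\<epsilon>>0. \<forall>\<gamma> A. \<gamma> 0 = 0 \<longrightarrow> (\<forall>s\<in>{0..1}. A s \<in> V 1 \<and> norm (A s - A0) \<le> \<epsilon>) \<longrightarrow>
    (\<forall>s\<in>{0..1}. \<forall>e>0. \<exists>\<delta>>0. \<forall>s'\<in>{0..1}. \<bar>s' - s\<bar> < \<delta> \<longrightarrow>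
        d (- \<gamma> s \<odot> \<gamma> s') ((s' - s) *\<^sub>R A s) \<le> e * \<bar>s' - s\<bar>) \<longrightarrow>
    d (\<gamma> 1) A0 \<le> \<eta>"
proof -
  obtain K where K: "0 \<le> K" "\<And>\<tau> A. A \<in> V 1 \<Longrightarrow> norm (A - A0) \<le> 1 \<Longrightarrow> \<bar>\<tau>\<bar> \<le> 1 \<Longrightarrow>
    norm (\<tau> *\<^sub>R A \<odot> (- \<tau>) *\<^sub>R A0) \<le> K * norm (A - A0) * \<bar>\<tau>\<bar>"
    using bch_V1_parallel_small[OF A0] by blast
  obtain C4 where C4: "0 < C4" "\<And>x. hnorm x \<le> 1 \<Longrightarrow> norm x \<le> C4 * hnorm x"
    using norm_le_hnorm by blast
  have "continuous_on (cball A0 1) hnorm" by (intro continuous_intros)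
  then have "compact (hnorm ` cball A0 1)"
    by (intro compact_continuous_image compact_cball)
  then obtain M where "\<And>y. y \<in> hnorm ` cball A0 1 \<Longrightarrow> norm y \<le> M"
    using compact_imp_bounded bounded_iff by metis
  then have M: "hnorm A \<le> M" if "norm (A - A0) \<le> 1" for A
    using that by (force simp: dist_norm norm_minus_commute)
  obtain R where R: "\<And>x. hnorm x \<le> M \<Longrightarrow> norm x \<le> R"
    using norm_bounded_of_hnorm by blast
  have "0 \<le> M" using order.trans[OF hnorm_nonneg M[of A0]] by simp
  then have "0 \<le> R" using R[of 0] by simp
  \<comment> \<open>Room for both kinds of triples used below: \<gamma> s has norm at most R,
    horizontal factors at most \<open>norm A0 + 1\<close>, and the inserted factor at most
    1.\<close>
  define r where "r = R + 2 * norm A0 + 2"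
  have "lip_bounded (\<lambda>p. fst p \<odot> (fst (snd p) \<odot> snd (snd p)))"
    by (intro lip_bounded_bch lip_bounded_linear bounded_linear_fst bounded_linear_snd
        bounded_linear_compose[OF bounded_linear_fst, unfolded o_def]
        bounded_linear_compose[OF bounded_linear_snd, unfolded o_def])
  then obtain c where c: "0 \<le> c" "\<And>p q. norm p \<le> r \<Longrightarrow> norm q \<le> r \<Longrightarrow>
    norm ((fst p \<odot> (fst (snd p) \<odot> snd (snd p))) - (fst q \<odot> (fst (snd q) \<odot> snd (snd q)))) \<le> c * norm (p - q)"
    using lip_boundedE by blast
  have insert_bound: "norm ((a \<odot> (u \<odot> b)) - (a \<odot> b)) \<le> c * norm u"
    if "norm a + norm u + norm b \<le> r" for a u b
  proof -
    have "norm (a, u, b) \<le> r" "norm (a, 0 :: 'v, b) \<le> r"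
      using that norm_Pair_le[of a "(u, b)"] norm_Pair_le[of u b] norm_Pair_le[of a "(0 :: 'v, b)"]
        norm_Pair_le[of "0 :: 'v" b] norm_ge_zero[of u] by (simp_all del: norm_ge_zero)
    from c(2)[OF this] show ?thesis by (simp add: norm_Pair)
  qed
  have "isCont (\<lambda>w. d (w \<odot> A0) A0) 0"
    by (rule continuous_on_interior[of UNIV]) (auto intro!: continuous_intros)
  then obtain \<theta> where \<theta>: "0 < \<theta>" "\<And>w. norm w < \<theta> \<Longrightarrow> d (w \<odot> A0) A0 < \<eta>"
    using \<eta> unfolding continuous_at_eps_delta by (auto simp: dist_real_def)
  \<comment> \<open>The three bounds serve in turn the condition
    \<open>norm (A s - A0) \<le> 1\<close>, one half of the bound \<open>norm u \<le> 1\<close>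
    below, and the final displacement \<open>c * (K * \<epsilon>) < \<theta>\<close>.\<close>
  define \<epsilon> where "\<epsilon> = min 1 (min (1 / (2 * (K + 1))) (\<theta> / (2 * (c * K + 1))))"
  have \<epsilon>: "0 < \<epsilon>" "\<epsilon> \<le> 1" "K * \<epsilon> \<le> 1 / 2" "c * (K * \<epsilon>) < \<theta>"
  proof -
    show "0 < \<epsilon>" "\<epsilon> \<le> 1" using K(1) c(1) \<theta>(1) by (auto simp: \<epsilon>_def intro!: divide_pos_pos add_nonneg_pos)
    have "(K + 1) * \<epsilon> \<le> (K + 1) * (1 / (2 * (K + 1)))"
      using K(1) by (intro mult_left_mono) (auto simp: \<epsilon>_def)
    also have "\<dots> = 1 / 2" using K(1) by (simp add: divide_simps)
    finally show "K * \<epsilon> \<le> 1 / 2" using \<open>0 < \<epsilon>\<close> by (simp add: distrib_right)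
    have "0 < c * K + 1" using K(1) c(1) by (simp add: add_nonneg_pos)
    then have "(c * K + 1) * \<epsilon> \<le> (c * K + 1) * (\<theta> / (2 * (c * K + 1)))"
      by (intro mult_left_mono) (auto simp: \<epsilon>_def)
    also have "\<dots> = \<theta> / 2" using \<open>0 < c * K + 1\<close> by (simp add: divide_simps)
    finally show "c * (K * \<epsilon>) < \<theta>"
      using \<open>0 < c * K + 1\<close> \<open>0 < \<epsilon>\<close> \<theta>(1) by (simp add: distrib_right mult.assoc)
  qed
  show ?thesis
  proof (intro exI[of _ \<epsilon>] conjI allI impI)
    show "0 < \<epsilon>" by (rule \<epsilon>)
    fix \<gamma> :: "real \<Rightarrow> 'v" and A :: "real \<Rightarrow> 'v"
    assume \<gamma>0: "\<gamma> 0 = 0" and A': "\<forall>s\<in>{0..1}. A s \<in> V 1 \<and> norm (A s - A0) \<le> \<epsilon>"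
      and curve: "\<forall>s\<in>{0..1}. \<forall>e>0. \<exists>\<delta>>0. \<forall>s'\<in>{0..1}. \<bar>s' - s\<bar> < \<delta> \<longrightarrow>
        d (- \<gamma> s \<odot> \<gamma> s') ((s' - s) *\<^sub>R A s) \<le> e * \<bar>s' - s\<bar>"
    note A = A'[rule_format]
    \<comment> \<open>Bounded speed keeps the whole curve in one ball, so a single Lipschitz
      constant of the group law applies along it.\<close>
    have "d (\<gamma> 0) (\<gamma> s) \<le> M * (s - 0)" if "s \<in> {0..1}" for s
    proof (rule pointwise_lipschitz_imp_lipschitz[OF d_sym d_tri, where T = 1])
      fix s e :: real assume s: "s \<in> {0..1}" and e: "0 < e"
      obtain \<delta> where \<delta>: "0 < \<delta>" "\<And>s'. s' \<in> {0..1} \<Longrightarrow> \<bar>s' - s\<bar> < \<delta> \<Longrightarrow>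
          d (- \<gamma> s \<odot> \<gamma> s') ((s' - s) *\<^sub>R A s) \<le> e * \<bar>s' - s\<bar>"
        using curve[THEN bspec, OF s, THEN spec, THEN mp, OF e] by blast
      have "d (\<gamma> s) (\<gamma> s') \<le> (M + e) * \<bar>s' - s\<bar>" if "s' \<in> {0..1}" "\<bar>s' - s\<bar> < \<delta>" for s'
      proof -
        have "d (\<gamma> s) (\<gamma> s') = d (- \<gamma> s \<odot> \<gamma> s') 0"
          unfolding d_eq_hnorm[of "\<gamma> s"] by (simp only: hnorm_def)
        also have "\<dots> \<le> d (- \<gamma> s \<odot> \<gamma> s') ((s' - s) *\<^sub>R A s) + d ((s' - s) *\<^sub>R A s) 0" by (rule d_tri)
        also have "d ((s' - s) *\<^sub>R A s) 0 = \<bar>s' - s\<bar> * hnorm (A s)"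
          using hnorm_scale_V1 A[OF s] unfolding hnorm_def by blast
        also have "\<dots> \<le> \<bar>s' - s\<bar> * M"
          using A[OF s] \<epsilon>(2) by (intro mult_left_mono M) auto
        finally show ?thesis using \<delta>(2)[OF that] by (simp add: algebra_simps)
      qed
      then show "\<exists>\<delta>>0. \<forall>s'\<in>{0..1}. \<bar>s' - s\<bar> < \<delta> \<longrightarrow> d (\<gamma> s) (\<gamma> s') \<le> (M + e) * \<bar>s' - s\<bar>"
        using \<delta>(1) by blast
    qed (use that in auto)
    then have "hnorm (\<gamma> s) \<le> M * s" if "s \<in> {0..1}" for s
      using that unfolding hnorm_def d_sym[of _ 0] \<gamma>0 by simp
    then have "hnorm (\<gamma> s) \<le> M" if "s \<in> {0..1}" for s
      using that mult_left_mono[of s 1 M] \<open>0 \<le> M\<close> by fastforce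
    then have \<gamma>_R: "norm (\<gamma> s) \<le> R" if "s \<in> {0..1}" for s using R that by blast
    define \<sigma> where "\<sigma> s = \<gamma> s \<odot> (- s) *\<^sub>R A0" for s
    have "dist (\<sigma> 0) (\<sigma> 1) \<le> c * (K * \<epsilon>) * (1 - 0)"
    proof (rule pointwise_lipschitz_imp_lipschitz[OF dist_commute dist_triangle, where T = 1])
      fix s e :: real assume s: "s \<in> {0..1}" and e: "0 < e"
      \<comment> \<open>The first term secures \<open>norm u \<le> 1\<close>. The second keeps the
        error below e after two uses of the Lipschitz bound, each costing a factor c; C4 converts
        \<open>hnorm\<close> into the Euclidean norm.\<close>
      define e' where "e' = min (1 / (2 * (c + 1) * (C4 + 1))) (e / ((c + 1)\<^sup>2 * (C4 + 1)))"
      have e': "0 < e'" "e' \<le> 1" "c * (C4 * e') \<le> 1 / 2" "c * (c * (C4 * e')) \<le> e" "C4 * e' \<le> 1 / 2"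
      proof -
        show "0 < e'" using c(1) C4(1) e by (auto simp: e'_def intro!: divide_pos_pos mult_pos_pos)
        have nz: "c + 1 \<noteq> 0" "C4 + 1 \<noteq> 0" using c(1) C4(1) by auto
        have *: "(c + 1) * (C4 + 1) * e' \<le> 1 / 2"
        proof -
          have "(c + 1) * (C4 + 1) * e' \<le> (c + 1) * (C4 + 1) * (1 / (2 * (c + 1) * (C4 + 1)))"
            using c(1) C4(1) by (intro mult_left_mono) (auto simp: e'_def)
          also have "\<dots> = 1 / 2" using nz by simp
          finally show ?thesis .
        qed
        have "1 * 1 * e' \<le> (c + 1) * (C4 + 1) * e'" "c * C4 * e' \<le> (c + 1) * (C4 + 1) * e'"
          "1 * C4 * e' \<le> (c + 1) * (C4 + 1) * e'"
          using c(1) C4(1) \<open>0 < e'\<close> by (intro mult_right_mono mult_mono; simp)+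
        with * show "e' \<le> 1" "c * (C4 * e') \<le> 1 / 2" "C4 * e' \<le> 1 / 2" by (simp_all add: mult.assoc)
        have "c * (c * (C4 * e')) = c\<^sup>2 * C4 * e'" by (simp add: power2_eq_square)
        also have "\<dots> \<le> (c + 1)\<^sup>2 * (C4 + 1) * e'"
          using c(1) C4(1) \<open>0 < e'\<close> by (intro mult_right_mono mult_mono power_mono) auto
        also have "\<dots> \<le> (c + 1)\<^sup>2 * (C4 + 1) * (e / ((c + 1)\<^sup>2 * (C4 + 1)))"
          using c(1) C4(1) by (intro mult_left_mono) (auto simp: e'_def)
        also have "\<dots> = e" using nz by simp
        finally show "c * (c * (C4 * e')) \<le> e" .
      qed
      obtain \<delta> where \<delta>: "0 < \<delta>" "\<And>s'. s' \<in> {0..1} \<Longrightarrow> \<bar>s' - s\<bar> < \<delta> \<Longrightarrow>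
          d (- \<gamma> s \<odot> \<gamma> s') ((s' - s) *\<^sub>R A s) \<le> e' * \<bar>s' - s\<bar>"
        using curve[THEN bspec, OF s, THEN spec, THEN mp, OF e'(1)] by blast
      have "dist (\<sigma> s) (\<sigma> s') \<le> (c * (K * \<epsilon>) + e) * \<bar>s' - s\<bar>" if s': "s' \<in> {0..1}" "\<bar>s' - s\<bar> < \<delta>" for s'
      proof -
        define \<tau> where "\<tau> = s' - s"
        have \<tau>: "\<bar>\<tau>\<bar> \<le> 1" using s s' by (auto simp: \<tau>_def)
        \<comment> \<open>w is the differentiation error and u the resulting increment:
          \<open>\<sigma> s'\<close> arises from \<open>\<sigma> s\<close> by inserting u between
          its two factors.\<close>
        define w where "w = - (\<tau> *\<^sub>R A s) \<odot> (- \<gamma> s \<odot> \<gamma> s')"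
        define u where "u = \<tau> *\<^sub>R A s \<odot> (w \<odot> (- \<tau>) *\<^sub>R A0)"
        have hw: "hnorm w \<le> e' * \<bar>\<tau>\<bar>"
          using \<delta>(2)[OF s'] unfolding w_def \<tau>_def d_eq_hnorm[symmetric] by (simp only: d_sym)
        also have "\<dots> \<le> 1 * 1" using e' \<tau> by (intro mult_mono) auto
        finally have "norm w \<le> C4 * hnorm w" by (intro C4(2)) simp
        also have "\<dots> \<le> C4 * (e' * \<bar>\<tau>\<bar>)" using hw C4(1) by (intro mult_left_mono) auto
        finally have w: "norm w \<le> C4 * e' * \<bar>\<tau>\<bar>" by (simp add: mult.assoc)
        also have "\<dots> \<le> C4 * e' * 1" using e' C4(1) \<tau> by (intro mult_left_mono) auto
        finally have "norm w \<le> 1" using e' by simp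
        have "norm (A s) \<le> norm A0 + 1"
          using A[OF s] \<epsilon>(2) norm_triangle_ineq2[of "A s" A0] by simp
        moreover have "norm (\<tau> *\<^sub>R A s) \<le> norm (A s)" "norm ((- \<tau>) *\<^sub>R A0) \<le> norm A0"
          using \<tau> mult_right_mono[of "\<bar>\<tau>\<bar>" 1 "norm (A s)"] mult_right_mono[of "\<bar>\<tau>\<bar>" 1 "norm A0"] by auto
        ultimately have "norm (\<tau> *\<^sub>R A s) + norm w + norm ((- \<tau>) *\<^sub>R A0) \<le> r"
          using \<open>norm w \<le> 1\<close> \<open>0 \<le> R\<close> by (simp add: r_def)
        from insert_bound[OF this]
        have "norm (u - (\<tau> *\<^sub>R A s \<odot> (- \<tau>) *\<^sub>R A0)) \<le> c * norm w" by (simp add: u_def)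
        also have "\<dots> \<le> c * (C4 * e' * \<bar>\<tau>\<bar>)" using c(1) w by (intro mult_left_mono)
        finally have "norm u \<le> norm (\<tau> *\<^sub>R A s \<odot> (- \<tau>) *\<^sub>R A0) + c * (C4 * e' * \<bar>\<tau>\<bar>)"
          using norm_triangle_ineq2[of u "\<tau> *\<^sub>R A s \<odot> (- \<tau>) *\<^sub>R A0"] by linarith
        also have "norm (\<tau> *\<^sub>R A s \<odot> (- \<tau>) *\<^sub>R A0) \<le> K * norm (A s - A0) * \<bar>\<tau>\<bar>"
          using A[OF s] \<epsilon>(2) \<tau> by (intro K) auto
        also have "\<dots> \<le> K * \<epsilon> * \<bar>\<tau>\<bar>"
          using A[OF s] K(1) by (intro mult_right_mono mult_left_mono) auto
        finally have u: "norm u \<le> (K * \<epsilon> + c * (C4 * e')) * \<bar>\<tau>\<bar>" by (simp add: algebra_simps)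
        also have "\<dots> \<le> 1 * 1"
          using \<epsilon> e' \<tau> K(1) c(1) C4(1) by (intro mult_mono) auto
        finally have "norm u \<le> 1" by simp
        moreover have "norm ((- s) *\<^sub>R A0) \<le> norm A0"
          using s mult_right_mono[of "\<bar>s\<bar>" 1 "norm A0"] by auto
        ultimately have "norm (\<gamma> s) + norm u + norm ((- s) *\<^sub>R A0) \<le> r"
          using \<gamma>_R[OF s] norm_ge_zero[of A0] unfolding r_def by linarith
        from insert_bound[OF this]
        have "norm ((\<gamma> s \<odot> (u \<odot> (- s) *\<^sub>R A0)) - \<sigma> s) \<le> c * norm u" by (simp add: \<sigma>_def)
        moreover have "\<gamma> s \<odot> (u \<odot> (- s) *\<^sub>R A0) = \<sigma> s'"
        proof -
          have "(- \<tau>) *\<^sub>R A0 \<odot> (- s) *\<^sub>R A0 = (- s') *\<^sub>R A0"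
            unfolding bch_parallel by (simp add: \<tau>_def)
          then show ?thesis
            by (simp add: u_def w_def \<sigma>_def bch_assoc)
        qed
        moreover have "c * norm u \<le> c * ((K * \<epsilon> + c * (C4 * e')) * \<bar>\<tau>\<bar>)"
          using u c(1) by (rule mult_left_mono)
        moreover have "\<dots> \<le> (c * (K * \<epsilon>) + e) * \<bar>\<tau>\<bar>"
          using e'(4) mult_right_mono[of "c * (c * (C4 * e'))" e "\<bar>\<tau>\<bar>"] by (simp add: algebra_simps)
        ultimately show ?thesis
          by (simp add: dist_norm norm_minus_commute[of "\<sigma> s"] \<tau>_def)
      qed
      with \<delta>(1) show "\<exists>\<delta>>0. \<forall>s'\<in>{0..1}. \<bar>s' - s\<bar> < \<delta> \<longrightarrow> dist (\<sigma> s) (\<sigma> s') \<le> (c * (K * \<epsilon>) + e) * \<bar>s' - s\<bar>"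
        by blast
    qed auto
    then have "norm (\<sigma> 1) < \<theta>" using \<epsilon>(4) by (simp add: \<sigma>_def \<gamma>0 dist_norm)
    from \<theta>(2)[OF this] show "d (\<gamma> 1) A0 \<le> \<eta>"
      by (simp add: \<sigma>_def bch_assoc)
  qed
qed

text \<open>Translating the start to the identity, rescaling time by T and dilating by 1 / T reduce
  to the unit interval; this makes \<epsilon> independent of T.\<close>

lemma horizontal_curve_estimate:
  assumes A0: "A0 \<in> V 1" and \<eta>: "0 < \<eta>"
  shows "\<exists>\<epsilon>>0. \<forall>T>0. \<forall>\<gamma> A. (\<forall>s\<in>{0..T}. A s \<in> V 1 \<and> norm (A s - A0) \<le> \<epsilon>) \<longrightarrow>
    (\<forall>s\<in>{0..T}. \<forall>e>0. \<exists>\<delta>>0. \<forall>s'\<in>{0..T}. \<bar>s' - s\<bar> < \<delta> \<longrightarrow>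
        d (- \<gamma> s \<odot> \<gamma> s') ((s' - s) *\<^sub>R A s) \<le> e * \<bar>s' - s\<bar>) \<longrightarrow>
    d (- \<gamma> 0 \<odot> \<gamma> T) (T *\<^sub>R A0) \<le> \<eta> * T"
proof -
  from horizontal_curve_unit[OF assms] obtain \<epsilon> where \<epsilon>: "0 < \<epsilon>" and
    unit: "\<forall>\<gamma> A. \<gamma> 0 = 0 \<longrightarrow> (\<forall>s\<in>{0..1}. A s \<in> V 1 \<and> norm (A s - A0) \<le> \<epsilon>) \<longrightarrow>
    (\<forall>s\<in>{0..1}. \<forall>e>0. \<exists>\<delta>>0. \<forall>s'\<in>{0..1}. \<bar>s' - s\<bar> < \<delta> \<longrightarrow>
        d (- \<gamma> s \<odot> \<gamma> s') ((s' - s) *\<^sub>R A s) \<le> e * \<bar>s' - s\<bar>) \<longrightarrow>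
    d (\<gamma> 1) A0 \<le> \<eta>"
    by (elim exE conjE)
  show ?thesis
  proof (intro exI[of _ \<epsilon>] conjI allI impI)
    show "0 < \<epsilon>" by (rule \<epsilon>)
    fix T :: real and \<gamma> :: "real \<Rightarrow> 'v" and A :: "real \<Rightarrow> 'v"
    assume T: "0 < T" and A: "\<forall>s\<in>{0..T}. A s \<in> V 1 \<and> norm (A s - A0) \<le> \<epsilon>"
      and curve: "\<forall>s\<in>{0..T}. \<forall>e>0. \<exists>\<delta>>0. \<forall>s'\<in>{0..T}. \<bar>s' - s\<bar> < \<delta> \<longrightarrow>
        d (- \<gamma> s \<odot> \<gamma> s') ((s' - s) *\<^sub>R A s) \<le> e * \<bar>s' - s\<bar>"
    define \<beta> where "\<beta> s = dilate (1 / T) (- \<gamma> 0 \<odot> \<gamma> (T * s))" for s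
    have "d (\<beta> 1) A0 \<le> \<eta>"
    proof (rule unit[THEN spec, THEN spec, THEN mp, THEN mp, THEN mp])
      show "\<beta> 0 = 0" by (simp add: \<beta>_def)
      show "\<forall>s\<in>{0..1}. A (T * s) \<in> V 1 \<and> norm (A (T * s) - A0) \<le> \<epsilon>"
        using A T by (auto simp: mult_le_cancel_left1)
      show "\<forall>s\<in>{0..1}. \<forall>e>0. \<exists>\<delta>>0. \<forall>s'\<in>{0..1}. \<bar>s' - s\<bar> < \<delta> \<longrightarrow>
        d (- \<beta> s \<odot> \<beta> s') ((s' - s) *\<^sub>R A (T * s)) \<le> e * \<bar>s' - s\<bar>"
      proof (intro ballI allI impI)
        fix s e :: real assume s: "s \<in> {0..1}" and e: "0 < e"
        have Ts: "T * s \<in> {0..T}" if "s \<in> {0..1}" for s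
          using that T by (auto simp: mult_le_cancel_left1)
        obtain \<delta> where \<delta>: "0 < \<delta>" "\<And>s'. s' \<in> {0..T} \<Longrightarrow> \<bar>s' - T * s\<bar> < \<delta> \<Longrightarrow>
          d (- \<gamma> (T * s) \<odot> \<gamma> s') ((s' - T * s) *\<^sub>R A (T * s)) \<le> e * \<bar>s' - T * s\<bar>"
          using curve Ts[OF s] e by meson
        have "d (- \<beta> s \<odot> \<beta> s') ((s' - s) *\<^sub>R A (T * s)) \<le> e * \<bar>s' - s\<bar>"
          if s': "s' \<in> {0..1}" "\<bar>s' - s\<bar> < \<delta> / T" for s'
        proof -
          have \<tau>: "T * s' - T * s = T * (s' - s)" by (simp add: right_diff_distrib)
          have "\<bar>T * s' - T * s\<bar> < \<delta>"
            using s'(2) T unfolding \<tau> by (simp add: abs_mult pos_less_divide_eq mult.commute)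
          then have le: "d (- \<gamma> (T * s) \<odot> \<gamma> (T * s')) ((T * (s' - s)) *\<^sub>R A (T * s)) \<le> e * (T * \<bar>s' - s\<bar>)"
            using \<delta>(2)[OF Ts[OF s'(1)]] T unfolding \<tau> by (simp add: abs_mult)
          have "A (T * s) \<in> V 1" using A Ts[OF s] by blast
          then have "(T * (s' - s)) *\<^sub>R A (T * s) \<in> V 1" by (rule subspace_scale[OF subspace_V])
          then have "(s' - s) *\<^sub>R A (T * s) = dilate (1 / T) ((T * (s' - s)) *\<^sub>R A (T * s))"
            using T by (simp add: dil_V1)
          moreover have "- \<beta> s \<odot> \<beta> s' = dilate (1 / T) (- \<gamma> (T * s) \<odot> \<gamma> (T * s'))"
            by (simp add: \<beta>_def dil_bch[symmetric] dil_uminus[symmetric] minus_bch bch_assoc)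
          ultimately show ?thesis
            using le T by (simp add: d_dil pos_divide_le_eq mult.commute mult.left_commute)
        qed
        moreover have "0 < \<delta> / T" using \<delta> T by simp
        ultimately show "\<exists>\<delta>>0. \<forall>s'\<in>{0..1}. \<bar>s' - s\<bar> < \<delta> \<longrightarrow>
            d (- \<beta> s \<odot> \<beta> s') ((s' - s) *\<^sub>R A (T * s)) \<le> e * \<bar>s' - s\<bar>" by blast
      qed
    qed
    moreover have "d (\<beta> 1) A0 = (1 / T) * d (- \<gamma> 0 \<odot> \<gamma> T) (T *\<^sub>R A0)"
    proof -
      have "T *\<^sub>R A0 \<in> V 1" using A0 by (rule subspace_scale[OF subspace_V])
      then have "A0 = dilate (1 / T) (T *\<^sub>R A0)" using T by (simp add: dil_V1)
      then show ?thesis using T d_dil[of "1 / T" "- \<gamma> 0 \<odot> \<gamma> T" "T *\<^sub>R A0"] by (simp add: \<beta>_def)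
    qed
    ultimately show "d (- \<gamma> 0 \<odot> \<gamma> T) (T *\<^sub>R A0) \<le> \<eta> * T"
      using T by (simp add: pos_divide_le_eq)
  qed
qed

end

subsection \<open>Generation by the first layer\<close>

context graded_algebra
begin

fun gprod :: "(real \<times> 'v) list \<Rightarrow> 'v" where
  "gprod [] = 0"
| "gprod (p # l) = fst p *\<^sub>R snd p \<odot> gprod l"

lemma gprod_append: "gprod (l @ l') = gprod l \<odot> gprod l'"
  by (induction l) (simp_all add: bch_assoc)

lemma gprod_dil:
  "snd ` set l \<subseteq> V 1 \<Longrightarrow> gprod (map (\<lambda>p. (r * fst p, snd p)) l) = dilate r (gprod l)"
proof (induction l)
  case (Cons p l)
  then have "fst p *\<^sub>R snd p \<in> V 1" by (auto intro: subspace_scale[OF subspace_V])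
  with Cons show ?case by (simp add: dil_bch dil_V1 del: One_nat_def)
qed simp

text \<open>The number of factors and their coefficients are bounded uniformly over S. Coefficients
  are nonnegative, hence the symmetry of B in the lemmas on inverses and commutators.\<close>

definition boundedly_generated :: "'v set \<Rightarrow> 'v set \<Rightarrow> bool" where
  "boundedly_generated B S \<longleftrightarrow> (\<exists>n C. \<forall>x\<in>S. \<exists>l. length l \<le> n \<and> set l \<subseteq> {0..C} \<times> B \<and> gprod l = x)"

lemma boundedly_generated_subset:
  "boundedly_generated B S \<Longrightarrow> S' \<subseteq> S \<Longrightarrow> boundedly_generated B S'"
  unfolding boundedly_generated_def by (meson subsetD)

lemma boundedly_generated_zero: "boundedly_generated B {0}"
  unfolding boundedly_generated_def by (intro exI[of _ 0] ballI exI[of _ "[]"]) auto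

lemma boundedly_generated_mult:
  assumes "boundedly_generated B S" "boundedly_generated B S'"
  shows "boundedly_generated B {x \<odot> y | x y. x \<in> S \<and> y \<in> S'}"
proof -
  obtain n C where n: "\<And>x. x \<in> S \<Longrightarrow> \<exists>l. length l \<le> n \<and> set l \<subseteq> {0..C} \<times> B \<and> gprod l = x"
    using assms(1) unfolding boundedly_generated_def by blast
  obtain n' C' where n': "\<And>x. x \<in> S' \<Longrightarrow> \<exists>l. length l \<le> n' \<and> set l \<subseteq> {0..C'} \<times> B \<and> gprod l = x"
    using assms(2) unfolding boundedly_generated_def by blast
  show ?thesis
    unfolding boundedly_generated_def
  proof (intro exI[of _ "n + n'"] exI[of _ "max C C'"] ballI)
    fix z assume "z \<in> {x \<odot> y | x y. x \<in> S \<and> y \<in> S'}"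
    then obtain x y where z: "z = x \<odot> y" and x: "x \<in> S" and y: "y \<in> S'" by blast
    obtain l where l: "length l \<le> n" "set l \<subseteq> {0..C} \<times> B" "gprod l = x" using n[OF x] by blast
    obtain l' where l': "length l' \<le> n'" "set l' \<subseteq> {0..C'} \<times> B" "gprod l' = y" using n'[OF y] by blast
    have "set (l @ l') \<subseteq> {0..max C C'} \<times> B" using l(2) l'(2) by fastforce
    then show "\<exists>l. length l \<le> n + n' \<and> set l \<subseteq> {0..max C C'} \<times> B \<and> gprod l = z"
      using l l' z by (intro exI[of _ "l @ l'"]) (simp add: gprod_append)
  qed
qed

lemma gprod_inverse: "gprod (rev (map (\<lambda>p. (fst p, - snd p)) l)) = - gprod l"
  by (induction l) (simp_all add: gprod_append minus_bch)

lemma boundedly_generated_uminus: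
  assumes S: "boundedly_generated B S" and B: "\<And>X. X \<in> B \<Longrightarrow> - X \<in> B"
  shows "boundedly_generated B (uminus ` S)"
proof -
  obtain n C where n: "\<And>x. x \<in> S \<Longrightarrow> \<exists>l. length l \<le> n \<and> set l \<subseteq> {0..C} \<times> B \<and> gprod l = x"
    using S unfolding boundedly_generated_def by blast
  show ?thesis
    unfolding boundedly_generated_def
  proof (intro exI[of _ n] exI[of _ C] ballI)
    fix z assume "z \<in> uminus ` S"
    then obtain x where z: "z = - x" and x: "x \<in> S" by blast
    obtain l where l: "length l \<le> n" "set l \<subseteq> {0..C} \<times> B" "gprod l = x" using n[OF x] by blast
    have "set (rev (map (\<lambda>p. (fst p, - snd p)) l)) \<subseteq> {0..C} \<times> B" using l(2) B by fastforce
    then show "\<exists>l. length l \<le> n \<and> set l \<subseteq> {0..C} \<times> B \<and> gprod l = z"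
      using l z by (intro exI[of _ "rev (map (\<lambda>p. (fst p, - snd p)) l)"]) (simp add: gprod_inverse)
  qed
qed

lemma boundedly_generated_line:
  assumes "X \<in> B" "- X \<in> B" shows "boundedly_generated B ((\<lambda>t. t *\<^sub>R X) ` {-C..C})"
  unfolding boundedly_generated_def
proof (intro exI[of _ "1::nat"] exI[of _ C] ballI)
  fix z assume "z \<in> (\<lambda>t. t *\<^sub>R X) ` {-C..C}"
  then obtain t where t: "z = t *\<^sub>R X" "t \<in> {-C..C}" by blast
  show "\<exists>l. length l \<le> 1 \<and> set l \<subseteq> {0..C} \<times> B \<and> gprod l = z"
    using t assms by (intro exI[of _ "[(\<bar>t\<bar>, if 0 \<le> t then X else - X)]"]) auto
qed

text \<open>Multiples of \<open>b\<close> are the leading terms at level \<open>j\<close> of boundedly generated elements; iterated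
  group commutators show that this covers all of \<open>V j\<close>.\<close>
definition reachable :: "'v set \<Rightarrow> nat \<Rightarrow> 'v \<Rightarrow> bool" where
  "reachable B j b \<longleftrightarrow> (\<forall>C. \<exists>S. boundedly_generated B S \<and> S \<subseteq> F j \<and>
     (\<forall>c. \<bar>c\<bar> \<le> C \<longrightarrow> (\<exists>p\<in>S. p - c *\<^sub>R b \<in> F (Suc j))))"

lemma bch_add_F_Suc:
  assumes "p \<in> F j" "q \<in> F j" "p - x \<in> F (Suc j)" "q - y \<in> F (Suc j)" "1 \<le> j"
  shows "p \<odot> q - (x + y) \<in> F (Suc j)"
proof -
  have "p \<odot> q - (p + q) \<in> F (Suc j)"
    using bch_F[OF assms(1,2)] F_antimono[of "Suc j" "j + j"] assms(5) by auto
  then have "(p \<odot> q - (p + q)) + ((p - x) + (q - y)) \<in> F (Suc j)"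
    using assms(3,4) by (intro subspace_add[OF subspace_F])
  then show ?thesis by (simp add: algebra_simps)
qed

lemma reachable_add:
  assumes "reachable B j b" "reachable B j b'" "1 \<le> j" shows "reachable B j (b + b')"
  unfolding reachable_def
proof
  fix C
  obtain S where S: "boundedly_generated B S" "S \<subseteq> F j"
    "\<And>c. \<bar>c\<bar> \<le> C \<Longrightarrow> \<exists>p\<in>S. p - c *\<^sub>R b \<in> F (Suc j)"
    using assms(1) unfolding reachable_def by meson
  obtain S' where S': "boundedly_generated B S'" "S' \<subseteq> F j"
    "\<And>c. \<bar>c\<bar> \<le> C \<Longrightarrow> \<exists>p\<in>S'. p - c *\<^sub>R b' \<in> F (Suc j)"
    using assms(2) unfolding reachable_def by meson
  let ?S = "{x \<odot> y | x y. x \<in> S \<and> y \<in> S'}"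
  have "\<exists>p\<in>?S. p - c *\<^sub>R (b + b') \<in> F (Suc j)" if c: "\<bar>c\<bar> \<le> C" for c
  proof -
    obtain p where p: "p \<in> S" "p - c *\<^sub>R b \<in> F (Suc j)" using S(3)[OF c] by blast
    obtain p' where p': "p' \<in> S'" "p' - c *\<^sub>R b' \<in> F (Suc j)" using S'(3)[OF c] by blast
    have "p \<odot> p' - (c *\<^sub>R b + c *\<^sub>R b') \<in> F (Suc j)"
      using p p' S(2) S'(2) assms(3) by (intro bch_add_F_Suc) auto
    then show ?thesis using p(1) p'(1) by (auto simp: scaleR_right_distrib)
  qed
  moreover have "?S \<subseteq> F j" using S(2) S'(2) by (auto intro!: bch_closed_F)
  ultimately show "\<exists>S. boundedly_generated B S \<and> S \<subseteq> F j \<and>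
     (\<forall>c. \<bar>c\<bar> \<le> C \<longrightarrow> (\<exists>p\<in>S. p - c *\<^sub>R (b + b') \<in> F (Suc j)))"
    using boundedly_generated_mult[OF S(1) S'(1)] by blast
qed

lemma reachable_scale:
  assumes "reachable B j b" shows "reachable B j (r *\<^sub>R b)"
  unfolding reachable_def
proof
  fix C
  obtain S where S: "boundedly_generated B S" "S \<subseteq> F j"
    "\<And>c. \<bar>c\<bar> \<le> \<bar>C\<bar> * \<bar>r\<bar> \<Longrightarrow> \<exists>p\<in>S. p - c *\<^sub>R b \<in> F (Suc j)"
    using assms unfolding reachable_def by meson
  have "\<exists>p\<in>S. p - c *\<^sub>R r *\<^sub>R b \<in> F (Suc j)" if "\<bar>c\<bar> \<le> C" for c
    using S(3)[of "c * r"] that mult_right_mono[of "\<bar>c\<bar>" "\<bar>C\<bar>" "\<bar>r\<bar>"] by (simp add: abs_mult)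
  with S(1,2) show "\<exists>S. boundedly_generated B S \<and> S \<subseteq> F j \<and>
     (\<forall>c. \<bar>c\<bar> \<le> C \<longrightarrow> (\<exists>p\<in>S. p - c *\<^sub>R r *\<^sub>R b \<in> F (Suc j)))" by blast
qed

lemma reachable_zero: "reachable B j 0"
  unfolding reachable_def
  using boundedly_generated_zero[of B] by (auto intro!: exI[of _ "{0}"] simp: subspace_0[OF subspace_F])

lemma subspace_reachable: "1 \<le> j \<Longrightarrow> subspace {b. reachable B j b}"
  by (auto simp: subspace_def reachable_zero reachable_add reachable_scale)

lemma reachable_generator:
  assumes "X \<in> B" "- X \<in> B" shows "reachable B 1 X"
  unfolding reachable_def
proof
  fix C
  have "\<exists>p\<in>(\<lambda>t. t *\<^sub>R X) ` {-C..C}. p - c *\<^sub>R X \<in> F (Suc 1)" if "\<bar>c\<bar> \<le> C" for c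
    using that by (intro bexI[of _ "c *\<^sub>R X"] imageI) (auto simp: subspace_0[OF subspace_F])
  then show "\<exists>S. boundedly_generated B S \<and> S \<subseteq> F 1 \<and>
     (\<forall>c. \<bar>c\<bar> \<le> C \<longrightarrow> (\<exists>p\<in>S. p - c *\<^sub>R X \<in> F (Suc 1)))"
    using boundedly_generated_line[OF assms, of C] F_1 by blast
qed

text \<open>Group commutators with X raise the level by one and turn the leading term c b into c
  \<open>br X b\<close>, at the cost of boundedly many more factors.\<close>

lemma reachable_br:
  assumes X: "X \<in> B" and B: "\<And>X. X \<in> B \<Longrightarrow> - X \<in> B" and b: "reachable B j b" and j: "1 \<le> j"
  shows "reachable B (Suc j) (br X b)"
  unfolding reachable_def
proof
  fix C
  obtain S where S: "boundedly_generated B S" "S \<subseteq> F j"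
    "\<And>c. \<bar>c\<bar> \<le> C \<Longrightarrow> \<exists>p\<in>S. p - c *\<^sub>R b \<in> F (Suc j)"
    using b unfolding reachable_def by meson
  let ?S = "(\<lambda>p. X \<odot> p \<odot> (- X) \<odot> (- p)) ` S"
  \<comment> \<open>The two occurrences of p vary independently here, so this is a product of
    boundedly generated sets that contains all the commutators.\<close>
  let ?T = "{x \<odot> y | x y. x \<in> {x \<odot> y | x y. x \<in> {x \<odot> y | x y. x \<in> {X} \<and> y \<in> S} \<and> y \<in> {- X}} \<and> y \<in> uminus ` S}"
  have gen: "boundedly_generated B {Y}" if "Y \<in> B" for Y
  proof -
    have "{Y} \<subseteq> (\<lambda>t. t *\<^sub>R Y) ` {-1..1}" by (auto intro!: image_eqI[of _ _ 1])
    then show ?thesis by (rule boundedly_generated_subset[OF boundedly_generated_line[OF that B[OF that]]])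
  qed
  have "boundedly_generated B ?T"
    using X B by (intro boundedly_generated_mult boundedly_generated_uminus gen S)
  moreover have "?S \<subseteq> ?T" by blast
  ultimately have "boundedly_generated B ?S" by (rule boundedly_generated_subset)
  moreover have "?S \<subseteq> F (Suc j)"
    using group_commutator_F(1)[OF _ j] S(2) by blast
  moreover have "\<exists>p\<in>?S. p - c *\<^sub>R br X b \<in> F (Suc (Suc j))" if c: "\<bar>c\<bar> \<le> C" for c
  proof -
    obtain p where p: "p \<in> S" "p - c *\<^sub>R b \<in> F (Suc j)" using S(3)[OF c] by blast
    let ?q = "X \<odot> p \<odot> (- X) \<odot> (- p)"
    have "?q - br X p \<in> F (Suc (Suc j))"
      using group_commutator_F(2)[OF _ j] p(1) S(2) by blast
    moreover have "br X (p - c *\<^sub>R b) \<in> F (Suc (Suc j))"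
      using br_F[of X 1 "p - c *\<^sub>R b" "Suc j"] p(2) F_1 by simp
    ultimately have "(?q - br X p) + br X (p - c *\<^sub>R b) \<in> F (Suc (Suc j))"
      by (rule subspace_add[OF subspace_F])
    then have "?q - c *\<^sub>R br X b \<in> F (Suc (Suc j))"
      by (simp add: linear_diff[OF linear_br] linear_cmul[OF linear_br])
    then show ?thesis using p(1) by blast
  qed
  ultimately show "\<exists>S. boundedly_generated B S \<and> S \<subseteq> F (Suc j) \<and>
     (\<forall>c. \<bar>c\<bar> \<le> C \<longrightarrow> (\<exists>p\<in>S. p - c *\<^sub>R br X b \<in> F (Suc (Suc j))))" by blast
qed

text \<open>The approximants of the separate vectors are multiplied; leading terms at the same level
  add up.\<close>

lemma reachable_family:
  assumes E: "finite E" "\<And>b. b \<in> E \<Longrightarrow> reachable B j b" and j: "1 \<le> j"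
  shows "\<exists>S. boundedly_generated B S \<and> S \<subseteq> F j \<and>
     (\<forall>c. (\<forall>b\<in>E. \<bar>c b\<bar> \<le> R) \<longrightarrow> (\<exists>p\<in>S. p - (\<Sum>b\<in>E. c b *\<^sub>R b) \<in> F (Suc j)))"
  using E
proof (induction E rule: finite_induct)
  case empty
  then show ?case
    using boundedly_generated_zero[of B] by (auto intro!: exI[of _ "{0}"] simp: subspace_0[OF subspace_F])
next
  case (insert b E)
  obtain S where S: "boundedly_generated B S" "S \<subseteq> F j"
    "\<And>c. (\<forall>b\<in>E. \<bar>c b\<bar> \<le> R) \<Longrightarrow> \<exists>p\<in>S. p - (\<Sum>b\<in>E. c b *\<^sub>R b) \<in> F (Suc j)"
    using insert by blast
  obtain S' where S': "boundedly_generated B S'" "S' \<subseteq> F j"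
    "\<And>c. \<bar>c\<bar> \<le> R \<Longrightarrow> \<exists>p\<in>S'. p - c *\<^sub>R b \<in> F (Suc j)"
    using insert.prems[of b] unfolding reachable_def by blast
  let ?S = "{x \<odot> y | x y. x \<in> S' \<and> y \<in> S}"
  have "\<exists>p\<in>?S. p - (\<Sum>b\<in>insert b E. c b *\<^sub>R b) \<in> F (Suc j)" if c: "\<forall>b\<in>insert b E. \<bar>c b\<bar> \<le> R" for c
  proof -
    obtain p where p: "p \<in> S" "p - (\<Sum>b\<in>E. c b *\<^sub>R b) \<in> F (Suc j)" using S(3)[of c] c by blast
    obtain p' where p': "p' \<in> S'" "p' - c b *\<^sub>R b \<in> F (Suc j)" using S'(3)[of "c b"] c by blast
    have "p' \<odot> p - (c b *\<^sub>R b + (\<Sum>b\<in>E. c b *\<^sub>R b)) \<in> F (Suc j)"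
      using p p' S(2) S'(2) j by (intro bch_add_F_Suc) auto
    then show ?thesis using p(1) p'(1) insert.hyps by auto
  qed
  moreover have "?S \<subseteq> F j" using S(2) S'(2) by (auto intro!: bch_closed_F)
  ultimately show ?case
    using boundedly_generated_mult[OF S'(1) S(1)] by blast
qed

end

section \<open>Uniform generation of a stratified group by horizontal factors\<close>

locale stratified_group = homogeneous_group br V k d
  for br :: "'v::euclidean_space \<Rightarrow> 'v \<Rightarrow> 'v" and V :: "nat \<Rightarrow> 'v set" and k :: nat and d :: "'v \<Rightarrow> 'v \<Rightarrow> real" +
  assumes stratified: "stratified br V k"
begin

lemma span_br_V: "1 \<le> j \<Longrightarrow> span {br x y | x y. x \<in> V 1 \<and> y \<in> V j} = V (Suc j)"
  using stratified[unfolded stratified_def, THEN conjunct2, THEN spec, THEN spec, of 1 j] by simp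

text \<open>Reachable vectors form a subspace, and brackets of \<open>V 1\<close> with
  \<open>V j\<close> span \<open>V (Suc j)\<close>; linearity in the first argument reduces
  \<open>V 1\<close> to its spanning set B.\<close>

lemma V_reachable:
  assumes B: "span B = V 1" "\<And>X. X \<in> B \<Longrightarrow> - X \<in> B" and j: "1 \<le> j"
  shows "V j \<subseteq> {b. reachable B j b}"
  using j
proof (induction j rule: nat_induct_at_least)
  case base
  have "span B \<subseteq> {b. reachable B 1 b}"
    using B(2) by (intro span_minimal subspace_reachable) (auto intro: reachable_generator simp del: One_nat_def)
  then show ?case using B(1) by simp
next
  case (Suc j)
  have "reachable B (Suc j) (br x y)" if x: "x \<in> V 1" and y: "y \<in> V j" for x y
  proof -
    have "subspace {x. br x y \<in> {b. reachable B (Suc j) b}}"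
      using subspace_reachable[of "Suc j" B]
      by (auto simp: subspace_def linear_0[OF linear_br_left] linear_add[OF linear_br_left]
          linear_cmul[OF linear_br_left])
    moreover have "B \<subseteq> {x. br x y \<in> {b. reachable B (Suc j) b}}"
      using reachable_br[OF _ B(2)] Suc y by blast
    ultimately have "span B \<subseteq> {x. br x y \<in> {b. reachable B (Suc j) b}}"
      by (intro span_minimal)
    then show ?thesis using B(1) x by blast
  qed
  then have "span {br x y | x y. x \<in> V 1 \<and> y \<in> V j} \<subseteq> {b. reachable B (Suc j) b}"
    by (intro span_minimal subspace_reachable) auto
  then show ?case using span_br_V Suc.hyps by simp
qed

text \<open>In an orthonormal basis of \<open>V j\<close> the coordinates are bounded by the norm,
  so the uniform statement for finite families covers a bounded part of the layer.\<close>

lemma V_reachable_uniform: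
  assumes B: "span B = V 1" "\<And>X. X \<in> B \<Longrightarrow> - X \<in> B" and j: "1 \<le> j"
  shows "\<exists>S. boundedly_generated B S \<and> S \<subseteq> F j \<and> (\<forall>v\<in>V j. norm v \<le> R \<longrightarrow> (\<exists>p\<in>S. p - v \<in> F (Suc j)))"
proof -
  obtain E where E: "E \<subseteq> V j" "pairwise orthogonal E" "\<And>x. x \<in> E \<Longrightarrow> norm x = 1" "independent E" "span E = V j"
    using orthonormal_basis_subspace[OF subspace_V] by metis
  have fin: "finite E" using E(4) by (rule independent_imp_finite)
  have "reachable B j b" if "b \<in> E" for b using V_reachable[OF assms] E(1) that by blast
  from reachable_family[OF fin this j] obtain S where S: "boundedly_generated B S" "S \<subseteq> F j"
    "\<And>c. (\<forall>b\<in>E. \<bar>c b\<bar> \<le> R) \<Longrightarrow> \<exists>p\<in>S. p - (\<Sum>b\<in>E. c b *\<^sub>R b) \<in> F (Suc j)" by blast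
  have "\<exists>p\<in>S. p - v \<in> F (Suc j)" if v: "v \<in> V j" "norm v \<le> R" for v
  proof -
    have "(\<Sum>b\<in>E. (v \<bullet> b) *\<^sub>R b) = v"
      using E v(1) by (intro orthonormal_basis_expand fin) auto
    moreover have "\<forall>b\<in>E. \<bar>v \<bullet> b\<bar> \<le> R"
    proof
      fix b assume "b \<in> E"
      then show "\<bar>v \<bullet> b\<bar> \<le> R" using Cauchy_Schwarz_ineq2[of v b] E(3)[of b] v(2) by simp
    qed
    ultimately show ?thesis using S(3)[of "\<lambda>b. v \<bullet> b"] by simp
  qed
  with S(1,2) show ?thesis by blast
qed

lemma hnorm_gprod_le:
  assumes B: "finite B" "B \<subseteq> V 1" and l: "set l \<subseteq> {0..C} \<times> B"
  shows "hnorm (gprod l) \<le> real (length l) * (\<bar>C\<bar> * (\<Sum>X\<in>B. hnorm X))"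
  using l
proof (induction l)
  case (Cons p l)
  have "hnorm (fst p *\<^sub>R snd p) = fst p * hnorm (snd p)"
    using Cons.prems B by (subst hnorm_scale_V1) auto
  also have "\<dots> \<le> \<bar>C\<bar> * (\<Sum>X\<in>B. hnorm X)"
    using Cons.prems B by (intro mult_mono member_le_sum) auto
  finally show ?case
    using Cons hnorm_mult[of "fst p *\<^sub>R snd p" "gprod l"] by (simp add: algebra_simps)
qed simp

lemma boundedly_generated_hnorm_bounded:
  assumes B: "finite B" "B \<subseteq> V 1" and S: "boundedly_generated B S"
  shows "\<exists>R. \<forall>x\<in>S. hnorm x \<le> R"
proof -
  obtain n C where n: "\<And>x. x \<in> S \<Longrightarrow> \<exists>l. length l \<le> n \<and> set l \<subseteq> {0..C} \<times> B \<and> gprod l = x"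
    using S unfolding boundedly_generated_def by blast
  have D: "0 \<le> \<bar>C\<bar> * (\<Sum>X\<in>B. hnorm X)" by (intro mult_nonneg_nonneg sum_nonneg) auto
  have "hnorm x \<le> real n * (\<bar>C\<bar> * (\<Sum>X\<in>B. hnorm X))" if x: "x \<in> S" for x
  proof -
    obtain l where l: "length l \<le> n" "set l \<subseteq> {0..C} \<times> B" "gprod l = x" using n[OF x] by blast
    then have "hnorm x \<le> real (length l) * (\<bar>C\<bar> * (\<Sum>X\<in>B. hnorm X))"
      using hnorm_gprod_le[OF B l(2)] by simp
    also have "\<dots> \<le> real n * (\<bar>C\<bar> * (\<Sum>X\<in>B. hnorm X))"
      using l(1) D by (intro mult_right_mono) auto
    finally show ?thesis .
  qed
  then show ?thesis by blast
qed

text \<open>Downward induction on the filtration, starting at \<open>F (Suc k)\<close>, which is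
  zero. The component of x in \<open>V j\<close> is matched by a generated p, and the remainder
  \<open>- p \<odot> x\<close> lies one level deeper with \<open>hnorm\<close> still
  bounded.\<close>

lemma boundedly_generated_F:
  assumes B: "finite B" "B \<subseteq> V 1" "span B = V 1" "\<And>X. X \<in> B \<Longrightarrow> - X \<in> B" and j: "1 \<le> j"
  shows "boundedly_generated B {x \<in> F j. hnorm x \<le> R}"
proof (cases "j \<le> Suc k")
  case True
  then show ?thesis using j
  proof (induction j arbitrary: R rule: inc_induct)
    case base
    have "{x \<in> F (Suc k). hnorm x \<le> R} \<subseteq> {0}" using F_zero[of "Suc k"] by auto
    then show ?case by (rule boundedly_generated_subset[OF boundedly_generated_zero])
  next
    case (step j)
    obtain R1 where R1: "\<And>x. hnorm x \<le> R \<Longrightarrow> norm x \<le> R1" using norm_bounded_of_hnorm by blast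
    obtain R2 where R2: "\<And>x. norm x \<le> R1 \<Longrightarrow> norm (proj j x) \<le> R2"
    proof -
      have "lip_bounded (proj j)"
        using linear_proj[of j] by (simp add: lip_bounded_linear linear_conv_bounded_linear)
      from lip_bounded_bound[OF this, of R1] that show thesis by metis
    qed
    have j: "1 \<le> j" by (rule step.prems)
    have "\<exists>S. boundedly_generated B S \<and> S \<subseteq> F j \<and> (\<forall>v\<in>V j. norm v \<le> R2 \<longrightarrow> (\<exists>p\<in>S. p - v \<in> F (Suc j)))"
      by (rule V_reachable_uniform[OF B(3) _ j]) (rule B(4))
    then obtain S where S: "boundedly_generated B S" "S \<subseteq> F j"
      "\<forall>v\<in>V j. norm v \<le> R2 \<longrightarrow> (\<exists>p\<in>S. p - v \<in> F (Suc j))"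
      by (elim exE conjE)
    obtain R3 where R3: "\<And>x. x \<in> S \<Longrightarrow> hnorm x \<le> R3"
      using boundedly_generated_hnorm_bounded[OF B(1,2) S(1)] by blast
    let ?T = "{x \<in> F (Suc j). hnorm x \<le> R3 + R}"
    have "{x \<in> F j. hnorm x \<le> R} \<subseteq> {x \<odot> y | x y. x \<in> S \<and> y \<in> ?T}"
    proof
      fix x assume "x \<in> {x \<in> F j. hnorm x \<le> R}"
      then have x: "x \<in> F j" "hnorm x \<le> R" by auto
      obtain p where p: "p \<in> S" "p - proj j x \<in> F (Suc j)"
        using S(3)[THEN bspec, OF proj_V, THEN mp, OF R2[OF R1[OF x(2)]]] by blast
      have pF: "- p \<in> F j" using p(1) S(2) by (auto intro: F_intros)
      have "- p \<odot> x - (- proj j x + proj j x) \<in> F (Suc j)"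
      proof (rule bch_add_F_Suc[OF pF x(1)])
        have "- (p - proj j x) \<in> F (Suc j)" using p(2) by (rule subspace_neg[OF subspace_F])
        then show "- p - - proj j x \<in> F (Suc j)" by simp
        show "x - proj j x \<in> F (Suc j)" using x(1) by (rule F_Suc)
      qed (rule step.prems)
      then have "- p \<odot> x \<in> F (Suc j)" by simp
      moreover have "hnorm (- p \<odot> x) \<le> R3 + R"
        using hnorm_mult[of "- p" x] R3[OF p(1)] x(2) by simp
      ultimately have "- p \<odot> x \<in> ?T" by simp
      moreover have "x = p \<odot> (- p \<odot> x)" by simp
      ultimately show "x \<in> {x \<odot> y | x y. x \<in> S \<and> y \<in> ?T}" using p(1) by blast
    qed
    moreover have "boundedly_generated B {x \<odot> y | x y. x \<in> S \<and> y \<in> ?T}"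
      by (intro boundedly_generated_mult S step.IH) simp
    ultimately show ?case using boundedly_generated_subset by blast
  qed
next
  case False
  then have "{x \<in> F j. hnorm x \<le> R} \<subseteq> {0}" using F_zero[of j] by auto
  then show ?thesis by (rule boundedly_generated_subset[OF boundedly_generated_zero])
qed

text \<open>Dilations scale the coefficients of a horizontal word and keep its length, so generation
  of the unit ball extends to every x with coefficients proportional to
  \<open>hnorm x\<close>.\<close>

theorem horizontal_generation:
  obtains B n C where "finite B" "B \<subseteq> V 1" "0 \<le> C"
    "\<And>x. \<exists>l. length l \<le> n \<and> set l \<subseteq> {0..C * hnorm x} \<times> B \<and> gprod l = x"
proof -
  obtain E where E: "E \<subseteq> V 1" "independent E" "span E = V 1"
    using orthonormal_basis_subspace[OF subspace_V] by metis
  define B where "B = E \<union> uminus ` E"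
  have fin: "finite B" using independent_imp_finite[OF E(2)] by (simp add: B_def)
  have B: "B \<subseteq> V 1"
    using E(1) subspace_neg[OF subspace_V] by (auto simp: B_def)
  then have "span B = V 1"
    using span_minimal[OF B subspace_V] span_mono[of E B] E(3) by (auto simp: B_def)
  moreover have "- X \<in> B" if "X \<in> B" for X using that by (auto simp: B_def)
  ultimately have "boundedly_generated B {x \<in> F 1. hnorm x \<le> 1}"
    by (intro boundedly_generated_F fin B) auto
  then obtain n C where n: "\<And>x. hnorm x \<le> 1 \<Longrightarrow> \<exists>l. length l \<le> n \<and> set l \<subseteq> {0..C} \<times> B \<and> gprod l = x"
    unfolding boundedly_generated_def F_1 by auto
  show ?thesis
  proof (rule that[OF fin B, of "\<bar>C\<bar>" n])
    fix x
    show "\<exists>l. length l \<le> n \<and> set l \<subseteq> {0..\<bar>C\<bar> * hnorm x} \<times> B \<and> gprod l = x"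
    proof (cases "x = 0")
      case True
      then show ?thesis by (intro exI[of _ "[]"]) simp
    next
      case False
      then have r: "0 < hnorm x" by (simp add: less_le)
      then have "hnorm (dilate (1 / hnorm x) x) \<le> 1" by (simp add: hnorm_dil)
      from n[OF this] obtain l where l: "length l \<le> n" "set l \<subseteq> {0..C} \<times> B" "gprod l = dilate (1 / hnorm x) x"
        by blast
      let ?l = "map (\<lambda>p. (hnorm x * fst p, snd p)) l"
      have "gprod ?l = dilate (hnorm x) (gprod l)"
        using l(2) B by (intro gprod_dil) auto
      then have "gprod ?l = x" using l(3) False by (simp add: dil_dil dil_1)
      moreover have "set ?l \<subseteq> {0..\<bar>C\<bar> * hnorm x} \<times> B"
      proof
        fix q assume "q \<in> set ?l"
        then obtain p where p: "p \<in> set l" "q = (hnorm x * fst p, snd p)" by auto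
        then have "0 \<le> fst p" "fst p \<le> \<bar>C\<bar>" "snd p \<in> B" using l(2) by auto
        then show "q \<in> {0..\<bar>C\<bar> * hnorm x} \<times> B"
          using p(2) mult_left_mono[of "fst p" "\<bar>C\<bar>" "hnorm x"] by (simp add: mult.commute)
      qed
      ultimately show ?thesis using l(1) by (intro exI[of _ ?l]) simp
    qed
  qed simp
qed

end

subsection \<open>P-differentiability and the inverse mapping theorem\<close>

context homogeneous_group
begin

section \<open>Algebra of h-homomorphisms\<close>

lemma h_hom_mult: "h_hom br V k L \<Longrightarrow> L (a \<odot> b) = L a \<odot> L b"
  and h_hom_dil: "h_hom br V k L \<Longrightarrow> 0 < r \<Longrightarrow> L (dilate r a) = dilate r (L a)"
  by (auto simp: h_hom_def)

lemma h_hom_0: "h_hom br V k L \<Longrightarrow> L 0 = 0"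
  using h_hom_mult[of L 0 0] bch_left_inject[of "L 0" "L 0" 0] by simp

lemma h_hom_uminus:
  assumes L: "h_hom br V k L" shows "L (- a) = - L a"
proof -
  have "L a \<odot> L (- a) = L a \<odot> (- L a)"
    using h_hom_mult[OF L, of a "- a"] h_hom_0[OF L] by simp
  then show ?thesis by (simp only: bch_left_inject)
qed

text \<open>For horizontal X, \<open>X \<odot> X\<close> is the dilation of X by 2. Hence dilating L
  X by 2 doubles it, and its component of weight i is multiplied by 2^i and by 2 at once, which
  leaves only i = 1.\<close>

lemma h_hom_V1:
  assumes L: "h_hom br V k L" and X: "X \<in> V 1" shows "L X \<in> V 1"
proof -
  have "dilate 2 (L X) = L (X \<odot> X)"
    using bch_parallel[of 1 X 1] h_hom_dil[OF L, of 2 X] X by (simp add: dil_V1)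
  also have "\<dots> = 2 *\<^sub>R L X"
    using bch_parallel[of 1 "L X" 1] by (simp add: h_hom_mult[OF L])
  finally have eq: "dilate 2 (L X) = 2 *\<^sub>R L X" .
  have "proj i (L X) = 0" if "i \<in> {1..k}" "i \<noteq> 1" for i
  proof -
    have "(2 ^ i - 2) *\<^sub>R proj i (L X) = 0"
      using arg_cong[OF eq, of "proj i"] by (simp add: proj_dil linear_cmul[OF linear_proj] algebra_simps)
    moreover have "(2::real) ^ i \<noteq> 2"
    proof -
      have "(2::real) ^ 1 < 2 ^ i" using that by (intro power_strict_increasing) auto
      then show ?thesis by simp
    qed
    ultimately show ?thesis by simp
  qed
  then have "L X = proj 1 (L X)"
    by - (rule proj_eqI, auto simp: proj_of_V[OF proj_V] simp del: One_nat_def)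
  then show ?thesis using proj_V[where i = 1 and v = "L X"] by simp
qed

lemma h_hom_scale_V1:
  assumes L: "h_hom br V k L" and X: "X \<in> V 1" shows "L (t *\<^sub>R X) = t *\<^sub>R L X"
proof -
  have pos: "L (t *\<^sub>R X) = t *\<^sub>R L X" if "0 < t" for t
    using h_hom_dil[OF L that, of X] X h_hom_V1[OF L X] by (simp add: dil_V1)
  consider "0 < t" | "t = 0" | "0 < - t" by linarith
  then show ?thesis
  proof cases
    case 3
    then show ?thesis using pos[OF 3] h_hom_uminus[OF L, of "(- t) *\<^sub>R X"] by simp
  qed (auto simp: pos h_hom_0[OF L])
qed

lemma h_hom_inv:
  assumes L: "h_hom br V k L" and "bij L" shows "h_hom br V k (inv L)"
proof -
  have L_inv: "L (inv L y) = y" for y using \<open>bij L\<close> by (simp add: bij_is_surj surj_f_inv_f)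
  have inv_L: "inv L (L x) = x" for x using \<open>bij L\<close> by (simp add: bij_is_inj)
  show ?thesis
    unfolding h_hom_def
    by (metis L_inv inv_L h_hom_mult[OF L] h_hom_dil[OF L])
qed

lemma d_h_hom: "h_hom br V k L \<Longrightarrow> d (L x) (L y) = hnorm (L (- x \<odot> y))"
  by (simp add: d_eq_hnorm h_hom_mult h_hom_uminus)

lemma isCont_d:
  assumes "\<And>e. 0 < e \<Longrightarrow> \<exists>\<delta>>0. \<forall>y. d x y < \<delta> \<longrightarrow> d (f x) (f y) < e"
  shows "isCont f x"
  unfolding isCont_def
proof (rule topological_tendstoI)
  fix S assume "open S" "f x \<in> S"
  then obtain e where e: "0 < e" "\<And>y. d (f x) y < e \<Longrightarrow> y \<in> S"
    using open_contains_d_ball by blast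
  obtain \<delta> where \<delta>: "0 < \<delta>" "\<And>y. d x y < \<delta> \<Longrightarrow> d (f x) (f y) < e"
    using assms[OF e(1)] by blast
  show "eventually (\<lambda>y. f y \<in> S) (at x)"
    unfolding eventually_at_topological
    using open_d_ball[of x \<delta>] \<delta> e(2) by (intro exI[of _ "{y. d x y < \<delta>}"]) auto
qed

text \<open>The form without quotient also covers h = 0, where both sides vanish; balls of
  \<open>hnorm\<close> replace Euclidean neighbourhoods of 0.\<close>

lemma P_diff_iff:
  "P_diff br V k d f x L \<longleftrightarrow> h_hom br V k L \<and>
    (\<forall>e>0. \<exists>\<delta>>0. \<forall>h. hnorm h < \<delta> \<longrightarrow> d (- f x \<odot> f (x \<odot> h)) (L h) \<le> e * hnorm h)"
proof -
  let ?q = "\<lambda>h. d (- f x \<odot> f (x \<odot> h)) (L h)"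
  have "(((\<lambda>h. ?q h / d h 0) \<longlongrightarrow> 0) (at 0)) \<longleftrightarrow> (\<forall>e>0. \<exists>\<delta>>0. \<forall>h. hnorm h < \<delta> \<longrightarrow> ?q h \<le> e * hnorm h)"
    (is "?l \<longleftrightarrow> ?r") if L: "h_hom br V k L"
  proof
    assume lim: ?l
    show ?r
    proof (intro allI impI)
      fix e :: real assume e: "0 < e"
      from tendstoD[OF lim this] obtain S where S: "open S" "0 \<in> S"
        "\<And>h. h \<in> S \<Longrightarrow> h \<noteq> 0 \<Longrightarrow> dist (?q h / d h 0) 0 < e"
        unfolding eventually_at_topological by blast
      obtain \<delta> where \<delta>: "0 < \<delta>" "\<And>h. d 0 h < \<delta> \<Longrightarrow> h \<in> S"
        using open_contains_d_ball[OF S(1,2)] by blast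
      have "?q h \<le> e * hnorm h" if "hnorm h < \<delta>" for h
      proof (cases "h = 0")
        case True then show ?thesis by (simp add: h_hom_0[OF L])
      next
        case False
        have "h \<in> S" using that by (intro \<delta>(2)) (simp add: hnorm_def d_sym)
        from S(3)[OF this False] have "?q h / hnorm h < e" by (simp add: hnorm_def)
        moreover have "0 < hnorm h" using False by (simp add: less_le)
        ultimately show ?thesis by (simp add: pos_divide_less_eq)
      qed
      with \<delta>(1) show "\<exists>\<delta>>0. \<forall>h. hnorm h < \<delta> \<longrightarrow> ?q h \<le> e * hnorm h" by blast
    qed
  next
    assume r: ?r
    show ?l
    proof (rule tendstoI)
      fix e :: real assume e: "0 < e"
      then have "0 < e / 2" by simp
      with r obtain \<delta> where \<delta>: "0 < \<delta>" "\<And>h. hnorm h < \<delta> \<Longrightarrow> ?q h \<le> e / 2 * hnorm h" by blast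
      have "dist (?q h / d h 0) 0 < e" if "hnorm h < \<delta>" "h \<noteq> 0" for h
      proof -
        have "0 < hnorm h" using that by (simp add: less_le)
        then have "?q h / hnorm h \<le> e / 2" using \<delta>(2)[OF that(1)] by (simp add: pos_divide_le_eq)
        then have "?q h / hnorm h < e" using e by linarith
        then show ?thesis by (simp add: hnorm_def)
      qed
      then show "eventually (\<lambda>h. dist (?q h / d h 0) 0 < e) (at 0)"
        unfolding eventually_at_topological using \<delta>(1)
        by (intro exI[of _ "{h. hnorm h < \<delta>}"]) (auto intro!: open_Collect_less continuous_intros)
    qed
  qed
  then show ?thesis unfolding P_diff_def by blast
qed

text \<open>Along a horizontal line \<open>s \<mapsto> z \<odot> s X\<close> the curve \<open>f (z \<odot> s X)\<close> is horizontal with velocity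
  \<open>Df (z \<odot> s X) X\<close>, which is close to \<open>Df xbar X\<close>.\<close>
lemma strict_P_diff_horizontal:
  assumes "open \<Omega>" and P: "\<And>x. x \<in> \<Omega> \<Longrightarrow> P_diff br V k d f x (Df x)"
    and cont: "continuous_on \<Omega> (\<lambda>x. Df x X)"
    and xbar: "xbar \<in> \<Omega>" and X: "X \<in> V 1" and \<eta>: "0 < \<eta>"
  shows "\<exists>\<delta>>0. \<forall>z t. 0 \<le> t \<longrightarrow> d xbar z + t * hnorm X < \<delta> \<longrightarrow>
    d (- f z \<odot> f (z \<odot> t *\<^sub>R X)) (t *\<^sub>R Df xbar X) \<le> \<eta> * t"
proof -
  have hom: "h_hom br V k (Df x)" if "x \<in> \<Omega>" for x using P[OF that] by (simp add: P_diff_iff)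
  have "Df xbar X \<in> V 1" by (rule h_hom_V1[OF hom[OF xbar] X])
  from horizontal_curve_estimate[OF this \<eta>] obtain \<epsilon> where \<epsilon>: "0 < \<epsilon>" and
    curve: "\<forall>T>0. \<forall>\<gamma> A. (\<forall>s\<in>{0..T}. A s \<in> V 1 \<and> norm (A s - Df xbar X) \<le> \<epsilon>) \<longrightarrow>
    (\<forall>s\<in>{0..T}. \<forall>e>0. \<exists>\<delta>>0. \<forall>s'\<in>{0..T}. \<bar>s' - s\<bar> < \<delta> \<longrightarrow>
        d (- \<gamma> s \<odot> \<gamma> s') ((s' - s) *\<^sub>R A s) \<le> e * \<bar>s' - s\<bar>) \<longrightarrow>
    d (- \<gamma> 0 \<odot> \<gamma> T) (T *\<^sub>R Df xbar X) \<le> \<eta> * T"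
    by (elim exE conjE)
  obtain \<delta>1 where \<delta>1: "0 < \<delta>1" "\<And>y. d xbar y < \<delta>1 \<Longrightarrow> y \<in> \<Omega>"
    using open_contains_d_ball[OF \<open>open \<Omega>\<close> xbar] by blast
  have "isCont (\<lambda>x. Df x X) xbar"
    using cont \<open>open \<Omega>\<close> xbar by (simp add: continuous_on_eq_continuous_at)
  from continuous_at_d[OF this \<epsilon>] obtain \<delta>2 where
    \<delta>2: "0 < \<delta>2" "\<And>y. d xbar y < \<delta>2 \<Longrightarrow> norm (Df y X - Df xbar X) < \<epsilon>" by blast
  show ?thesis
  proof (intro exI[of _ "min \<delta>1 \<delta>2"] conjI allI impI)
    show "0 < min \<delta>1 \<delta>2" using \<delta>1(1) \<delta>2(1) by simp
    fix z t assume "0 \<le> t" and z: "d xbar z + t * hnorm X < min \<delta>1 \<delta>2"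
    show "d (- f z \<odot> f (z \<odot> t *\<^sub>R X)) (t *\<^sub>R Df xbar X) \<le> \<eta> * t"
    proof (cases "t = 0")
      case False
      with \<open>0 \<le> t\<close> have t: "0 < t" by simp
      define \<gamma> where "\<gamma> s = f (z \<odot> s *\<^sub>R X)" for s
      define A where "A s = Df (z \<odot> s *\<^sub>R X) X" for s
      have near: "d xbar (z \<odot> s *\<^sub>R X) < min \<delta>1 \<delta>2" if "s \<in> {0..t}" for s
      proof -
        have "d xbar (z \<odot> s *\<^sub>R X) \<le> d xbar z + hnorm (s *\<^sub>R X)"
          using d_tri[of xbar "z \<odot> s *\<^sub>R X" z] by simp
        also have "hnorm (s *\<^sub>R X) = s * hnorm X" using that by (simp add: hnorm_scale_V1[OF X])
        also have "\<dots> \<le> t * hnorm X" using that by (intro mult_right_mono) auto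
        finally show ?thesis using z by simp
      qed
      have in_\<Omega>: "z \<odot> s *\<^sub>R X \<in> \<Omega>" if "s \<in> {0..t}" for s using near[OF that] \<delta>1(2) by simp
      have "\<forall>s\<in>{0..t}. A s \<in> V 1 \<and> norm (A s - Df xbar X) \<le> \<epsilon>"
        unfolding A_def using near \<delta>2(2) h_hom_V1[OF hom[OF in_\<Omega>] X] by (auto intro: less_imp_le)
      moreover have "\<forall>s\<in>{0..t}. \<forall>e>0. \<exists>\<delta>>0. \<forall>s'\<in>{0..t}. \<bar>s' - s\<bar> < \<delta> \<longrightarrow>
        d (- \<gamma> s \<odot> \<gamma> s') ((s' - s) *\<^sub>R A s) \<le> e * \<bar>s' - s\<bar>"
      proof (intro ballI allI impI)
        fix s e :: real assume s: "s \<in> {0..t}" and e: "0 < e"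
        \<comment> \<open>The summand 1 keeps the divisor positive when X = 0.\<close>
        let ?y = "z \<odot> s *\<^sub>R X" and ?N = "hnorm X + 1"
        have N: "0 < ?N" by (simp add: add_nonneg_pos)
        have "0 < e / ?N" using e N by simp
        then obtain \<delta> where \<delta>: "0 < \<delta>" "\<And>h. hnorm h < \<delta> \<Longrightarrow> d (- f ?y \<odot> f (?y \<odot> h)) (Df ?y h) \<le> e / ?N * hnorm h"
          using P[OF in_\<Omega>[OF s]] unfolding P_diff_iff by blast
        have "d (- \<gamma> s \<odot> \<gamma> s') ((s' - s) *\<^sub>R A s) \<le> e * \<bar>s' - s\<bar>" if s': "\<bar>s' - s\<bar> < \<delta> / ?N" for s'
        proof -
          let ?h = "(s' - s) *\<^sub>R X"
          have h: "hnorm ?h = \<bar>s' - s\<bar> * hnorm X" by (rule hnorm_scale_V1[OF X])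
          also have "\<dots> \<le> \<bar>s' - s\<bar> * ?N" by (intro mult_left_mono) auto
          finally have hN: "hnorm ?h \<le> \<bar>s' - s\<bar> * ?N" .
          also have "\<dots> < \<delta>" using s' N by (simp add: pos_less_divide_eq)
          finally have "d (- f ?y \<odot> f (?y \<odot> ?h)) (Df ?y ?h) \<le> e / ?N * hnorm ?h" by (rule \<delta>(2))
          also have "\<dots> \<le> e / ?N * (\<bar>s' - s\<bar> * ?N)" using hN e N by (intro mult_left_mono) auto
          also have "\<dots> = e * \<bar>s' - s\<bar>" using N by simp
          also have "?y \<odot> ?h = z \<odot> s' *\<^sub>R X" by (simp add: bch_assoc bch_parallel)
          also have "Df ?y ?h = (s' - s) *\<^sub>R A s"
            using h_hom_scale_V1[OF hom[OF in_\<Omega>[OF s]] X] by (simp add: A_def)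
          finally show ?thesis by (simp add: \<gamma>_def)
        qed
        moreover have "0 < \<delta> / ?N" using \<delta>(1) N by simp
        ultimately show "\<exists>\<delta>>0. \<forall>s'\<in>{0..t}. \<bar>s' - s\<bar> < \<delta> \<longrightarrow>
          d (- \<gamma> s \<odot> \<gamma> s') ((s' - s) *\<^sub>R A s) \<le> e * \<bar>s' - s\<bar>" by blast
      qed
      ultimately have "d (- \<gamma> 0 \<odot> \<gamma> t) (t *\<^sub>R Df xbar X) \<le> \<eta> * t"
        by (rule curve[THEN spec, THEN mp, OF t, THEN spec, THEN spec, THEN mp, THEN mp])
      then show ?thesis by (simp add: \<gamma>_def)
    qed simp
  qed
qed

end

section \<open>Boundedness, strict differentiability and inversion\<close>

context stratified_group
begin

text \<open>\<open>h_hom\<close> demands no continuity. The bound comes from the finitely many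
  values of L on B, since x is a product of boundedly many factors of size proportional to
  \<open>hnorm x\<close>.\<close>

lemma h_hom_bounded:
  assumes L: "h_hom br V k L"
  shows "\<exists>C>0. \<forall>x. hnorm (L x) \<le> C * hnorm x"
proof -
  obtain B n C where B: "finite B" "B \<subseteq> V 1" "0 \<le> C"
    and gen: "\<And>x. \<exists>l. length l \<le> n \<and> set l \<subseteq> {0..C * hnorm x} \<times> B \<and> gprod l = x"
    by (rule horizontal_generation) (rule that)
  define D where "D = (\<Sum>X\<in>B. hnorm (L X))"
  have D: "0 \<le> D" by (auto simp: D_def intro: sum_nonneg)
  have word: "hnorm (L (gprod l)) \<le> real (length l) * (c * D)" if "set l \<subseteq> {0..c} \<times> B" for l c
    using that
  proof (induction l)
    case Nil then show ?case by (simp add: h_hom_0[OF L])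
  next
    case (Cons p l)
    have p: "0 \<le> fst p" "fst p \<le> c" "snd p \<in> B" using Cons.prems by auto
    have V1: "snd p \<in> V 1" using p(3) B(2) by blast
    have "hnorm (L (fst p *\<^sub>R snd p)) = fst p * hnorm (L (snd p))"
      using p(1) by (simp add: h_hom_scale_V1[OF L V1] hnorm_scale_V1[OF h_hom_V1[OF L V1]])
    also have "\<dots> \<le> c * D"
      unfolding D_def using p B(1) by (intro mult_mono member_le_sum[of _ _ "\<lambda>X. hnorm (L X)"]) auto
    finally show ?case
      using Cons hnorm_mult[of "L (fst p *\<^sub>R snd p)" "L (gprod l)"] by (simp add: h_hom_mult[OF L] algebra_simps)
  qed
  have "hnorm (L x) \<le> (real n * C * D + 1) * hnorm x" for x
  proof -
    obtain l where l: "length l \<le> n" "set l \<subseteq> {0..C * hnorm x} \<times> B" "gprod l = x" using gen by blast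
    have "hnorm (L x) \<le> real (length l) * (C * hnorm x * D)" using word[OF l(2)] l(3) by simp
    also have "\<dots> \<le> real n * (C * hnorm x * D)"
      using l(1) B(3) D by (intro mult_right_mono mult_nonneg_nonneg) auto
    also have "\<dots> \<le> (real n * C * D + 1) * hnorm x" by (simp add: algebra_simps)
    finally show ?thesis .
  qed
  moreover have "0 < real n * C * D + 1" using B(3) D by (intro add_nonneg_pos mult_nonneg_nonneg) auto
  ultimately show ?thesis by blast
qed

lemma isCont_h_hom:
  assumes L: "h_hom br V k L" shows "isCont L x"
proof (rule isCont_d)
  obtain C where C: "0 < C" "\<And>x. hnorm (L x) \<le> C * hnorm x" using h_hom_bounded[OF L] by blast
  fix e :: real assume e: "0 < e"
  have "d (L x) (L y) < e" if "d x y < e / C" for y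
  proof -
    have "d (L x) (L y) \<le> C * d x y" using C(2)[of "- x \<odot> y"] by (simp add: d_h_hom[OF L] d_eq_hnorm[of x y])
    also have "\<dots> < e" using that C(1) by (simp add: pos_less_divide_eq mult.commute)
    finally show ?thesis .
  qed
  moreover have "0 < e / C" using e C(1) by simp
  ultimately show "\<exists>\<delta>>0. \<forall>y. d x y < \<delta> \<longrightarrow> d (L x) (L y) < e" by blast
qed

text \<open>With y written as x followed by boundedly many horizontal steps, the one-step estimates
  are chained. The error of the first step is carried through right multiplication by the image of
  the remaining ones, which \<open>d_mult_right_small\<close> controls at scale r.\<close>

theorem strict_P_diff:
  assumes \<Omega>: "open \<Omega>" and P: "\<And>x. x \<in> \<Omega> \<Longrightarrow> P_diff br V k d f x (Df x)"
    and cont: "\<And>h. continuous_on \<Omega> (\<lambda>x. Df x h)"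
    and xbar: "xbar \<in> \<Omega>" and \<eta>: "0 < \<eta>"
  shows "\<exists>\<delta>>0. \<forall>x y. d xbar x < \<delta> \<longrightarrow> d xbar y < \<delta> \<longrightarrow>
    d (- f x \<odot> f y) (Df xbar (- x \<odot> y)) \<le> \<eta> * d x y"
proof -
  let ?L = "Df xbar"
  have L: "h_hom br V k ?L" using P[OF xbar] by (simp add: P_diff_iff)
  obtain B n C where B: "finite B" "B \<subseteq> V 1" and C: "0 \<le> C"
    and gen: "\<And>x. \<exists>l. length l \<le> n \<and> set l \<subseteq> {0..C * hnorm x} \<times> B \<and> gprod l = x"
    by (rule horizontal_generation) (rule that)
  obtain CL where CL: "0 < CL" "\<And>x. hnorm (?L x) \<le> CL * hnorm x" using h_hom_bounded[OF L] by blast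
  define D where "D = (\<Sum>X\<in>B. hnorm X)"
  have D: "0 \<le> D" by (auto simp: D_def intro: sum_nonneg)
  have le_D: "hnorm X \<le> D" if "X \<in> B" for X
    unfolding D_def using that B(1) by (intro member_le_sum) auto
  have along: "\<exists>\<delta>>0. \<forall>X\<in>B. \<forall>z t. 0 \<le> t \<longrightarrow> d xbar z + t * hnorm X < \<delta> \<longrightarrow>
    d (- f z \<odot> f (z \<odot> t *\<^sub>R X)) (t *\<^sub>R ?L X) \<le> \<epsilon> * t" if "0 < \<epsilon>" for \<epsilon>
  proof -
    have "\<forall>X\<in>B. \<exists>\<delta>>0. \<forall>z t. 0 \<le> t \<longrightarrow> d xbar z + t * hnorm X < \<delta> \<longrightarrow>
      d (- f z \<odot> f (z \<odot> t *\<^sub>R X)) (t *\<^sub>R ?L X) \<le> \<epsilon> * t"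
      using strict_P_diff_horizontal[OF \<Omega> P cont xbar _ that] B(2) by blast
    then obtain \<delta> where \<delta>: "\<And>X. X \<in> B \<Longrightarrow> 0 < \<delta> X"
      "\<And>X z t. X \<in> B \<Longrightarrow> 0 \<le> t \<Longrightarrow> d xbar z + t * hnorm X < \<delta> X \<Longrightarrow>
      d (- f z \<odot> f (z \<odot> t *\<^sub>R X)) (t *\<^sub>R ?L X) \<le> \<epsilon> * t" by metis
    \<comment> \<open>Finiteness of B yields a radius common to all directions; the 1 covers empty
      B.\<close>
    have "0 < Min (insert 1 (\<delta> ` B))" using B(1) \<delta>(1) by auto
    moreover have "Min (insert 1 (\<delta> ` B)) \<le> \<delta> X" if "X \<in> B" for X using B(1) that by (intro Min_le) auto
    ultimately show ?thesis using \<delta>(2) by (intro exI[of _ "Min (insert 1 (\<delta> ` B))"]) force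
  qed
  \<comment> \<open>The condition on x leaves room for m steps, each of length at most C r D, so all
    intermediate points stay near \<open>xbar\<close>.\<close>
  have chain: "\<exists>\<delta>>0. \<forall>x l r. 0 < r \<longrightarrow> length l \<le> m \<longrightarrow> set l \<subseteq> {0..C * r} \<times> B \<longrightarrow>
    d xbar x + real m * (C * r * D) < \<delta> \<longrightarrow>
    d (- f x \<odot> f (x \<odot> gprod l)) (?L (gprod l)) \<le> \<theta> * r" if "0 < \<theta>" for m \<theta>
    using that
  proof (induction m arbitrary: \<theta>)
    case 0
    then show ?case by (intro exI[of _ 1]) (auto simp: h_hom_0[OF L])
  next
    case (Suc m)
    from Suc.prems have "0 < \<theta> / 2" by simp
    from Suc.IH[OF this] obtain \<delta>1 where \<delta>1: "0 < \<delta>1"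
      "\<And>x l r. 0 < r \<Longrightarrow> length l \<le> m \<Longrightarrow> set l \<subseteq> {0..C * r} \<times> B \<Longrightarrow>
      d xbar x + real m * (C * r * D) < \<delta>1 \<Longrightarrow>
      d (- f x \<odot> f (x \<odot> gprod l)) (?L (gprod l)) \<le> \<theta> / 2 * r" by blast
    \<comment> \<open>The tolerance of the first step is fixed after the size of what follows it: q
      is the image of at most m steps, so its \<open>hnorm\<close> is at most CL m C D r.\<close>
    from d_mult_right_small[OF \<open>0 < \<theta> / 2\<close>, of "CL * (real m * (C * D))"] obtain \<epsilon> where \<epsilon>: "0 < \<epsilon>"
      "\<And>r q a a'. 0 < r \<Longrightarrow> hnorm q \<le> CL * (real m * (C * D)) * r \<Longrightarrow> d a a' \<le> \<epsilon> * r \<Longrightarrow>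
        d (a \<odot> q) (a' \<odot> q) \<le> \<theta> / 2 * r" by blast
    have "0 < \<epsilon> / (C + 1)" using \<epsilon>(1) C by simp
    from along[OF this] obtain \<delta>2 where \<delta>2: "0 < \<delta>2"
      "\<And>X z t. X \<in> B \<Longrightarrow> 0 \<le> t \<Longrightarrow> d xbar z + t * hnorm X < \<delta>2 \<Longrightarrow>
        d (- f z \<odot> f (z \<odot> t *\<^sub>R X)) (t *\<^sub>R ?L X) \<le> \<epsilon> / (C + 1) * t" by blast
    have "d (- f x \<odot> f (x \<odot> gprod l)) (?L (gprod l)) \<le> \<theta> * r"
      if r: "0 < r" and len: "length l \<le> Suc m" and l: "set l \<subseteq> {0..C * r} \<times> B"
        and x: "d xbar x + real (Suc m) * (C * r * D) < min \<delta>1 \<delta>2" for x l r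
    proof (cases l)
      case Nil
      then show ?thesis using Suc.prems r by (simp add: h_hom_0[OF L])
    next
      case (Cons p l')
      define t X where "t = fst p" and "X = snd p"
      have t: "0 \<le> t" "t \<le> C * r" and X: "X \<in> B" "X \<in> V 1" and l': "set l' \<subseteq> {0..C * r} \<times> B" "length l' \<le> m"
        using l len Cons B(2) by (auto simp: t_def X_def)
      define z q where "z = x \<odot> t *\<^sub>R X" and "q = ?L (gprod l')"
      have "C * r * D \<ge> 0" using C r D by simp
      have tX: "t * hnorm X \<le> C * r * D" using t X(1) le_D C r by (intro mult_mono) auto
      have "d xbar x + t * hnorm X < \<delta>2"
        using x tX mult_nonneg_nonneg[of "real m", OF _ \<open>C * r * D \<ge> 0\<close>] by (simp add: algebra_simps)
      then have "d (- f x \<odot> f z) (t *\<^sub>R ?L X) \<le> \<epsilon> / (C + 1) * t"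
        unfolding z_def using X(1) t(1) by (intro \<delta>2(2))
      also have "\<dots> \<le> \<epsilon> / (C + 1) * ((C + 1) * r)"
        using t \<epsilon>(1) C r by (intro mult_left_mono) (auto simp: distrib_right)
      also have "\<dots> = \<epsilon> * r" using C by simp
      finally have step: "d (- f x \<odot> f z) (t *\<^sub>R ?L X) \<le> \<epsilon> * r" .
      have "hnorm (gprod l') \<le> real (length l') * (C * r * D)"
        using hnorm_gprod_le[OF B l'(1)] C r by (simp add: D_def)
      also have "\<dots> \<le> real m * (C * r * D)" using l'(2) \<open>C * r * D \<ge> 0\<close> by (intro mult_right_mono) auto
      finally have "CL * hnorm (gprod l') \<le> CL * (real m * (C * r * D))" using CL(1) by (intro mult_left_mono) auto
      then have "hnorm q \<le> CL * (real m * (C * D)) * r"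
        using CL(2)[of "gprod l'"] by (simp add: q_def algebra_simps)
      from \<epsilon>(2)[OF r this step] have 1: "d ((- f x \<odot> f z) \<odot> q) (t *\<^sub>R ?L X \<odot> q) \<le> \<theta> / 2 * r" .
      have "d xbar z \<le> d xbar x + t * hnorm X"
        using d_tri[of xbar z x] t(1) by (simp add: z_def hnorm_scale_V1[OF X(2)])
      then have "d xbar z + real m * (C * r * D) < \<delta>1"
        using x tX by (simp add: algebra_simps)
      from \<delta>1(2)[OF r l'(2,1) this]
      have "d (- f z \<odot> f (z \<odot> gprod l')) q \<le> \<theta> / 2 * r" by (simp add: q_def)
      then have 2: "d ((- f x \<odot> f z) \<odot> (- f z \<odot> f (z \<odot> gprod l'))) ((- f x \<odot> f z) \<odot> q) \<le> \<theta> / 2 * r"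
        by simp
      have "(- f x \<odot> f z) \<odot> (- f z \<odot> f (z \<odot> gprod l')) = - f x \<odot> f (x \<odot> gprod l)"
        by (simp add: bch_assoc z_def Cons t_def X_def)
      moreover have "?L (gprod l) = t *\<^sub>R ?L X \<odot> q"
        by (simp add: Cons h_hom_mult[OF L] q_def h_hom_scale_V1[OF L X(2)] flip: t_def X_def)
      ultimately show ?thesis
        using 1 2 d_tri[of "- f x \<odot> f (x \<odot> gprod l)" "?L (gprod l)" "(- f x \<odot> f z) \<odot> q"] by simp
    qed
    then show ?case using \<delta>1(1) \<delta>2(1) by (intro exI[of _ "min \<delta>1 \<delta>2"]) auto
  qed
  from chain[OF \<eta>, of n] obtain \<delta> where \<delta>: "0 < \<delta>"
    "\<And>x l r. 0 < r \<Longrightarrow> length l \<le> n \<Longrightarrow> set l \<subseteq> {0..C * r} \<times> B \<Longrightarrow>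
    d xbar x + real n * (C * r * D) < \<delta> \<Longrightarrow>
    d (- f x \<odot> f (x \<odot> gprod l)) (?L (gprod l)) \<le> \<eta> * r" by blast
  \<comment> \<open>The distance of x and y is at most 2 \<delta> / E, so the start and the n steps
    together stay below (\<delta> / E) E = \<delta>.\<close>
  define E where "E = 1 + 2 * (real n * (C * D))"
  have E: "0 < E" using C D by (simp add: E_def add_pos_nonneg)
  show ?thesis
  proof (intro exI[of _ "\<delta> / E"] conjI allI impI)
    show "0 < \<delta> / E" using \<delta>(1) E by simp
    fix x y assume x: "d xbar x < \<delta> / E" and y: "d xbar y < \<delta> / E"
    show "d (- f x \<odot> f y) (?L (- x \<odot> y)) \<le> \<eta> * d x y"
    proof (cases "x = y")
      case True then show ?thesis by (simp add: h_hom_0[OF L])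
    next
      case False
      define r where "r = d x y"
      have r: "0 < r" using False by (simp add: r_def less_le)
      obtain l where l: "length l \<le> n" "set l \<subseteq> {0..C * r} \<times> B" "gprod l = - x \<odot> y"
        using gen[of "- x \<odot> y"] by (auto simp: r_def d_eq_hnorm)
      have "r \<le> 2 * (\<delta> / E)" using d_tri[of x y xbar] d_sym[of x xbar] x y by (simp add: r_def)
      then have "real n * (C * r * D) \<le> real n * (C * (2 * (\<delta> / E)) * D)"
        using C D by (intro mult_left_mono mult_right_mono) auto
      then have "d xbar x + real n * (C * r * D) < \<delta> / E + real n * (C * (2 * (\<delta> / E)) * D)"
        using x by linarith
      also have "u + real n * (C * (2 * u) * D) = u * E" for u
        by (simp add: E_def algebra_simps)
      finally have "d xbar x + real n * (C * r * D) < \<delta>" using E by simp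
      from \<delta>(2)[OF r l(1,2) this] show ?thesis by (simp add: l(3) r_def)
    qed
  qed
qed

text \<open>A homomorphism tangent to a map that expands distances up to a factor has no kernel, is open by
  invariance of domain, and surjective by dilation.\<close>
lemma bij_of_P_diff_expanding:
  assumes P: "P_diff br V k d f x M" and U: "open U" "x \<in> U"
    and K: "0 < K" "\<And>y. y \<in> U \<Longrightarrow> d x y \<le> K * d (f x) (f y)"
  shows "bij M" "hnorm h \<le> K * hnorm (M h)"
proof -
  have M: "h_hom br V k M" using P by (simp add: P_diff_iff)
  obtain \<delta>1 where \<delta>1: "0 < \<delta>1" "\<And>y. d x y < \<delta>1 \<Longrightarrow> y \<in> U"
    using open_contains_d_ball[OF U] by blast
  show le: "hnorm h \<le> K * hnorm (M h)" for h
  proof (rule field_le_epsilon)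
    fix e :: real assume e: "0 < e"
    \<comment> \<open>After multiplication by K the error is r e times hnorm h / (hnorm h + 1),
      hence at most r e.\<close>
    define e' where "e' = e / (K * (hnorm h + 1))"
    have hp: "0 < hnorm h + 1" by (simp add: add_nonneg_pos)
    have e': "0 < e'" using e K(1) hp by (simp add: e'_def)
    then obtain \<delta>2 where \<delta>2: "0 < \<delta>2"
      "\<And>h. hnorm h < \<delta>2 \<Longrightarrow> d (- f x \<odot> f (x \<odot> h)) (M h) \<le> e' * hnorm h"
      using P unfolding P_diff_iff by blast
    \<comment> \<open>h is dilated until both the expansion bound on U and the differentiability
      estimate apply; by homogeneity r cancels at the end.\<close>
    define r where "r = min \<delta>1 \<delta>2 / (hnorm h + 1)"
    have r: "0 < r" using \<delta>1(1) \<delta>2(1) hp by (simp add: r_def)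
    let ?h = "dilate r h"
    have rh: "hnorm ?h = r * hnorm h" using r by (simp add: hnorm_dil)
    also have "\<dots> < r * (hnorm h + 1)" using r by simp
    also have "\<dots> = min \<delta>1 \<delta>2" using hp by (simp add: r_def)
    finally have small: "hnorm ?h < \<delta>1" "hnorm ?h < \<delta>2" by auto
    have "r * hnorm h = d x (x \<odot> ?h)" by (simp add: rh)
    also have "\<dots> \<le> K * d (f x) (f (x \<odot> ?h))" using small(1) by (intro K(2) \<delta>1(2)) simp
    also have "\<dots> = K * d (- f x \<odot> f (x \<odot> ?h)) 0" by (simp add: d_eq_hnorm[of "f x"] hnorm_def)
    also have "\<dots> \<le> K * (e' * (r * hnorm h) + r * hnorm (M h))"
    proof (intro mult_left_mono)
      have "d (- f x \<odot> f (x \<odot> ?h)) 0 \<le> d (- f x \<odot> f (x \<odot> ?h)) (M ?h) + d (M ?h) 0" by (rule d_tri)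
      moreover have "d (M ?h) 0 = r * hnorm (M h)"
        using r by (simp add: h_hom_dil[OF M r] hnorm_dil flip: hnorm_def)
      ultimately show "d (- f x \<odot> f (x \<odot> ?h)) 0 \<le> e' * (r * hnorm h) + r * hnorm (M h)"
        using \<delta>2(2)[OF small(2)] by (simp add: rh)
    qed (use K in simp)
    also have "\<dots> = K * e' * (r * hnorm h) + r * (K * hnorm (M h))"
      by (simp add: algebra_simps)
    also have "K * e' = e / (hnorm h + 1)" using K(1) by (simp add: e'_def)
    also have "e / (hnorm h + 1) * (r * hnorm h) + r * (K * hnorm (M h))
        = r * (K * hnorm (M h) + e * (hnorm h / (hnorm h + 1)))"
      by (simp add: distrib_left)
    finally have "hnorm h \<le> K * hnorm (M h) + e * (hnorm h / (hnorm h + 1))" using r by simp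
    also have "\<dots> \<le> K * hnorm (M h) + e * 1"
      using e hp by (intro add_left_mono mult_left_mono) auto
    finally show "hnorm h \<le> K * hnorm (M h) + e" by simp
  qed
  show "bij M"
  proof (rule bijI)
    show "inj M"
    proof (rule injI)
      fix a b assume "M a = M b"
      then have "hnorm (M (- a \<odot> b)) = 0" using d_h_hom[OF M, of a b] by simp
      with le[of "- a \<odot> b"] have "hnorm (- a \<odot> b) \<le> 0" by (simp only: mult_zero_right)
      then have "hnorm (- a \<odot> b) = 0" using hnorm_nonneg by (rule order.antisym)
      then show "a = b" by (simp add: bch_eq_0_iff)
    qed
    have "continuous_on UNIV M"
      by (rule continuous_at_imp_continuous_on) (simp add: isCont_h_hom[OF M])
    then have "open (range M)" using \<open>inj M\<close> by (intro invariance_of_domain) auto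
    moreover have "0 \<in> range M" using h_hom_0[OF M] by (metis rangeI)
    ultimately obtain \<delta> where \<delta>: "0 < \<delta>" "\<And>y. d 0 y < \<delta> \<Longrightarrow> y \<in> range M"
      using open_contains_d_ball by blast
    have "y \<in> range M" for y
    proof -
      have yp: "0 < hnorm y + 1" by (simp add: add_nonneg_pos)
      define r where "r = \<delta> / (hnorm y + 1)"
      have r: "0 < r" using \<delta>(1) yp by (simp add: r_def)
      have "d 0 (dilate r y) = r * hnorm y" using r by (simp add: hnorm_dil d_sym[of 0] flip: hnorm_def)
      also have "\<dots> < r * (hnorm y + 1)" using r by simp
      also have "\<dots> = \<delta>" using yp by (simp add: r_def)
      finally obtain w where w: "dilate r y = M w" using \<delta>(2) by blast
      have "y = dilate (1 / r) (dilate r y)" using r by (simp add: dil_dil dil_1)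
      also have "\<dots> = M (dilate (1 / r) w)" using r by (simp add: w h_hom_dil[OF M])
      finally show ?thesis by blast
    qed
    then show "surj M" by blast
  qed
qed

text \<open>If \<open>f x \<odot> w = f y\<close> and h leads from x to y, expansion gives
  \<open>hnorm h \<le> K * hnorm w\<close>, so errors small relative to h are small relative to w.
  The lower bound for M turns the distance of w and M h into one of \<open>inv M w\<close> and
  h.\<close>

lemma P_diff_inverse:
  assumes P: "P_diff br V k d f x M" and U: "open U" "x \<in> U" "open (f ` U)"
    and g: "\<And>y. y \<in> U \<Longrightarrow> g (f y) = y"
    and K: "0 < K" "\<And>y. y \<in> U \<Longrightarrow> d x y \<le> K * d (f x) (f y)"
  shows "P_diff br V k d g (f x) (inv M)"
proof -
  have M: "h_hom br V k M" using P by (simp add: P_diff_iff)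
  have bij: "bij M" and le: "\<And>h. hnorm h \<le> K * hnorm (M h)"
    using bij_of_P_diff_expanding[OF P U(1,2) K] by auto
  have inv: "h_hom br V k (inv M)" by (rule h_hom_inv[OF M bij])
  have M_inv: "M (inv M y) = y" and inv_M: "inv M (M y) = y" for y
    using bij by (simp_all add: bij_is_surj surj_f_inv_f bij_is_inj)
  have "\<exists>\<delta>>0. \<forall>w. hnorm w < \<delta> \<longrightarrow> d (- g (f x) \<odot> g (f x \<odot> w)) (inv M w) \<le> e * hnorm w" if e: "0 < e" for e
  proof -
    \<comment> \<open>One factor K converts \<open>hnorm h\<close> into \<open>hnorm w\<close>, the
      other comes from passing through the inverse of M.\<close>
    define e' where "e' = e / (K * K)"
    have "0 < e'" using e K(1) by (simp add: e'_def)
    then obtain \<delta>1 where \<delta>1: "0 < \<delta>1"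
      "\<And>h. hnorm h < \<delta>1 \<Longrightarrow> d (- f x \<odot> f (x \<odot> h)) (M h) \<le> e' * hnorm h"
      using P unfolding P_diff_iff by blast
    obtain \<delta>2 where \<delta>2: "0 < \<delta>2" "\<And>y. d (f x) y < \<delta>2 \<Longrightarrow> y \<in> f ` U"
      using open_contains_d_ball[OF U(3)] U(2) by blast
    have "d (- g (f x) \<odot> g (f x \<odot> w)) (inv M w) \<le> e * hnorm w" if w: "hnorm w < min \<delta>2 (\<delta>1 / K)" for w
    proof -
      have "f x \<odot> w \<in> f ` U" using w by (intro \<delta>2(2)) simp
      then obtain y where y: "y \<in> U" "f x \<odot> w = f y" by auto
      define h where "h = - x \<odot> y"
      have h_le: "hnorm h \<le> K * hnorm w"
        using K(2)[OF y(1)] by (simp add: h_def flip: d_eq_hnorm y(2))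
      also have "\<dots> < \<delta>1" using w K(1) by (simp add: pos_less_divide_eq mult.commute)
      finally have "d (- f x \<odot> f (x \<odot> h)) (M h) \<le> e' * hnorm h" by (rule \<delta>1(2))
      moreover have "- f x \<odot> f (x \<odot> h) = w" by (simp add: h_def flip: y(2))
      ultimately have wM: "d w (M h) \<le> e' * hnorm h" by simp
      have "d (- g (f x) \<odot> g (f x \<odot> w)) (inv M w) = d h (inv M w)"
        using g[OF U(2)] g[OF y(1)] by (simp add: y(2) h_def)
      also have "\<dots> \<le> K * hnorm (M (- h \<odot> inv M w))"
        using le[of "- h \<odot> inv M w"] by (simp add: d_eq_hnorm[of h])
      also have "hnorm (M (- h \<odot> inv M w)) = d w (M h)"
        using d_h_hom[OF M, of h "inv M w"] by (simp add: M_inv d_sym)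
      also have "K * d w (M h) \<le> K * (e' * (K * hnorm w))"
        using order.trans[OF wM mult_left_mono[OF h_le]] K(1) \<open>0 < e'\<close> by (intro mult_left_mono) auto
      also have "\<dots> = e * hnorm w" using K(1) by (simp add: e'_def)
      finally show ?thesis .
    qed
    moreover have "0 < min \<delta>2 (\<delta>1 / K)" using \<delta>1(1) \<delta>2(1) K(1) by simp
    ultimately show ?thesis by blast
  qed
  with inv show ?thesis by (simp add: P_diff_iff)
qed

theorem inverse_mapping:
  assumes \<Omega>: "open \<Omega>" and P: "\<And>x. x \<in> \<Omega> \<Longrightarrow> P_diff br V k d f x (Df x)"
    and cont: "\<And>h. continuous_on \<Omega> (\<lambda>x. Df x h)"
    and xbar: "xbar \<in> \<Omega>" and bij: "bij (Df xbar)"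
  shows "\<exists>U g. open U \<and> xbar \<in> U \<and> U \<subseteq> \<Omega> \<and> open (f ` U)
           \<and> (\<forall>x\<in>U. g (f x) = x) \<and> g ` (f ` U) \<subseteq> U
           \<and> (\<forall>y\<in>f ` U. P_diff br V k d g y (inv (Df (g y))))"
proof -
  let ?L = "Df xbar"
  have L: "h_hom br V k ?L" using P[OF xbar] by (simp add: P_diff_iff)
  have inv_L: "inv ?L (?L y) = y" for y using bij by (simp add: bij_is_inj)
  obtain CL where CL: "0 < CL" "\<And>x. hnorm (?L x) \<le> CL * hnorm x" using h_hom_bounded[OF L] by blast
  obtain C where C: "0 < C" "\<And>x. hnorm (inv ?L x) \<le> C * hnorm x"
    using h_hom_bounded[OF h_hom_inv[OF L bij]] by blast
  have L_ge: "hnorm h \<le> C * hnorm (?L h)" for h using C(2)[of "?L h"] by (simp add: inv_L)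
  obtain \<delta>1 where \<delta>1: "0 < \<delta>1" "\<And>y. d xbar y < \<delta>1 \<Longrightarrow> y \<in> \<Omega>"
    using open_contains_d_ball[OF \<Omega> xbar] by blast
  \<comment> \<open>Half of the lower bound 1 / C of the differential; subtracting the error leaves
    1 / (2 C) as lower bound for f.\<close>
  have "0 < 1 / (2 * C)" using C(1) by simp
  from strict_P_diff[OF \<Omega> P cont xbar this] obtain \<delta>2 where \<delta>2: "0 < \<delta>2"
    "\<And>x y. d xbar x < \<delta>2 \<Longrightarrow> d xbar y < \<delta>2 \<Longrightarrow>
      d (- f x \<odot> f y) (?L (- x \<odot> y)) \<le> 1 / (2 * C) * d x y" by blast
  define U where "U = {y. d xbar y < min \<delta>1 \<delta>2}"
  have U: "open U" "xbar \<in> U" "U \<subseteq> \<Omega>"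
    using open_d_ball[of xbar "min \<delta>1 \<delta>2"] \<delta>1 \<delta>2(1) by (auto simp: U_def)
  have strict: "d (- f x \<odot> f y) (?L (- x \<odot> y)) \<le> 1 / (2 * C) * d x y" if "x \<in> U" "y \<in> U" for x y
    using that by (intro \<delta>2(2)) (auto simp: U_def)
  have lower: "d x y \<le> 2 * C * d (f x) (f y)" if xy: "x \<in> U" "y \<in> U" for x y
  proof -
    have "hnorm (?L (- x \<odot> y)) \<le> d (- f x \<odot> f y) (?L (- x \<odot> y)) + d (f x) (f y)"
      using d_tri[of "?L (- x \<odot> y)" 0 "- f x \<odot> f y"]
      by (simp add: d_sym[of "?L (- x \<odot> y)" "- f x \<odot> f y"] d_eq_hnorm[of "f x"] flip: hnorm_def)
    also have "\<dots> \<le> 1 / (2 * C) * d x y + d (f x) (f y)" using strict[OF xy] by simp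
    finally have "C * hnorm (?L (- x \<odot> y)) \<le> C * (1 / (2 * C) * d x y + d (f x) (f y))"
      using C(1) by (intro mult_left_mono) auto
    then have "d x y \<le> C * (1 / (2 * C) * d x y + d (f x) (f y))"
      using L_ge[of "- x \<odot> y"] by (simp add: d_eq_hnorm[of x y])
    then show ?thesis using C(1) by (simp add: distrib_left)
  qed
  \<comment> \<open>The upper bound supplies the continuity of f on U that invariance of domain
    requires.\<close>
  have upper: "d (f x) (f y) \<le> (1 / (2 * C) + CL) * d x y" if xy: "x \<in> U" "y \<in> U" for x y
  proof -
    have "d (f x) (f y) \<le> d (- f x \<odot> f y) (?L (- x \<odot> y)) + hnorm (?L (- x \<odot> y))"
      using d_tri[of "- f x \<odot> f y" 0 "?L (- x \<odot> y)"] by (simp add: d_eq_hnorm[of "f x"] flip: hnorm_def)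
    also have "\<dots> \<le> 1 / (2 * C) * d x y + CL * d x y"
      using strict[OF xy] CL(2)[of "- x \<odot> y"] by (simp add: d_eq_hnorm[of x y])
    finally show ?thesis by (simp add: distrib_right)
  qed
  have inj: "inj_on f U"
    using lower by (intro inj_onI) (metis d_self d_eq_0_iff d_nonneg mult_zero_right order.antisym)
  have "isCont f x" if x: "x \<in> U" for x
  proof (rule isCont_d)
    fix e :: real assume e: "0 < e"
    obtain \<delta> where \<delta>: "0 < \<delta>" "\<And>y. d x y < \<delta> \<Longrightarrow> y \<in> U" using open_contains_d_ball[OF U(1) x] by blast
    let ?c = "1 / (2 * C) + CL"
    have c: "0 < ?c" using C(1) CL(1) by (simp add: add_pos_pos)
    have "d (f x) (f y) < e" if y: "d x y < min \<delta> (e / ?c)" for y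
    proof -
      have "d (f x) (f y) \<le> ?c * d x y" using y by (intro upper x \<delta>(2)) simp
      also have "\<dots> < ?c * (e / ?c)" using y c by (intro mult_strict_left_mono) auto
      also have "\<dots> = e" using c by simp
      finally show ?thesis .
    qed
    moreover have "0 < min \<delta> (e / ?c)" using \<delta>(1) e c by simp
    ultimately show "\<exists>\<delta>>0. \<forall>y. d x y < \<delta> \<longrightarrow> d (f x) (f y) < e" by blast
  qed
  then have "continuous_on U f" by (simp add: continuous_at_imp_continuous_on)
  then have fU: "open (f ` U)" using U(1) inj by (rule invariance_of_domain)
  define g where "g = inv_into U f"
  have g: "g (f x) = x" if "x \<in> U" for x using inj that by (simp add: g_def)
  have "P_diff br V k d g (f x) (inv (Df (g (f x))))" if x: "x \<in> U" for x
  proof -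
    have "P_diff br V k d f x (Df x)" using P x U(3) by blast
    from P_diff_inverse[OF this U(1) x fU g _ lower[OF x]] C(1) show ?thesis by (simp add: g x)
  qed
  with U fU g show ?thesis by (intro exI[of _ U] exI[of _ g]) auto
qed

end

theorem theorem6p3:
  fixes br :: "'v::euclidean_space \<Rightarrow> 'v \<Rightarrow> 'v"
    and V :: "nat \<Rightarrow> 'v set" and k :: nat
    and d :: "'v \<Rightarrow> 'v \<Rightarrow> real"
    and \<Omega> :: "'v set" and f :: "'v \<Rightarrow> 'v"
    and Df :: "'v \<Rightarrow> 'v \<Rightarrow> 'v" and xbar :: 'v
  assumes "stratified br V k"
    and "hom_dist br V k d"
    and "open \<Omega>"
    and "\<forall>x\<in>\<Omega>. P_diff br V k d f x (Df x)"
    and "\<forall>h. continuous_on \<Omega> (\<lambda>x. Df x h)"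
    and "xbar \<in> \<Omega>"
    and "bij (Df xbar)"
  shows "\<exists>U g. open U \<and> xbar \<in> U \<and> U \<subseteq> \<Omega> \<and> open (f ` U)
           \<and> (\<forall>x\<in>U. g (f x) = x) \<and> g ` (f ` U) \<subseteq> U
           \<and> (\<forall>y\<in>f ` U. P_diff br V k d g y (inv (Df (g y))))"
proof -
  have "graded_lie_algebra br V k" using assms(1) by (simp add: stratified_def)
  then interpret stratified_group br V k d
    using assms(1,2) by unfold_locales
  show ?thesis by (rule inverse_mapping) (use assms in auto)
qed

end
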